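(* In the setting of the context, let $W^\Psi(t):=\int_0^tS(t-\tau)\Psi(\tau)\,dW(\tau)$, $t\in[0,T]$. If $\Psi\in\mathcal N^2(0,T;L_2^0)$, then the following estimate holds: $$\sup_{t\le T}\,\mathbb E\big(|W^\Psi(t)|_H\big)\le C\,M_T\,\mathbb E\left(\int_0^T|\Psi(t)|_{L_2^0}^2\,dt\right)^{\frac12},$$ where $C$ is a constant and $M_T=\sup_{t\le T}\|S(t)\|$ (operator norm). On the right-hand side the expectation is taken of the square root of the integral.
   Context: $H$ and $U$ are separable Hilbert spaces and the finite interval $[0,T]$ is fixed. $(\Omega,\mathcal F,(\mathcal F_t)_{t\ge0},P)$ is a filtered probability space whose filtration is normal ($\mathcal F_0$ contains all sets $B\in\mathcal F$ with $P(B)=0$, and $\mathcal F_t=\bigcap_{s>t}\mathcal F_s$). $W$ is a cylindrical Wiener process on this space with nonnegative covariance operator $Q\in L(U)$ ($\mathrm{Tr}\,Q<\infty$ is not assumed). There is a complete orthonormal set $\{e_k\}\subset U$ of eigenvectors of $Q$ with eigenvalues $\lambda_k$, and $W(t)=\sum_k e_k\beta_k(t)$ with independent real Wiener processes $\beta_k$, $\mathbb E\beta_k^2(t)=\lambda_k t$. $U_0:=Q^{1/2}(U)$ with inner product $\langle u,v\rangle_{U_0}=\langle Q^{-1/2}u,Q^{-1/2}v\rangle_U$. $L_2^0:=L_2(U_0,H)$ is the space of Hilbert-Schmidt operators from $U_0$ to $H$ with the Hilbert-Schmidt norm $|\cdot|_{L_2^0}$. $\mathcal N^2(0,T;L_2^0)$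 is the space of $L_2^0$-valued predictable processes $\Phi$ on $[0,T]$ with $\mathbb E\int_0^T|\Phi(\tau)|_{L_2^0}^2\,d\tau<\infty$. Stochastic integrals are the usual Hilbert-space stochastic integrals with respect to the cylindrical Wiener process $W$. Volterra assumptions: $A:D(A)\subset H\to H$ is a closed, densely defined unbounded linear operator; $a\in L^1_{\mathrm{loc}}(\mathbb R_+)$; and the deterministic Volterra equation $X(t)=X_0+\int_0^t a(t-\tau)AX(\tau)\,d\tau+f(t)$ is well-posed, i.e. it admits a resolvent $(S(t))_{t\ge0}$: a family of bounded linear operators on $H$ such that (1) $S$ is strongly continuous on $\mathbb R_+$ and $S(0)=I$; (2) $S(t)D(A)\subset D(A)$ and $AS(t)x=S(t)Ax$ for $x\in D(A)$, $t\ge0$; (3) $S(t)x=x+\int_0^t a(t-\tau)AS(\tau)x\,d\tau$ for all $x\in D(A)$, $t\ge0$. *)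

theory Defs
  imports "HOL-Probability.Probability"
begin

section \<open>The spaces \<open>U\<^sub>0\<close> and \<open>L\<^sub>2\<^sup>0\<close>\<close>

definition nonneg_op :: "('u::real_inner \<Rightarrow>\<^sub>L 'u) \<Rightarrow> bool" where
  "nonneg_op R \<longleftrightarrow>
     (\<forall>u v. blinfun_apply R u \<bullet> v = u \<bullet> blinfun_apply R v) \<and> (\<forall>u. 0 \<le> blinfun_apply R u \<bullet> u)"

definition op_sqrt :: "('u::real_inner \<Rightarrow>\<^sub>L 'u) \<Rightarrow> ('u \<Rightarrow>\<^sub>L 'u)" where
  "op_sqrt Q = (THE R. nonneg_op R \<and> R o\<^sub>L R = Q)"

definition U0 :: "('u::real_inner \<Rightarrow>\<^sub>L 'u) \<Rightarrow> 'u set" where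
  "U0 Q = range (blinfun_apply (op_sqrt Q))"

text \<open>\<open>Q\<close> need not be injective, so \<open>Q\<^sup>-\<^sup>1\<^sup>/\<^sup>2\<close> on \<open>U0 Q\<close> is the pseudo-inverse: the preimage
  orthogonal to the kernel of the square root.\<close>

definition inv_sqrt :: "('u::real_inner \<Rightarrow>\<^sub>L 'u) \<Rightarrow> 'u \<Rightarrow> 'u" where
  "inv_sqrt Q u = (THE v. blinfun_apply (op_sqrt Q) v = u \<and>
     (\<forall>w. blinfun_apply (op_sqrt Q) w = 0 \<longrightarrow> v \<bullet> w = 0))"

definition U0_inner :: "('u::real_inner \<Rightarrow>\<^sub>L 'u) \<Rightarrow> 'u \<Rightarrow> 'u \<Rightarrow> real" where
  "U0_inner Q u v = inv_sqrt Q u \<bullet> inv_sqrt Q v"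

definition U0_onb :: "('u::real_inner \<Rightarrow>\<^sub>L 'u) \<Rightarrow> 'u set \<Rightarrow> bool" where
  "U0_onb Q B \<longleftrightarrow> B \<subseteq> U0 Q \<and>
     (\<forall>b\<in>B. \<forall>c\<in>B. U0_inner Q b c = (if b = c then 1 else 0)) \<and>
     (\<forall>u\<in>U0 Q. (\<forall>b\<in>B. U0_inner Q u b = 0) \<longrightarrow> u = 0)"

text \<open>The Hilbert--Schmidt norm does not depend on the orthonormal basis, so an arbitrary one
  is chosen.\<close>

definition U0_basis :: "('u::real_inner \<Rightarrow>\<^sub>L 'u) \<Rightarrow> 'u set" where
  "U0_basis Q = (SOME B. U0_onb Q B)"

definition hs_norm :: "('u::real_inner \<Rightarrow>\<^sub>L 'u) \<Rightarrow> ('u \<Rightarrow> 'h::real_inner) \<Rightarrow> real" where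
  "hs_norm Q L = sqrt (\<Sum>\<^sub>\<infinity>b\<in>U0_basis Q. (norm (L b))\<^sup>2)"

text \<open>Operators on \<open>U0 Q\<close> are represented by functions on all of the ambient space that vanish
  outside \<open>U0 Q\<close>, so that equality of operators is equality of functions.\<close>

definition L20 :: "('u::real_inner \<Rightarrow>\<^sub>L 'u) \<Rightarrow> ('u \<Rightarrow> 'h::real_inner) set" where
  "L20 Q = {L.
     (\<forall>u. u \<notin> U0 Q \<longrightarrow> L u = 0) \<and>
     (\<forall>u\<in>U0 Q. \<forall>v\<in>U0 Q. L (u + v) = L u + L v) \<and>
     (\<forall>c. \<forall>u\<in>U0 Q. L (c *\<^sub>R u) = c *\<^sub>R L u) \<and>
     (\<exists>b. \<forall>u\<in>U0 Q. norm (L u) \<le> b * sqrt (U0_inner Q u u)) \<and>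
     (\<lambda>b. (norm (L b))\<^sup>2) summable_on U0_basis Q}"

definition L20_borel :: "('u::real_inner \<Rightarrow>\<^sub>L 'u) \<Rightarrow> ('u \<Rightarrow> 'h::real_inner) measure" where
  "L20_borel Q = sigma (L20 Q)
     {V. openin (Metric_space.mtopology (L20 Q) (\<lambda>L L'. hs_norm Q (\<lambda>u. L u - L' u))) V}"


section \<open>Filtrations and Wiener processes\<close>

locale normal_filtration = prob_space M for M :: "'w measure" +
  fixes F :: "real \<Rightarrow> 'w measure"
  assumes space_F: "0 \<le> t \<Longrightarrow> space (F t) = space M"
    and sets_F: "0 \<le> t \<Longrightarrow> sets (F t) \<subseteq> sets M"
    and F_mono: "0 \<le> s \<Longrightarrow> s \<le> t \<Longrightarrow> sets (F s) \<subseteq> sets (F t)"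
    and F_null: "B \<in> sets M \<Longrightarrow> prob B = 0 \<Longrightarrow> B \<in> sets (F 0)"
    and F_right_cont: "0 \<le> t \<Longrightarrow> sets (F t) = (\<Inter>s\<in>{t<..}. sets (F s))"

text \<open>Variance \<open>l * t\<close> at time \<open>t\<close>; the degenerate case \<open>l = 0\<close> (zero eigenvalue of the
  covariance) is allowed.\<close>

locale real_wiener = normal_filtration M F for M :: "'w measure" and F +
  fixes l :: real and B :: "real \<Rightarrow> 'w \<Rightarrow> real"
  assumes adapted: "0 \<le> t \<Longrightarrow> B t \<in> borel_measurable (F t)"
    and start: "AE \<omega> in M. B 0 \<omega> = 0"
    and paths: "AE \<omega> in M. continuous_on {0..} (\<lambda>t. B t \<omega>)"
    and increments_indep: "0 \<le> s \<Longrightarrow> s \<le> t \<Longrightarrow>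
      indep_set (sets (F s)) (sets (vimage_algebra (space M) (\<lambda>\<omega>. B t \<omega> - B s \<omega>) borel))"
    and increments_normal: "0 \<le> s \<Longrightarrow> s < t \<Longrightarrow> l > 0 \<Longrightarrow>
      distributed M lborel (\<lambda>\<omega>. B t \<omega> - B s \<omega>) (normal_density 0 (sqrt (l * (t - s))))"
    and increments_zero: "0 \<le> s \<Longrightarrow> s < t \<Longrightarrow> l = 0 \<Longrightarrow> AE \<omega> in M. B t \<omega> = B s \<omega>"

text \<open>Without a trace condition on \<open>Q\<close>, the sum \<open>W(t) = \<Sum>k. \<beta> k t * e k\<close> does not converge
  in \<open>U\<close>. A cylindrical process is therefore given by its pairings: \<open>W t u\<close> stands for
  \<open>\<langle>W(t), u\<rangle>\<close>, and the sum is required to converge in mean square after pairing with each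
  \<open>u\<close>. The index set \<open>K\<close> is finite if \<open>U\<close> is finite-dimensional.\<close>

locale cylindrical_wiener = normal_filtration M F for M :: "'w measure" and F +
  fixes Q :: "'u::{real_inner, banach, second_countable_topology} \<Rightarrow>\<^sub>L 'u"
    and K :: "nat set" and e :: "nat \<Rightarrow> 'u" and lam :: "nat \<Rightarrow> real"
    and \<beta> :: "nat \<Rightarrow> real \<Rightarrow> 'w \<Rightarrow> real"
    and W :: "real \<Rightarrow> 'u \<Rightarrow> 'w \<Rightarrow> real"
  assumes Q_nonneg: "nonneg_op Q"
    and e_orthonormal: "j \<in> K \<Longrightarrow> k \<in> K \<Longrightarrow> e j \<bullet> e k = (if j = k then 1 else 0)"
    and e_complete: "closure (span (e ` K)) = UNIV"
    and e_eigen: "k \<in> K \<Longrightarrow> blinfun_apply Q (e k) = lam k *\<^sub>R e k"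
    and \<beta>_wiener: "k \<in> K \<Longrightarrow> real_wiener M F (lam k) (\<beta> k)"
    and \<beta>_indep: "indep_vars (\<lambda>_. PiM {0..} (\<lambda>_. borel)) (\<lambda>k \<omega>. \<lambda>t\<in>{0..}. \<beta> k t \<omega>) K"
    and W_adapted: "0 \<le> t \<Longrightarrow> W t u \<in> borel_measurable (F t)"
    and W_increments_indep: "0 \<le> s \<Longrightarrow> s \<le> t \<Longrightarrow>
      indep_set (sets (F s))
        (sets (vimage_algebra (space M) (\<lambda>\<omega> u. W t u \<omega> - W s u \<omega>) (PiM UNIV (\<lambda>_. borel))))"
    and W_expansion: "0 \<le> t \<Longrightarrow>
      ((\<lambda>J. \<integral>\<^sup>+\<omega>. ennreal ((W t u \<omega> - (\<Sum>k\<in>J. (e k \<bullet> u) * \<beta> k t \<omega>))\<^sup>2) \<partial>M) \<longlongrightarrow> 0)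
        (finite_subsets_at_top K)"


section \<open>Stochastic integration\<close>

definition predictable :: "'w measure \<Rightarrow> (real \<Rightarrow> 'w measure) \<Rightarrow> real \<Rightarrow> (real \<times> 'w) measure" where
  "predictable M F T = sigma ({0..T} \<times> space M)
     ({{s<..t} \<times> A | s t A. 0 \<le> s \<and> s < t \<and> t \<le> T \<and> A \<in> sets (F s)} \<union>
      {{0} \<times> A | A. A \<in> sets (F 0)})"

definition N2 :: "'w measure \<Rightarrow> (real \<Rightarrow> 'w measure) \<Rightarrow> ('u::real_inner \<Rightarrow>\<^sub>L 'u) \<Rightarrow> real
    \<Rightarrow> (real \<Rightarrow> 'w \<Rightarrow> 'u \<Rightarrow> 'h::real_inner) set" where
  "N2 M F Q T = {\<Phi>.
     (\<lambda>(t, \<omega>). \<Phi> t \<omega>) \<in> measurable (predictable M F T) (L20_borel Q) \<and>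
     (\<integral>\<^sup>+\<omega>. (\<integral>\<^sup>+\<tau>\<in>{0..T}. ennreal ((hs_norm Q (\<Phi> \<tau> \<omega>))\<^sup>2) \<partial>lborel) \<partial>M) < \<infinity>}"

text \<open>The list entry \<open>(s, r, A, v, h)\<close> stands for the process
  \<open>1\<^bsub>(s,r]\<^esub> 1\<^bsub>A\<^esub> \<langle>v, \<cdot>\<rangle> h\<close>; its integral is \<open>1\<^bsub>A\<^esub> \<langle>W(r) - W(s), v\<rangle> h\<close>. Sums of these are
  the elementary processes with finite-rank values, which are dense in \<open>N2 M F Q t\<close>.\<close>

type_synonym ('w, 'u, 'h) elementary = "(real \<times> real \<times> 'w set \<times> 'u \<times> 'h) list"

definition elementary :: "(real \<Rightarrow> 'w measure) \<Rightarrow> real \<Rightarrow> ('w, 'u, 'h) elementary \<Rightarrow> bool" where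
  "elementary F t E \<longleftrightarrow> (\<forall>(s, r, A, v, h)\<in>set E. 0 \<le> s \<and> s < r \<and> r \<le> t \<and> A \<in> sets (F s))"

definition elem_process :: "('u::real_inner \<Rightarrow>\<^sub>L 'u) \<Rightarrow> ('w, 'u, 'h::real_inner) elementary
    \<Rightarrow> real \<Rightarrow> 'w \<Rightarrow> 'u \<Rightarrow> 'h" where
  "elem_process Q E \<tau> \<omega> u = (if u \<in> U0 Q then
     (\<Sum>(s, r, A, v, h)\<leftarrow>E. (indicator {s<..r} \<tau> * indicator A \<omega> * (v \<bullet> u)) *\<^sub>R h) else 0)"

definition elem_integral :: "(real \<Rightarrow> 'u \<Rightarrow> 'w \<Rightarrow> real) \<Rightarrow> ('w, 'u, 'h::real_inner) elementary
    \<Rightarrow> 'w \<Rightarrow> 'h" where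
  "elem_integral W E \<omega> =
     (\<Sum>(s, r, A, v, h)\<leftarrow>E. (indicator A \<omega> * (W r v \<omega> - W s v \<omega>)) *\<^sub>R h)"

definition has_stoch_integral :: "'w measure \<Rightarrow> (real \<Rightarrow> 'w measure) \<Rightarrow> ('u::real_inner \<Rightarrow>\<^sub>L 'u)
    \<Rightarrow> (real \<Rightarrow> 'u \<Rightarrow> 'w \<Rightarrow> real) \<Rightarrow> real \<Rightarrow> (real \<Rightarrow> 'w \<Rightarrow> 'u \<Rightarrow> 'h::real_inner)
    \<Rightarrow> ('w \<Rightarrow> 'h) \<Rightarrow> bool" where
  "has_stoch_integral M F Q W t \<Phi> X \<longleftrightarrow>
     \<Phi> \<in> N2 M F Q t \<and> X \<in> borel_measurable M \<and>
     (\<integral>\<^sup>+\<omega>. ennreal ((norm (X \<omega>))\<^sup>2) \<partial>M) < \<infinity> \<and>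
     (\<exists>E. (\<forall>n. elementary F t (E n)) \<and>
        (\<lambda>n. \<integral>\<^sup>+\<omega>. (\<integral>\<^sup>+\<tau>\<in>{0..t}. ennreal
           ((hs_norm Q (\<lambda>u. elem_process Q (E n) \<tau> \<omega> u - \<Phi> \<tau> \<omega> u))\<^sup>2) \<partial>lborel) \<partial>M) \<longlonglongrightarrow> 0 \<and>
        (\<lambda>n. \<integral>\<^sup>+\<omega>. ennreal ((norm (elem_integral W (E n) \<omega> - X \<omega>))\<^sup>2) \<partial>M) \<longlonglongrightarrow> 0)"

text \<open>The integral over \<open>[0, t]\<close> is determined up to a null set; a version is chosen.\<close>

definition stoch_integral :: "'w measure \<Rightarrow> (real \<Rightarrow> 'w measure) \<Rightarrow> ('u::real_inner \<Rightarrow>\<^sub>L 'u)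
    \<Rightarrow> (real \<Rightarrow> 'u \<Rightarrow> 'w \<Rightarrow> real) \<Rightarrow> real \<Rightarrow> (real \<Rightarrow> 'w \<Rightarrow> 'u \<Rightarrow> 'h::real_inner)
    \<Rightarrow> 'w \<Rightarrow> 'h" where
  "stoch_integral M F Q W t \<Phi> = (SOME X. has_stoch_integral M F Q W t \<Phi> X)"


section \<open>Volterra equations and the stochastic convolution\<close>

locale volterra_resolvent =
  fixes D :: "'h::{real_inner, banach, second_countable_topology} set"
    and A :: "'h \<Rightarrow> 'h" and a :: "real \<Rightarrow> real" and S :: "real \<Rightarrow> 'h \<Rightarrow>\<^sub>L 'h"
  assumes D_subspace: "subspace D"
    and A_add: "x \<in> D \<Longrightarrow> y \<in> D \<Longrightarrow> A (x + y) = A x + A y"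
    and A_scale: "x \<in> D \<Longrightarrow> A (c *\<^sub>R x) = c *\<^sub>R A x"
    and A_dense: "closure D = UNIV"
    and A_closed: "closed {(x, A x) | x. x \<in> D}"
    and A_unbounded: "\<not> (\<exists>b. \<forall>x\<in>D. norm (A x) \<le> b * norm x)"
    and a_L1_loc: "0 \<le> r \<Longrightarrow> a absolutely_integrable_on {0..r}"
    and S_cont: "continuous_on {0..} (\<lambda>t. blinfun_apply (S t) x)"
    and S_0: "S 0 = id_blinfun"
    and S_D: "0 \<le> t \<Longrightarrow> x \<in> D \<Longrightarrow> blinfun_apply (S t) x \<in> D"
    and S_commute: "0 \<le> t \<Longrightarrow> x \<in> D \<Longrightarrow> A (blinfun_apply (S t) x) = blinfun_apply (S t) (A x)"
    and S_equation: "0 \<le> t \<Longrightarrow> x \<in> D \<Longrightarrow>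
      blinfun_apply (S t) x =
        x + (LINT \<tau>:{0..t}|lebesgue. a (t - \<tau>) *\<^sub>R A (blinfun_apply (S \<tau>) x))"

definition stoch_convolution :: "'w measure \<Rightarrow> (real \<Rightarrow> 'w measure) \<Rightarrow> ('u::real_inner \<Rightarrow>\<^sub>L 'u)
    \<Rightarrow> (real \<Rightarrow> 'u \<Rightarrow> 'w \<Rightarrow> real) \<Rightarrow> (real \<Rightarrow> 'h::real_inner \<Rightarrow>\<^sub>L 'h)
    \<Rightarrow> (real \<Rightarrow> 'w \<Rightarrow> 'u \<Rightarrow> 'h) \<Rightarrow> real \<Rightarrow> 'w \<Rightarrow> 'h" where
  "stoch_convolution M F Q W S \<Psi> t =
     stoch_integral M F Q W t (\<lambda>\<tau> \<omega> u. blinfun_apply (S (t - \<tau>)) (\<Psi> \<tau> \<omega> u))"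

end

theory Submission
  imports Defs
begin

text \<open>For an elementary integrand the integral is a finite sum of martingale differences whose
  conditional energy at a partition point is already known at the preceding point. Cutting the
  integrand off as soon as the energy exceeds \<open>c\<^sup>2\<close> and using the isometry together with Chebyshev's
  inequality gives \<open>P(|I| > c) \<le> P(V\<^sup>1\<^sup>/\<^sup>2 > c) + E min(1, V / c\<^sup>2)\<close>, and integration over \<open>c\<close> yields
  \<open>E |I| \<le> 3 E V\<^sup>1\<^sup>/\<^sup>2\<close> for the terminal energy \<open>V\<close>. Elementary integrands are
  dense, so the stochastic integral exists and inherits the bound up to a factor \<open>2\<close>. For fixed
  \<open>t\<close> this applies to \<open>S(t - \<tau>) \<Psi>(\<tau>)\<close>, whose Hilbert--Schmidt norm is at most \<open>M\<^sub>T\<close> times that of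
  \<open>\<Psi>(\<tau>)\<close>; it is predictable because \<open>(\<tau>, L) \<mapsto> S(t - \<tau>) L\<close> is jointly continuous, and \<open>M\<^sub>T\<close> is finite by
  uniform boundedness.\<close>

section \<open>Orthonormal families\<close>

text \<open>The isometry alone yields only \<open>(E V)^(1/2)\<close>, which dominates the quantity
  \<open>E V^(1/2)\<close> wanted here, so the second moment has to be localised. This works without
  overshoot because on \<open>(p k, p (Suc k)]\<close> the integrand is fixed at time
  \<open>p k\<close>: an interval can be discarded before its increment is seen, and the energy kept
  never exceeds the level. The final constant is 6 = 3 * 2. Here 3 = 1 + 2 comes from the tail of
  the energy and from integrating \<open>min 1 (z^2 / c^2)\<close> over \<open>c\<close>, and 2 from
  a crude bound for the square root of \<open>2 * y + 2 * z\<close> in the passage to the limit.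

  Several objects are given by choice: the square root of \<open>Q\<close>, the basis of
  \<open>U0 Q\<close>, the integral itself. Each needs an existence proof before anything can be
  said about it. Predictability occurs in two strengths: measurable coordinates suffice for norms
  and density, whereas \<open>N2\<close> asks for measurability into the Borel sets of the metric
  space \<open>L20 Q\<close>, and this has to be proved for the integrand of the
  convolution.\<close>

definition orthonormal_on :: "'i set \<Rightarrow> ('i \<Rightarrow> 'u::real_inner) \<Rightarrow> bool" where
  "orthonormal_on I g \<longleftrightarrow> (\<forall>i\<in>I. \<forall>j\<in>I. g i \<bullet> g j = (if i = j then 1 else 0))"

lemma orthonormal_onD:
  "orthonormal_on I g \<Longrightarrow> i \<in> I \<Longrightarrow> j \<in> I \<Longrightarrow> g i \<bullet> g j = (if i = j then 1 else 0)"
  by (simp add: orthonormal_on_def)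

lemma orthonormal_sum_inner:
  assumes "orthonormal_on I g" "finite F" "F \<subseteq> I" "j \<in> F"
  shows "(\<Sum>i\<in>F. c i *\<^sub>R g i) \<bullet> g j = c j"
proof -
  have "(\<Sum>i\<in>F. c i *\<^sub>R g i) \<bullet> g j = (\<Sum>i\<in>F. c i * (if i = j then 1 else 0))"
    unfolding inner_sum_left using assms
    by (intro sum.cong) (auto simp: orthonormal_onD subset_iff)
  also have "\<dots> = c j" using assms(2,4) by (simp add: if_distrib cong: if_cong)
  finally show ?thesis .
qed

lemma orthonormal_norm_sum:
  assumes "orthonormal_on I g" "finite F" "F \<subseteq> I"
  shows "(norm (\<Sum>i\<in>F. c i *\<^sub>R g i))\<^sup>2 = (\<Sum>i\<in>F. (c i)\<^sup>2)"
proof -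
  have "(norm (\<Sum>i\<in>F. c i *\<^sub>R g i))\<^sup>2 = (\<Sum>j\<in>F. c j * ((\<Sum>i\<in>F. c i *\<^sub>R g i) \<bullet> g j))"
    unfolding power2_norm_eq_inner by (simp only: inner_sum_right inner_scaleR_right)
  also have "\<dots> = (\<Sum>j\<in>F. c j * c j)"
    using assms by (intro sum.cong refl) (simp add: orthonormal_sum_inner)
  finally show ?thesis by (simp add: power2_eq_square)
qed

lemma bessel_finite:
  assumes "orthonormal_on I g" "finite F" "F \<subseteq> I"
  shows "(\<Sum>i\<in>F. (x \<bullet> g i)\<^sup>2) \<le> (norm x)\<^sup>2"
proof -
  define s where "s = (\<Sum>i\<in>F. (x \<bullet> g i) *\<^sub>R g i)"
  have "x \<bullet> s = (\<Sum>i\<in>F. (x \<bullet> g i)\<^sup>2)"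
    by (simp add: s_def inner_sum_right power2_eq_square)
  moreover have "(norm s)\<^sup>2 = (\<Sum>i\<in>F. (x \<bullet> g i)\<^sup>2)"
    unfolding s_def by (rule orthonormal_norm_sum[OF assms])
  moreover have "0 \<le> (norm (x - s))\<^sup>2" by simp
  ultimately show ?thesis
    by (simp add: power2_norm_eq_inner inner_diff_left inner_diff_right inner_commute)
qed

lemma bessel_summable:
  assumes "orthonormal_on I g"
  shows "(\<lambda>i. (x \<bullet> g i)\<^sup>2) summable_on I"
  by (rule nonneg_bdd_above_summable_on)
     (auto intro!: bdd_aboveI[where M = "(norm x)\<^sup>2"] bessel_finite[OF assms])

text \<open>The Riesz-Fischer theorem for an arbitrary index set: by Pythagoras a block of terms has
  squared norm equal to the matching block of the convergent series of squares, so the net of finite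
  partial sums is Cauchy.\<close>

lemma orthonormal_summable:
  fixes g :: "'i \<Rightarrow> 'u::{real_inner, banach}"
  assumes on: "orthonormal_on I g" and sm: "(\<lambda>i. (c i)\<^sup>2) summable_on I"
  shows "(\<lambda>i. c i *\<^sub>R g i) summable_on I"
proof -
  let ?f = "\<lambda>i. c i *\<^sub>R g i"
  define L where "L = infsum (\<lambda>i. (c i)\<^sup>2) I"
  have lim: "(sum (\<lambda>i. (c i)\<^sup>2) \<longlongrightarrow> L) (finite_subsets_at_top I)"
    unfolding L_def by (rule infsum_tendsto[OF sm])
  have "\<exists>P. eventually P (finite_subsets_at_top I) \<and>
              (\<forall>F F'. P F \<and> P F' \<longrightarrow> dist (sum ?f F) (sum ?f F') < e)" if "e>0" for e
  proof -
    \<comment> \<open>A block outside \<open>F0\<close> then has squared norm below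
      \<open>e^2/4\<close>, hence norm below \<open>e/2\<close>; any two large finite sets are
      compared through \<open>F0\<close>.\<close>
    have "eventually (\<lambda>F. dist (sum (\<lambda>i. (c i)\<^sup>2) F) L < e\<^sup>2/4) (finite_subsets_at_top I)"
      using lim that by (intro tendstoD) auto
    then obtain F0 where F0: "finite F0" "F0 \<subseteq> I"
      and close: "\<And>F. finite F \<Longrightarrow> F0 \<subseteq> F \<Longrightarrow> F \<subseteq> I \<Longrightarrow> dist (sum (\<lambda>i. (c i)\<^sup>2) F) L < e\<^sup>2/4"
      by (auto simp: eventually_finite_subsets_at_top)
    have small: "dist (sum ?f F) (sum ?f F0) < e/2" if F: "finite F" "F0 \<subseteq> F" "F \<subseteq> I" for F
    proof -
      have bd: "sum (\<lambda>i. (c i)\<^sup>2) (F - F0) = sum (\<lambda>i. (c i)\<^sup>2) F - sum (\<lambda>i. (c i)\<^sup>2) F0"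
        using F F0 by (simp add: sum_diff)
      have tail: "sum (\<lambda>i. (c i)\<^sup>2) F \<le> L"
        unfolding L_def using F by (intro finite_sum_le_infsum[OF sm]) auto
      have "dist (sum (\<lambda>i. (c i)\<^sup>2) F0) L < e\<^sup>2/4" using close F0 by auto
      then have "sum (\<lambda>i. (c i)\<^sup>2) (F - F0) < e\<^sup>2/4"
        using bd tail by (auto simp: dist_real_def abs_if split: if_splits)
      then have "(norm (sum ?f (F - F0)))\<^sup>2 < (e/2)\<^sup>2"
        using orthonormal_norm_sum[OF on finite_Diff[OF F(1)], of F0 c] F(3)
        by (simp add: power_divide subset_iff)
      then have "norm (sum ?f (F - F0)) < e/2"
        by (rule power2_less_imp_less) (use \<open>e > 0\<close> in simp)
      then show ?thesis
        unfolding dist_norm using F F0 by (simp add: sum_diff)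
    qed
    show ?thesis
    proof (intro exI[of _ "\<lambda>F. finite F \<and> F0 \<subseteq> F \<and> F \<subseteq> I"] conjI allI impI)
      show "\<forall>\<^sub>F F in finite_subsets_at_top I. finite F \<and> F0 \<subseteq> F \<and> F \<subseteq> I"
        using F0 by (auto simp: eventually_finite_subsets_at_top)
    next
      fix F F' assume "(finite F \<and> F0 \<subseteq> F \<and> F \<subseteq> I) \<and> finite F' \<and> F0 \<subseteq> F' \<and> F' \<subseteq> I"
      then have "dist (sum ?f F) (sum ?f F0) < e/2" "dist (sum ?f F') (sum ?f F0) < e/2"
        using small by auto
      then show "dist (sum ?f F) (sum ?f F') < e"
        using dist_triangle_half_l by blast
    qed
  qed
  then have "cauchy_filter (filtermap (sum ?f) (finite_subsets_at_top I))"
    by (simp add: cauchy_filter_metric_filtermap)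
  moreover have "uniform_space_class.complete (UNIV::'u set)"
    by (rule complete_UNIV)
  ultimately obtain L' where "(sum ?f \<longlongrightarrow> L') (finite_subsets_at_top I)"
    using complete_uniform[where S=UNIV] by (force simp add: filterlim_def)
  then show ?thesis
    using summable_on_def has_sum_def by blast
qed

lemma has_sum_inner:
  fixes f :: "'i \<Rightarrow> 'u::real_inner"
  assumes "(f has_sum x) I"
  shows "((\<lambda>i. f i \<bullet> y) has_sum (x \<bullet> y)) I"
  using has_sum_bounded_linear[OF bounded_linear_inner_left assms] by simp

lemma has_sum_orthonormal_inner:
  assumes on: "orthonormal_on I g" and hs: "((\<lambda>i. c i *\<^sub>R g i) has_sum x) I" and j: "j \<in> I"
  shows "x \<bullet> g j = c j"
proof -
  have "((\<lambda>i. (c i *\<^sub>R g i) \<bullet> g j) has_sum (x \<bullet> g j)) I"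
    by (rule has_sum_inner[OF hs])
  moreover have "((\<lambda>i. (c i *\<^sub>R g i) \<bullet> g j) has_sum c j) I"
    using j by (intro has_sum_finite_neutralI[of "{j}"]) (auto simp: orthonormal_onD[OF on])
  ultimately show ?thesis using has_sum_unique by blast
qed

text \<open>\<open>P\<close> describes a closed subspace in which the family is maximal.\<close>

lemma orthonormal_expansion:
  fixes g :: "'i \<Rightarrow> 'u::{real_inner, banach}"
  assumes on: "orthonormal_on I g"
    and maximal: "\<And>r. (\<And>i. i \<in> I \<Longrightarrow> r \<bullet> g i = 0) \<Longrightarrow> P r \<Longrightarrow> r = 0"
    and closed: "\<And>s. ((\<lambda>i. (x \<bullet> g i) *\<^sub>R g i) has_sum s) I \<Longrightarrow> P (x - s)"
  shows "((\<lambda>i. (x \<bullet> g i) *\<^sub>R g i) has_sum x) I"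
proof -
  define s where "s = infsum (\<lambda>i. (x \<bullet> g i) *\<^sub>R g i) I"
  have s: "((\<lambda>i. (x \<bullet> g i) *\<^sub>R g i) has_sum s) I"
    unfolding s_def
    using orthonormal_summable[OF on bessel_summable[OF on]] by (rule has_sum_infsum)
  have "x - s = 0"
    using has_sum_orthonormal_inner[OF on s] by (intro maximal closed[OF s]) (simp add: inner_diff_left)
  then show ?thesis using s by simp
qed

lemma parseval_inner:
  assumes "((\<lambda>i. (x \<bullet> g i) *\<^sub>R g i) has_sum x) I"
  shows "((\<lambda>i. (x \<bullet> g i) * (y \<bullet> g i)) has_sum (x \<bullet> y)) I"
  using has_sum_inner[OF assms, of y] by (simp add: inner_commute)

section \<open>Diagonal operators and their square roots\<close>

text \<open>These are the assumptions of \<open>cylindrical_wiener\<close> that concern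
  \<open>Q\<close> alone. The operator theory is done here, free of probability, and imported by a
  sublocale. Vectors are mostly compared by their coordinates along \<open>e\<close>.\<close>

locale diagonal_operator =
  fixes Q :: "'u::{real_inner, banach, second_countable_topology} \<Rightarrow>\<^sub>L 'u"
    and K :: "nat set" and e :: "nat \<Rightarrow> 'u" and lam :: "nat \<Rightarrow> real"
  assumes Q_nonneg: "nonneg_op Q"
    and e_orthonormal: "j \<in> K \<Longrightarrow> k \<in> K \<Longrightarrow> e j \<bullet> e k = (if j = k then 1 else 0)"
    and e_complete: "closure (span (e ` K)) = UNIV"
    and e_eigen: "k \<in> K \<Longrightarrow> blinfun_apply Q (e k) = lam k *\<^sub>R e k"
begin

lemma e_on: "orthonormal_on K e"
  using e_orthonormal by (simp add: orthonormal_on_def)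

lemma Q_sym: "blinfun_apply Q u \<bullet> v = u \<bullet> blinfun_apply Q v"
  using Q_nonneg by (auto simp: nonneg_op_def)

lemma lam_nonneg: "k \<in> K \<Longrightarrow> 0 \<le> lam k"
  using Q_nonneg e_eigen[of k] e_orthonormal[of k k] by (auto simp: nonneg_op_def dest: spec[of _ "e k"])

lemma e_maximal:
  assumes "\<And>k. k \<in> K \<Longrightarrow> x \<bullet> e k = 0"
  shows "x = 0"
proof -
  have sp: "y \<in> span (e ` K) \<Longrightarrow> x \<bullet> y = 0" for y
    by (induction rule: span_induct)
       (use assms in \<open>auto simp: inner_add_right subspace_def\<close>)
  have "closure (span (e ` K)) \<subseteq> {y. x \<bullet> y = 0}"
    by (intro closure_minimal closed_Collect_eq continuous_intros) (auto simp: sp)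
  then have "x \<bullet> x = 0" unfolding e_complete by blast
  then show ?thesis by simp
qed

lemma e_eqI: "(\<And>k. k \<in> K \<Longrightarrow> x \<bullet> e k = y \<bullet> e k) \<Longrightarrow> x = y"
  using e_maximal[of "x - y"] by (simp add: inner_diff_left)

lemma e_expansion: "((\<lambda>k. (x \<bullet> e k) *\<^sub>R e k) has_sum x) K"
  by (rule orthonormal_expansion[OF e_on, where P = "\<lambda>_. True"]) (auto intro: e_maximal)

lemma e_parseval: "((\<lambda>k. (x \<bullet> e k) * (y \<bullet> e k)) has_sum (x \<bullet> y)) K"
  by (rule parseval_inner[OF e_expansion])

lemma Q_inner_e: "k \<in> K \<Longrightarrow> blinfun_apply Q x \<bullet> e k = lam k * (x \<bullet> e k)"
  by (simp add: Q_sym e_eigen)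

lemma lam_le: "k \<in> K \<Longrightarrow> lam k \<le> norm Q"
  using norm_blinfun[of Q "e k"] e_eigen[of k] e_orthonormal[of k k] lam_nonneg[of k]
  by (simp add: norm_eq_sqrt_inner)

text \<open>With \<open>mu = sqrt (lam k)\<close> the product
  \<open>(R + mu) (R - mu) = Q - mu^2\<close> annihilates \<open>e k\<close>. So
  \<open>y = (R - mu) (e k)\<close> satisfies \<open>R y = - mu y\<close>, and nonnegativity of
  \<open>R\<close> leaves only \<open>y = 0\<close> when \<open>mu > 0\<close>. This pins down every
  nonnegative square root.\<close>

lemma square_root_inner_e:
  assumes R: "nonneg_op R" and RR: "R o\<^sub>L R = Q" and k: "k \<in> K"
  shows "blinfun_apply R x \<bullet> e k = sqrt (lam k) * (x \<bullet> e k)"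
proof -
  have sym: "blinfun_apply R u \<bullet> v = u \<bullet> blinfun_apply R v" for u v
    using R by (auto simp: nonneg_op_def)
  have pos: "0 \<le> blinfun_apply R u \<bullet> u" for u
    using R by (auto simp: nonneg_op_def)
  have sq: "blinfun_apply R (blinfun_apply R u) = blinfun_apply Q u" for u
    using arg_cong[OF RR, of "\<lambda>Z. blinfun_apply Z u"] by simp
  define y where "y = blinfun_apply R (e k) - sqrt (lam k) *\<^sub>R e k"
  have Ry: "blinfun_apply R y = - sqrt (lam k) *\<^sub>R y"
    using e_eigen[OF k] lam_nonneg[OF k]
    by (simp add: y_def blinfun.diff_right blinfun.scaleR_right sq scaleR_diff_right)
  have "y = 0"
  proof (cases "lam k = 0")
    \<comment> \<open>For \<open>lam k = 0\<close> the sign argument says nothing; instead the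
      squared norm of \<open>R (e k)\<close> equals
      \<open>e k \<bullet> Q (e k) = 0\<close>.\<close>
    case True
    have "y \<bullet> y = blinfun_apply R (e k) \<bullet> blinfun_apply R (e k)" using True by (simp add: y_def)
    also have "\<dots> = e k \<bullet> blinfun_apply Q (e k)" by (simp add: sym sq)
    also have "\<dots> = 0" using True e_eigen[OF k] by simp
    finally show ?thesis by simp
  next
    case False
    then have "sqrt (lam k) > 0" using lam_nonneg[OF k] by simp
    moreover have "0 \<le> - sqrt (lam k) * (y \<bullet> y)" using pos[of y] Ry by simp
    ultimately have "y \<bullet> y \<le> 0" by (simp add: mult_le_0_iff)
    then show ?thesis using inner_ge_zero[of y] by (simp add: order_antisym)
  qed
  then show ?thesis by (simp add: y_def sym)
qed

text \<open>The candidate multiplies the coordinate along \<open>e k\<close> by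
  \<open>sqrt (lam k)\<close>. As every eigenvalue is at most \<open>norm Q\<close>, the squared
  coordinates stay summable and the operator is bounded by \<open>sqrt (norm Q)\<close>.\<close>

lemma square_root_exists: "\<exists>R. nonneg_op R \<and> R o\<^sub>L R = Q"
proof -
  define c where "c x k = sqrt (lam k) * (x \<bullet> e k)" for x k
  define R where "R x = infsum (\<lambda>k. c x k *\<^sub>R e k) K" for x
  have c2: "(c x k)\<^sup>2 \<le> norm Q * (x \<bullet> e k)\<^sup>2" if "k \<in> K" for x k
    using lam_nonneg[OF that] lam_le[OF that]
    by (auto simp: c_def power_mult_distrib intro!: mult_right_mono)
  have sm: "(\<lambda>k. norm Q * (x \<bullet> e k)\<^sup>2) summable_on K" for x
    by (intro summable_on_cmult_right bessel_summable e_on)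
  have c_sm: "(\<lambda>k. (c x k)\<^sup>2) summable_on K" for x
    using sm by (rule summable_on_comparison_test) (use c2 in auto)
  have R: "((\<lambda>k. c x k *\<^sub>R e k) has_sum R x) K" for x
    unfolding R_def by (intro has_sum_infsum orthonormal_summable[OF e_on] c_sm)
  have Re: "R x \<bullet> e k = sqrt (lam k) * (x \<bullet> e k)" if "k \<in> K" for x k
    using has_sum_orthonormal_inner[OF e_on R that] by (simp add: c_def)
  have norm_R: "(norm (R x))\<^sup>2 \<le> norm Q * (norm x)\<^sup>2" for x
  proof -
    have "((\<lambda>k. (c x k)\<^sup>2) has_sum (norm (R x))\<^sup>2) K"
      unfolding power2_norm_eq_inner[of "R x"]
      using e_parseval[of "R x" "R x"]
      by (rule has_sum_cong[THEN iffD1, rotated]) (simp add: Re c_def power2_eq_square)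
    moreover have "((\<lambda>k. norm Q * (x \<bullet> e k)\<^sup>2) has_sum (norm Q * (norm x)\<^sup>2)) K"
      using has_sum_cmult_right[OF e_parseval[of x x], of "norm Q"]
      by (simp add: power2_eq_square power2_norm_eq_inner[unfolded power2_eq_square])
    ultimately show ?thesis by (rule has_sum_mono) (rule c2)
  qed
  have bl: "bounded_linear R"
  proof (rule bounded_linear_intro[where K = "sqrt (norm Q)"])
    show "R (x + y) = R x + R y" for x y
      by (rule e_eqI) (simp add: Re inner_add_left algebra_simps)
    show "R (r *\<^sub>R x) = r *\<^sub>R R x" for r x
      by (rule e_eqI) (simp add: Re)
    show "norm (R x) \<le> norm x * sqrt (norm Q)" for x
      by (rule power2_le_imp_le) (use norm_R[of x] in \<open>simp_all add: power_mult_distrib mult.commute\<close>)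
  qed
  have ap: "blinfun_apply (Blinfun R) = R" by (rule bounded_linear_Blinfun_apply[OF bl])
  have in1: "((\<lambda>k. sqrt (lam k) * ((x \<bullet> e k) * (y \<bullet> e k))) has_sum (R x \<bullet> y)) K" for x y
    using e_parseval[of "R x" y]
    by (rule has_sum_cong[THEN iffD1, rotated]) (simp add: Re)
  have "nonneg_op (Blinfun R)"
    unfolding nonneg_op_def ap
  proof (intro conjI allI)
    show "R u \<bullet> v = u \<bullet> R v" for u v
    proof -
      have "((\<lambda>k. sqrt (lam k) * ((u \<bullet> e k) * (v \<bullet> e k))) has_sum (R v \<bullet> u)) K"
        using in1[of v u] by (simp add: mult.commute mult.left_commute)
      then show ?thesis using in1[of u v] has_sum_unique by (metis inner_commute)
    qed
    show "0 \<le> R u \<bullet> u" for u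
      by (rule has_sum_nonneg[OF in1]) (simp add: lam_nonneg)
  qed
  moreover have "Blinfun R o\<^sub>L Blinfun R = Q"
    by (rule blinfun_eqI, rule e_eqI) (simp add: ap Re Q_inner_e lam_nonneg mult.assoc[symmetric])
  ultimately show ?thesis by blast
qed

text \<open>Turns the definite description in \<open>op_sqrt\<close> into a genuine square
  root.\<close>

lemma op_sqrt_unique: "\<exists>!R. nonneg_op R \<and> R o\<^sub>L R = Q"
proof -
  have "R = R'" if "nonneg_op R \<and> R o\<^sub>L R = Q" "nonneg_op R' \<and> R' o\<^sub>L R' = Q" for R R'
    by (rule blinfun_eqI, rule e_eqI) (use that in \<open>simp add: square_root_inner_e\<close>)
  then show ?thesis using square_root_exists by blast
qed

abbreviation R :: "'u \<Rightarrow> 'u" where "R \<equiv> blinfun_apply (op_sqrt Q)"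
abbreviation J :: "'u \<Rightarrow> 'u" where "J \<equiv> inv_sqrt Q"

lemma op_sqrt_nonneg: "nonneg_op (op_sqrt Q)" and op_sqrt_square: "op_sqrt Q o\<^sub>L op_sqrt Q = Q"
  using theI'[OF op_sqrt_unique] by (auto simp: op_sqrt_def)

lemma R_sym: "R u \<bullet> v = u \<bullet> R v"
  using op_sqrt_nonneg by (auto simp: nonneg_op_def)

lemma R_R: "R (R u) = blinfun_apply Q u"
  using arg_cong[OF op_sqrt_square, of "\<lambda>Z. blinfun_apply Z u"] by simp

lemma R_inner_e: "k \<in> K \<Longrightarrow> R x \<bullet> e k = sqrt (lam k) * (x \<bullet> e k)"
  by (rule square_root_inner_e[OF op_sqrt_nonneg op_sqrt_square])

lemma R_e: "k \<in> K \<Longrightarrow> R (e k) = sqrt (lam k) *\<^sub>R e k"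
  by (rule e_eqI) (auto simp: R_inner_e e_orthonormal)

text \<open>The orthogonal complement of the kernel of \<open>R\<close>. With
  \<open>U0_inner\<close> as inner product, \<open>J\<close> maps \<open>U0 Q\<close> isometrically
  onto it, so the geometry of \<open>U0 Q\<close> can be studied inside the ambient Hilbert
  space.\<close>

definition ker_perp :: "'u \<Rightarrow> bool" where
  "ker_perp v \<longleftrightarrow> (\<forall>w. R w = 0 \<longrightarrow> v \<bullet> w = 0)"

lemma R_eq_0_iff: "R w = 0 \<longleftrightarrow> (\<forall>k\<in>K. lam k \<noteq> 0 \<longrightarrow> w \<bullet> e k = 0)"
  using R_inner_e[of _ w] e_maximal[of "R w"] by fastforce

lemma ker_perp_iff: "ker_perp v \<longleftrightarrow> (\<forall>k\<in>K. lam k = 0 \<longrightarrow> v \<bullet> e k = 0)"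
proof
  assume "ker_perp v"
  then show "\<forall>k\<in>K. lam k = 0 \<longrightarrow> v \<bullet> e k = 0"
    by (auto simp: ker_perp_def R_e)
next
  assume *: "\<forall>k\<in>K. lam k = 0 \<longrightarrow> v \<bullet> e k = 0"
  show "ker_perp v"
    unfolding ker_perp_def
  proof (intro allI impI)
    fix w assume "R w = 0"
    then have "((\<lambda>k. (v \<bullet> e k) * (w \<bullet> e k)) has_sum 0) K"
      using * by (intro has_sum_0) (auto simp: R_eq_0_iff)
    then show "v \<bullet> w = 0" using e_parseval[of v w] has_sum_unique by blast
  qed
qed

lemma ker_perp_diff: "ker_perp v \<Longrightarrow> ker_perp w \<Longrightarrow> ker_perp (v - w)"
  by (simp add: ker_perp_iff inner_diff_left)

lemma ker_perp_add: "ker_perp v \<Longrightarrow> ker_perp w \<Longrightarrow> ker_perp (v + w)"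
  by (simp add: ker_perp_iff inner_add_left)

lemma ker_perp_scaleR: "ker_perp v \<Longrightarrow> ker_perp (c *\<^sub>R v)"
  by (simp add: ker_perp_iff)

lemma ker_perp_R: "ker_perp (R v)"
  by (simp add: ker_perp_iff R_inner_e)

lemma R_inj: "ker_perp v \<Longrightarrow> ker_perp w \<Longrightarrow> R v = R w \<Longrightarrow> v = w"
proof -
  assume "ker_perp v" "ker_perp w" "R v = R w"
  then have "ker_perp (v - w)" "R (v - w) = 0" by (auto intro: ker_perp_diff simp: blinfun.diff_right)
  then have "(v - w) \<bullet> (v - w) = 0" by (simp add: ker_perp_def)
  then show "v = w" by simp
qed

text \<open>Deleting from \<open>w\<close> the coordinates with eigenvalue zero does not change
  \<open>R w\<close> and projects onto the complement of the kernel.\<close>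

lemma ker_perp_preimage: "\<exists>v. R v = R w \<and> ker_perp v"
proof -
  let ?c = "\<lambda>k. if lam k = 0 then 0 else w \<bullet> e k"
  have "(\<lambda>k. (?c k)\<^sup>2) summable_on K"
    by (rule summable_on_comparison_test[OF bessel_summable[OF e_on, of w]]) auto
  then obtain v where v: "((\<lambda>k. ?c k *\<^sub>R e k) has_sum v) K"
    using orthonormal_summable[OF e_on] by (meson summable_on_def)
  have ve: "v \<bullet> e k = ?c k" if "k \<in> K" for k
    by (rule has_sum_orthonormal_inner[OF e_on v that])
  have "R v = R w" by (rule e_eqI) (simp add: R_inner_e ve)
  moreover have "ker_perp v" by (simp add: ker_perp_iff ve)
  ultimately show ?thesis by blast
qed

lemma J_eqI: "ker_perp v \<Longrightarrow> J (R v) = v"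
  unfolding inv_sqrt_def using R_inj
  by (intro the_equality) (auto simp: ker_perp_def)

lemma J_U0: "u \<in> U0 Q \<Longrightarrow> R (J u) = u" and ker_perp_J: "u \<in> U0 Q \<Longrightarrow> ker_perp (J u)"
  using ker_perp_preimage J_eqI by (metis U0_def rangeE)+

lemma R_in_U0 [simp]: "R v \<in> U0 Q"
  by (simp add: U0_def)

lemma U0_add: "u \<in> U0 Q \<Longrightarrow> v \<in> U0 Q \<Longrightarrow> u + v \<in> U0 Q"
  unfolding U0_def by (auto simp: blinfun.add_right[symmetric])

lemma U0_scaleR: "u \<in> U0 Q \<Longrightarrow> c *\<^sub>R u \<in> U0 Q"
  unfolding U0_def by (auto simp: blinfun.scaleR_right[symmetric])

lemma U0_0: "0 \<in> U0 Q"
  using U0_scaleR[OF R_in_U0[of 0], of 0] by simp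

lemma J_add: "u \<in> U0 Q \<Longrightarrow> v \<in> U0 Q \<Longrightarrow> J (u + v) = J u + J v"
  using J_eqI[OF ker_perp_add[OF ker_perp_J ker_perp_J]] by (simp add: blinfun.add_right J_U0)

lemma J_scaleR: "u \<in> U0 Q \<Longrightarrow> J (c *\<^sub>R u) = c *\<^sub>R J u"
  using J_eqI[OF ker_perp_scaleR[OF ker_perp_J]] by (simp add: blinfun.scaleR_right J_U0)

text \<open>\<open>U0_basis\<close> is an arbitrary choice, so some basis must be exhibited. The
  vectors \<open>R (e k) = sqrt (lam k) *\<^sub>R e k\<close> with nonzero eigenvalue form one,
  because \<open>J\<close> sends them back to \<open>e k\<close>.\<close>

lemma U0_onb_exists: "\<exists>B. U0_onb Q B"
proof
  let ?K = "{k\<in>K. lam k \<noteq> 0}"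
  have Je: "J (R (e k)) = e k" if "k \<in> ?K" for k
    using that by (intro J_eqI) (auto simp: ker_perp_iff e_orthonormal)
  show "U0_onb Q ((\<lambda>k. R (e k)) ` ?K)"
    unfolding U0_onb_def
  proof (intro conjI ballI impI)
    show "(\<lambda>k. R (e k)) ` ?K \<subseteq> U0 Q" by auto
  next
    fix b c assume "b \<in> (\<lambda>k. R (e k)) ` ?K" "c \<in> (\<lambda>k. R (e k)) ` ?K"
    then obtain j k where "b = R (e j)" "c = R (e k)" and jk: "j \<in> ?K" "k \<in> ?K" by auto
    \<comment> \<open>The basis is a set and not a family, so the Kronecker delta compares vectors;
      distinct indices must be seen to give distinct vectors.\<close>
    moreover have "R (e j) = R (e k) \<longleftrightarrow> j = k"
    proof
      assume "R (e j) = R (e k)"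
      then have "e j = e k" using jk Je by metis
      then show "j = k" using jk e_orthonormal[of j k] e_orthonormal[of k k] by (auto split: if_splits)
    qed simp
    ultimately show "U0_inner Q b c = (if b = c then 1 else 0)"
      by (simp add: U0_inner_def Je e_orthonormal)
  next
    fix u assume u: "u \<in> U0 Q" and z: "\<forall>b\<in>(\<lambda>k. R (e k)) ` ?K. U0_inner Q u b = 0"
    have "J u = 0"
    proof (rule e_maximal)
      fix k assume k: "k \<in> K"
      show "J u \<bullet> e k = 0"
        using z k ker_perp_J[OF u] Je[of k]
        by (cases "lam k = 0") (auto simp: ker_perp_iff U0_inner_def)
    qed
    then show "u = 0" using J_U0[OF u] by (simp add: blinfun.zero_right)
  qed
qed

section \<open>The chosen orthonormal basis of \<open>U0 Q\<close>\<close>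

abbreviation B :: "'u set" where "B \<equiv> U0_basis Q"

lemma B_onb: "U0_onb Q B"
  unfolding U0_basis_def by (rule someI_ex[OF U0_onb_exists])

lemma B_U0: "b \<in> B \<Longrightarrow> b \<in> U0 Q"
  using B_onb by (auto simp: U0_onb_def)

lemma J_on: "orthonormal_on B J"
  using B_onb by (simp add: U0_onb_def orthonormal_on_def U0_inner_def)

text \<open>Maximality of \<open>B\<close> is applied to \<open>R r\<close>, whose image under
  \<open>J\<close> is \<open>r\<close> again; then \<open>R r = 0\<close>, and a vector of
  \<open>ker_perp\<close> lying in the kernel is orthogonal to itself.\<close>

lemma J_maximal:
  assumes "\<And>b. b \<in> B \<Longrightarrow> r \<bullet> J b = 0" "ker_perp r"
  shows "r = 0"
proof -
  have "R r = 0"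
    using B_onb assms unfolding U0_onb_def by (auto simp: U0_inner_def J_eqI)
  then have "r \<bullet> r = 0" using assms by (simp add: ker_perp_def)
  then show ?thesis by simp
qed

text \<open>The family \<open>J b\<close> is maximal only inside \<open>ker_perp\<close>, so the
  limit of the series has to be kept there: every term is orthogonal to the kernel of
  \<open>R\<close>, hence so is the limit.\<close>

lemma J_expansion:
  assumes "ker_perp x"
  shows "((\<lambda>b. (x \<bullet> J b) *\<^sub>R J b) has_sum x) B"
proof (rule orthonormal_expansion[OF J_on, where P = ker_perp])
  fix s assume s: "((\<lambda>b. (x \<bullet> J b) *\<^sub>R J b) has_sum s) B"
  have "ker_perp s"
    unfolding ker_perp_def
  proof (intro allI impI)
    fix w assume w: "R w = 0"
    have "((\<lambda>b. ((x \<bullet> J b) *\<^sub>R J b) \<bullet> w) has_sum 0) B"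
      using w ker_perp_J[OF B_U0] by (intro has_sum_0) (auto simp: ker_perp_def)
    then show "s \<bullet> w = 0" using has_sum_inner[OF s] has_sum_unique by blast
  qed
  then show "ker_perp (x - s)" using assms by (intro ker_perp_diff)
qed (auto intro: J_maximal)

text \<open>The functional given by \<open>v\<close> acts on \<open>U0 Q\<close> as the
  \<open>J\<close>-coordinate along \<open>R v\<close>; this is the source of the \<open>R v\<close>
  in the elementary operators below.\<close>

lemma inner_basis: "b \<in> B \<Longrightarrow> v \<bullet> b = R v \<bullet> J b"
  by (simp add: R_sym J_U0 B_U0)

lemma J_parseval: "ker_perp x \<Longrightarrow> ((\<lambda>b. (x \<bullet> J b) * (y \<bullet> J b)) has_sum (x \<bullet> y)) B"
  by (rule parseval_inner[OF J_expansion])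

text \<open>Here the Hilbert-Schmidt norm meets the noise:
  \<open>blinfun_apply Q v \<bullet> w\<close> is also the covariance per unit time of the
  increments of \<open>W\<close>, and the isometry rests on this agreement.\<close>

lemma Q_parseval: "((\<lambda>b. (v \<bullet> b) * (w \<bullet> b)) has_sum (blinfun_apply Q v \<bullet> w)) B"
proof -
  have "((\<lambda>b. (R v \<bullet> J b) * (R w \<bullet> J b)) has_sum (R v \<bullet> R w)) B"
    by (intro J_parseval ker_perp_R)
  then show ?thesis
    by (subst has_sum_cong[of _ _ "\<lambda>b. (R v \<bullet> J b) * (R w \<bullet> J b)"])
       (auto simp: inner_basis R_sym R_R[symmetric])
qed

text \<open>Bessel's inequality lets each \<open>e k\<close> see only countably many
  \<open>J b\<close>, and each \<open>J b\<close>, being nonzero, is seen by some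
  \<open>e k\<close>. Countability is what makes the Hilbert-Schmidt norm measurable later.\<close>

lemma countable_B: "countable B"
proof -
  have "countable {b\<in>B. (J b \<bullet> e k) \<noteq> 0}" for k
  proof -
    have "countable {b\<in>B. (e k \<bullet> J b)\<^sup>2 \<noteq> 0}"
      using bessel_summable[OF J_on, of "e k"] by (rule summable_countable_real)
    then show ?thesis by (simp add: inner_commute)
  qed
  then have "countable (\<Union>k\<in>K. {b\<in>B. (J b \<bullet> e k) \<noteq> 0})" by blast
  moreover have "B \<subseteq> (\<Union>k\<in>K. {b\<in>B. (J b \<bullet> e k) \<noteq> 0})"
  proof
    fix b assume b: "b \<in> B"
    have "J b \<noteq> 0" using orthonormal_onD[OF J_on b b] by auto
    then show "b \<in> (\<Union>k\<in>K. {b\<in>B. (J b \<bullet> e k) \<noteq> 0})" using b e_maximal[of "J b"] by blast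
  qed
  ultimately show ?thesis using countable_subset by blast
qed

text \<open>\<open>Q\<^sup>-\<^sup>1\<^sup>/\<^sup>2 b\<close> itself need not lie in the range of \<open>Q\<^sup>1\<^sup>/\<^sup>2\<close>.\<close>

lemma R_dense:
  assumes "ker_perp x" "\<epsilon> > 0"
  shows "\<exists>v. norm (R v - x) < \<epsilon>"
proof -
  obtain F where F: "finite F" "F \<subseteq> K" "dist (sum (\<lambda>k. (x \<bullet> e k) *\<^sub>R e k) F) x \<le> \<epsilon>/2"
    using has_sum_finite_approximation[OF e_expansion[of x], of "\<epsilon>/2"] assms by auto
  \<comment> \<open>The division is harmless for finitely many \<open>k\<close>. Where
    \<open>lam k = 0\<close> it returns 0, and there the coordinate of \<open>x\<close> vanishes
    because \<open>x\<close> lies in \<open>ker_perp\<close>.\<close>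
  let ?v = "\<Sum>k\<in>F. ((x \<bullet> e k) / sqrt (lam k)) *\<^sub>R e k"
  have "R ?v = (\<Sum>k\<in>F. (x \<bullet> e k) *\<^sub>R e k)"
    unfolding blinfun.sum_right blinfun.scaleR_right
    using F assms(1) by (intro sum.cong) (auto simp: R_e ker_perp_iff subset_iff)
  then show ?thesis using F assms by (intro exI[of _ ?v]) (simp add: dist_norm)
qed

section \<open>The Hilbert--Schmidt norm\<close>

abbreviation hs :: "('u \<Rightarrow> 'h::real_inner) \<Rightarrow> real" where "hs \<equiv> hs_norm Q"

text \<open>\<open>infsum\<close> is 0 for a divergent family, so a small value of \<open>hs\<close>
  means something only together with this condition.\<close>

definition ell2 :: "('u \<Rightarrow> 'h::real_inner) \<Rightarrow> bool" where
  "ell2 f \<longleftrightarrow> (\<lambda>b. (norm (f b))\<^sup>2) summable_on B"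

lemma hs_nonneg [simp]: "0 \<le> hs f"
  by (simp add: hs_norm_def infsum_nonneg)

lemma hs_square: "(hs f)\<^sup>2 = infsum (\<lambda>b. (norm (f b))\<^sup>2) B"
  by (simp add: hs_norm_def infsum_nonneg)

lemma hs_has_sum: "ell2 f \<Longrightarrow> ((\<lambda>b. (norm (f b))\<^sup>2) has_sum (hs f)\<^sup>2) B"
  by (simp add: hs_square ell2_def)

lemma hs_cong: "(\<And>b. b \<in> B \<Longrightarrow> norm (f b) = norm (g b)) \<Longrightarrow> hs f = hs g"
  by (simp add: hs_norm_def cong: infsum_cong)

lemma hs_finite_le:
  assumes "ell2 f" "finite F" "F \<subseteq> B"
  shows "L2_set (\<lambda>b. norm (f b)) F \<le> hs f"
  unfolding L2_set_def hs_norm_def using assms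
  by (intro real_sqrt_le_mono finite_sum_le_infsum) (auto simp: ell2_def)

text \<open>Reduces estimates of \<open>hs\<close> to \<open>L2_set\<close> over finite sets, where
  Minkowski and Cauchy-Schwarz are available; summability comes as a by-product.\<close>

lemma hs_leI:
  assumes "\<And>F. finite F \<Longrightarrow> F \<subseteq> B \<Longrightarrow> L2_set (\<lambda>b. norm (f b)) F \<le> c"
  shows "ell2 f" "hs f \<le> c"
proof -
  have c: "0 \<le> c" using assms[of "{}"] by simp
  have bd: "(\<Sum>b\<in>F. (norm (f b))\<^sup>2) \<le> c\<^sup>2" if "finite F" "F \<subseteq> B" for F
    using power_mono[OF assms[OF that], of 2] by (simp add: L2_set_def sum_nonneg)
  show 1: "ell2 f"
    unfolding ell2_def
    by (rule nonneg_bdd_above_summable_on) (auto intro!: bdd_aboveI[where M = "c\<^sup>2"] bd)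
  have "infsum (\<lambda>b. (norm (f b))\<^sup>2) B \<le> c\<^sup>2"
    using 1 by (intro infsum_le_finite_sums bd) (auto simp: ell2_def)
  then show "hs f \<le> c"
    unfolding hs_norm_def using real_sqrt_le_mono[of _ "c\<^sup>2"] c by fastforce
qed

lemma hs_norm_le:
  assumes "ell2 f" "\<And>b. b \<in> B \<Longrightarrow> norm (g b) \<le> c * norm (f b)" "0 \<le> c"
  shows "ell2 g" "hs g \<le> c * hs f"
proof -
  have "L2_set (\<lambda>b. norm (g b)) F \<le> c * hs f" if F: "finite F" "F \<subseteq> B" for F
  proof -
    have "L2_set (\<lambda>b. norm (g b)) F \<le> L2_set (\<lambda>b. c * norm (f b)) F"
      using F assms(2) by (intro L2_set_mono) auto
    also have "\<dots> = c * L2_set (\<lambda>b. norm (f b)) F"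
      by (rule L2_set_right_distrib[OF assms(3), symmetric])
    also have "\<dots> \<le> c * hs f" by (intro mult_left_mono hs_finite_le assms F)
    finally show ?thesis .
  qed
  from hs_leI[OF this] show "ell2 g" "hs g \<le> c * hs f" by auto
qed

lemma hs_add:
  assumes f: "ell2 f" and g: "ell2 g"
  shows "ell2 (\<lambda>u. f u + g u)" "hs (\<lambda>u. f u + g u) \<le> hs f + hs g"
proof -
  have "L2_set (\<lambda>b. norm (f b + g b)) F \<le> hs f + hs g" if F: "finite F" "F \<subseteq> B" for F
  proof -
    have "L2_set (\<lambda>b. norm (f b + g b)) F \<le> L2_set (\<lambda>b. norm (f b) + norm (g b)) F"
      by (intro L2_set_mono norm_triangle_ineq) auto
    also have "\<dots> \<le> L2_set (\<lambda>b. norm (f b)) F + L2_set (\<lambda>b. norm (g b)) F"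
      by (rule L2_set_triangle_ineq)
    also have "\<dots> \<le> hs f + hs g" by (intro add_mono hs_finite_le f g F)
    finally show ?thesis .
  qed
  from hs_leI[of "\<lambda>u. f u + g u", OF this]
  show "ell2 (\<lambda>u. f u + g u)" "hs (\<lambda>u. f u + g u) \<le> hs f + hs g" by auto
qed

lemma hs_uminus [simp]: "hs (\<lambda>u. - f u) = hs f"
  by (rule hs_cong) simp

lemma hs_diff_commute: "hs (\<lambda>u. f u - g u) = hs (\<lambda>u. g u - f u)"
  by (rule hs_cong) (rule norm_minus_commute)

lemma hs_0 [simp]: "hs (\<lambda>u. 0) = 0" and ell2_0 [simp]: "ell2 (\<lambda>u. 0)"
  by (simp_all add: hs_norm_def ell2_def)

lemma hs_triangle:
  assumes "ell2 (\<lambda>u. f u - g u)" "ell2 (\<lambda>u. g u - k u)"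
  shows "hs (\<lambda>u. f u - k u) \<le> hs (\<lambda>u. f u - g u) + hs (\<lambda>u. g u - k u)"
  using hs_add(2)[OF assms] by simp

lemma hs_diff_square_le:
  assumes "ell2 (\<lambda>u. f u - g u)" "ell2 (\<lambda>u. g u - k u)"
  shows "(hs (\<lambda>u. f u - k u))\<^sup>2 \<le> 2 * (hs (\<lambda>u. f u - g u))\<^sup>2 + 2 * (hs (\<lambda>u. g u - k u))\<^sup>2"
proof -
  have "(hs (\<lambda>u. f u - k u))\<^sup>2 \<le> (hs (\<lambda>u. f u - g u) + hs (\<lambda>u. g u - k u))\<^sup>2"
    by (intro power_mono hs_triangle assms) simp
  also have "\<dots> \<le> 2 * (hs (\<lambda>u. f u - g u))\<^sup>2 + 2 * (hs (\<lambda>u. g u - k u))\<^sup>2"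
    using sum_squares_bound[of "hs (\<lambda>u. f u - g u)" "hs (\<lambda>u. g u - k u)"]
    by (simp add: power2_sum)
  finally show ?thesis .
qed

section \<open>The space \<open>L20 Q\<close> as a normed space\<close>

lemma L20_add_eq: "L \<in> L20 Q \<Longrightarrow> u \<in> U0 Q \<Longrightarrow> v \<in> U0 Q \<Longrightarrow> L (u + v) = L u + L v"
  and L20_scaleR_eq: "L \<in> L20 Q \<Longrightarrow> u \<in> U0 Q \<Longrightarrow> L (c *\<^sub>R u) = c *\<^sub>R L u"
  and L20_outside: "L \<in> L20 Q \<Longrightarrow> u \<notin> U0 Q \<Longrightarrow> L u = 0"
  and L20_ell2: "L \<in> L20 Q \<Longrightarrow> ell2 L"
  by (auto simp: L20_def ell2_def)

lemma L20_0_eq: "L \<in> L20 Q \<Longrightarrow> L 0 = 0"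
  using L20_scaleR_eq[of L 0 0] by (simp add: U0_0)

lemma U0_sum: "finite F \<Longrightarrow> (\<And>b. b \<in> F \<Longrightarrow> f b \<in> U0 Q) \<Longrightarrow> (\<Sum>b\<in>F. f b) \<in> U0 Q"
  by (induction F rule: finite_induct) (auto simp: U0_0 U0_add)

lemma L20_sum_eq:
  "L \<in> L20 Q \<Longrightarrow> finite F \<Longrightarrow> (\<And>b. b \<in> F \<Longrightarrow> f b \<in> U0 Q) \<Longrightarrow> L (\<Sum>b\<in>F. f b) = (\<Sum>b\<in>F. L (f b))"
  by (rotate_tac, induction F rule: finite_induct) (auto simp: L20_0_eq L20_add_eq U0_sum)

lemma J_sum:
  "finite F \<Longrightarrow> (\<And>b. b \<in> F \<Longrightarrow> f b \<in> U0 Q) \<Longrightarrow> J (\<Sum>b\<in>F. f b) = (\<Sum>b\<in>F. J (f b))"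
proof (induction F rule: finite_induct)
  case empty
  then show ?case using J_scaleR[OF U0_0, of 0] by simp
qed (simp add: J_add U0_sum)

text \<open>On a partial sum \<open>uF F\<close> of the expansion of \<open>u\<close> along
  \<open>B\<close> this is Cauchy-Schwarz. The bound contained in the definition of
  \<open>L20\<close>, with its unknown constant \<open>c\<close>, provides the continuity needed to
  pass from \<open>uF F\<close> to \<open>u\<close>.\<close>

lemma L20_bound:
  assumes L: "L \<in> L20 Q" and u: "u \<in> U0 Q"
  shows "norm (L u) \<le> hs L * norm (J u)"
proof -
  obtain c where c: "\<And>u. u \<in> U0 Q \<Longrightarrow> norm (L u) \<le> c * norm (J u)"
    using L unfolding L20_def U0_inner_def norm_eq_sqrt_inner[of "J _", symmetric] by blast
  define uF where "uF F = (\<Sum>b\<in>F. (J u \<bullet> J b) *\<^sub>R b)" for F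
  have fin: "norm (L (uF F)) \<le> hs L * norm (J u)" if F: "finite F" "F \<subseteq> B" for F
  proof -
    have "L (uF F) = (\<Sum>b\<in>F. (J u \<bullet> J b) *\<^sub>R L b)"
      unfolding uF_def using F B_U0
      by (subst L20_sum_eq[OF L]) (auto simp: L20_scaleR_eq[OF L] U0_scaleR intro!: sum.cong)
    also have "norm \<dots> \<le> (\<Sum>b\<in>F. \<bar>J u \<bullet> J b\<bar> * \<bar>norm (L b)\<bar>)"
      by (rule order_trans[OF norm_sum]) simp
    also have "\<dots> \<le> L2_set (\<lambda>b. J u \<bullet> J b) F * L2_set (\<lambda>b. norm (L b)) F"
      by (rule L2_set_mult_ineq)
    also have "\<dots> \<le> norm (J u) * hs L"
    proof (intro mult_mono hs_finite_le L20_ell2 L F)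
      have "sqrt (\<Sum>b\<in>F. (J u \<bullet> J b)\<^sup>2) \<le> sqrt ((norm (J u))\<^sup>2)"
        by (intro real_sqrt_le_mono bessel_finite[OF J_on] F)
      then show "L2_set (\<lambda>b. J u \<bullet> J b) F \<le> norm (J u)" by (simp add: L2_set_def)
    qed (auto simp: L2_set_nonneg)
    finally show ?thesis by (simp add: mult.commute)
  qed
  show ?thesis
  proof (rule field_le_epsilon)
    fix \<epsilon> :: real assume \<epsilon>: "0 < \<epsilon>"
    \<comment> \<open>The constant \<open>c\<close> has no known sign, hence the divisor
      \<open>\<bar>c\<bar> + 1\<close>.\<close>
    define \<delta> where "\<delta> = \<epsilon> / (\<bar>c\<bar> + 1)"
    have \<delta>: "\<delta> > 0" using \<epsilon> by (simp add: \<delta>_def)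
    obtain F where F: "finite F" "F \<subseteq> B" "dist (\<Sum>b\<in>F. (J u \<bullet> J b) *\<^sub>R J b) (J u) \<le> \<delta>"
      using has_sum_finite_approximation[OF J_expansion[OF ker_perp_J[OF u]] \<delta>] by blast
    have uF: "uF F \<in> U0 Q" unfolding uF_def using F B_U0 by (intro U0_sum U0_scaleR) auto
    have m: "(-1) *\<^sub>R uF F \<in> U0 Q" by (rule U0_scaleR[OF uF])
    have JF: "J (uF F) = (\<Sum>b\<in>F. (J u \<bullet> J b) *\<^sub>R J b)"
      unfolding uF_def using F B_U0 by (subst J_sum) (auto simp: J_scaleR U0_scaleR intro!: sum.cong)
    have "L (u + (-1) *\<^sub>R uF F) = L u - L (uF F)"
      using L20_add_eq[OF L u m] L20_scaleR_eq[OF L uF, of "-1"] by simp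
    then have "norm (L u - L (uF F)) \<le> c * norm (J (u + (-1) *\<^sub>R uF F))"
      using c[OF U0_add[OF u m]] by simp
    also have "J (u + (-1) *\<^sub>R uF F) = J u - J (uF F)"
      using J_add[OF u m] J_scaleR[OF uF, of "-1"] by simp
    also have "c * norm (J u - J (uF F)) \<le> (\<bar>c\<bar> + 1) * \<delta>"
      using F(3) by (intro mult_mono) (auto simp: JF dist_norm norm_minus_commute)
    also have "\<dots> = \<epsilon>" by (simp add: \<delta>_def)
    finally have "norm (L u - L (uF F)) \<le> \<epsilon>" .
    then show "norm (L u) \<le> hs L * norm (J u) + \<epsilon>"
      using fin[OF F(1,2)] norm_triangle_sub[of "L u" "L (uF F)"] by linarith
  qed
qed

lemma L20_I:
  assumes "\<And>u. u \<notin> U0 Q \<Longrightarrow> L u = 0"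
    and "\<And>u v. u \<in> U0 Q \<Longrightarrow> v \<in> U0 Q \<Longrightarrow> L (u + v) = L u + L v"
    and "\<And>c u. u \<in> U0 Q \<Longrightarrow> L (c *\<^sub>R u) = c *\<^sub>R L u"
    and "\<And>u. u \<in> U0 Q \<Longrightarrow> norm (L u) \<le> c * norm (J u)"
    and "ell2 L"
  shows "L \<in> L20 Q"
  using assms unfolding L20_def ell2_def
  by (auto simp: U0_inner_def norm_eq_sqrt_inner[symmetric] intro!: exI[of _ c])

lemma L20_zero: "(\<lambda>u. 0) \<in> L20 Q"
  by (rule L20_I[where c = 0]) auto

lemma L20_add:
  assumes L: "L \<in> L20 Q" and L': "L' \<in> L20 Q"
  shows "(\<lambda>u. L u + L' u) \<in> L20 Q"
proof (rule L20_I[where c = "hs L + hs L'"])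
  fix u assume u: "u \<in> U0 Q"
  show "norm (L u + L' u) \<le> (hs L + hs L') * norm (J u)"
    using norm_triangle_ineq[of "L u" "L' u"] L20_bound[OF L u] L20_bound[OF L' u]
    by (simp add: distrib_right)
qed (use L L' in \<open>auto simp: L20_outside L20_add_eq L20_scaleR_eq scaleR_add_right intro: hs_add L20_ell2\<close>)

lemma L20_comp:
  fixes A :: "'h::real_inner \<Rightarrow>\<^sub>L 'k::real_inner"
  assumes L: "L \<in> L20 Q"
  shows "(\<lambda>u. blinfun_apply A (L u)) \<in> L20 Q"
    and "hs (\<lambda>u. blinfun_apply A (L u)) \<le> norm A * hs L"
proof -
  note * = hs_norm_le[OF L20_ell2[OF L], of "\<lambda>u. blinfun_apply A (L u)" "norm A"]
  show "hs (\<lambda>u. blinfun_apply A (L u)) \<le> norm A * hs L" by (intro * norm_blinfun) auto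
  show "(\<lambda>u. blinfun_apply A (L u)) \<in> L20 Q"
  proof (rule L20_I[where c = "norm A * hs L"])
    fix u assume u: "u \<in> U0 Q"
    have "norm (blinfun_apply A (L u)) \<le> norm A * norm (L u)" by (rule norm_blinfun)
    also have "\<dots> \<le> norm A * (hs L * norm (J u))" by (intro mult_left_mono L20_bound L u) auto
    finally show "norm (blinfun_apply A (L u)) \<le> norm A * hs L * norm (J u)" by (simp add: mult.assoc)
  next
    show "ell2 (\<lambda>u. blinfun_apply A (L u))" by (intro * norm_blinfun) auto
  qed (use L in \<open>auto simp: L20_outside L20_add_eq L20_scaleR_eq blinfun.add_right blinfun.scaleR_right blinfun.zero_right\<close>)
qed

lemma L20_scaleR: "L \<in> L20 Q \<Longrightarrow> (\<lambda>u. c *\<^sub>R L u) \<in> L20 Q"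
  using L20_comp(1)[of L "c *\<^sub>R id_blinfun"] by (simp add: scaleR_blinfun.rep_eq)

lemma L20_diff: "L \<in> L20 Q \<Longrightarrow> L' \<in> L20 Q \<Longrightarrow> (\<lambda>u. L u - L' u) \<in> L20 Q"
  using L20_add[OF _ L20_scaleR[of L' "-1"], of L] by simp

text \<open>\<open>hs\<close> inspects the basis only; \<open>L20_bound\<close> carries the
  vanishing to all of \<open>U0 Q\<close>, and outside it both functions are 0 by
  convention.\<close>

lemma L20_eqI:
  assumes "L \<in> L20 Q" "L' \<in> L20 Q" "hs (\<lambda>u. L u - L' u) = 0"
  shows "L = L'"
proof
  fix u
  show "L u = L' u"
  proof (cases "u \<in> U0 Q")
    case True
    then show ?thesis using L20_bound[OF L20_diff[OF assms(1,2)] True] assms(3) by simp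
  qed (use assms in \<open>simp add: L20_outside\<close>)
qed

text \<open>Gives access to the theory of metric topologies, from which the sigma-algebra
  \<open>L20_borel\<close> is built.\<close>

lemma L20_metric: "Metric_space (L20 Q) (\<lambda>L L'. hs (\<lambda>u. L u - L' u :: 'h::real_inner))"
proof
  fix L L' L'' :: "'u \<Rightarrow> 'h"
  show "0 \<le> hs (\<lambda>u. L u - L' u)" by simp
  show "hs (\<lambda>u. L u - L' u) = hs (\<lambda>u. L' u - L u)" by (rule hs_diff_commute)
  show "hs (\<lambda>u. L u - L' u) = 0 \<longleftrightarrow> L = L'" if "L \<in> L20 Q" "L' \<in> L20 Q"
    using that L20_eqI by auto
  show "hs (\<lambda>u. L u - L'' u) \<le> hs (\<lambda>u. L u - L' u) + hs (\<lambda>u. L' u - L'' u)"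
    if "L \<in> L20 Q" "L' \<in> L20 Q" "L'' \<in> L20 Q"
    using that by (intro hs_triangle L20_ell2 L20_diff)
qed

text \<open>The operator with functional represented by \<open>x\<close> through \<open>J\<close>.
  For \<open>x = R v\<close> it is the restriction of \<open><v, .> h\<close> to
  \<open>U0 Q\<close>, the form in which elementary processes occur; general \<open>x\<close> in
  \<open>ker_perp\<close> is needed because \<open>J b\<close> may lie outside the range of
  \<open>R\<close>.\<close>

definition rank1 :: "'u \<Rightarrow> 'h::real_inner \<Rightarrow> 'u \<Rightarrow> 'h" where
  "rank1 x h u = (if u \<in> U0 Q then (x \<bullet> J u) *\<^sub>R h else 0)"

lemma rank1_R: "u \<in> U0 Q \<Longrightarrow> rank1 (R v) h u = (v \<bullet> u) *\<^sub>R h"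
  by (simp add: rank1_def R_sym J_U0)

lemma rank1_B: "b \<in> B \<Longrightarrow> rank1 x h b = (x \<bullet> J b) *\<^sub>R h"
  by (simp add: rank1_def B_U0)

lemma rank1_hs:
  assumes "ker_perp x"
  shows "ell2 (rank1 x h)" "hs (rank1 x h) = norm x * norm h"
proof -
  have "((\<lambda>b. (x \<bullet> J b) * (x \<bullet> J b) * (norm h)\<^sup>2) has_sum ((x \<bullet> x) * (norm h)\<^sup>2)) B"
    by (intro has_sum_cmult_left J_parseval assms)
  then have *: "((\<lambda>b. (norm (rank1 x h b))\<^sup>2) has_sum ((norm x * norm h)\<^sup>2)) B"
    by (rule has_sum_cong[THEN iffD1, rotated 1, OF back_subst[of "\<lambda>z. (_ has_sum z) B"]])
       (auto simp: rank1_B power_mult_distrib power2_eq_square dot_square_norm)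
  then show "ell2 (rank1 x h)" by (auto simp: ell2_def summable_on_def)
  show "hs (rank1 x h) = norm x * norm h"
    using infsumI[OF *] by (simp add: hs_norm_def)
qed

lemma rank1_L20:
  assumes "ker_perp x"
  shows "rank1 x h \<in> L20 Q"
proof (rule L20_I[where c = "norm x * norm h"])
  show "ell2 (rank1 x h)" by (rule rank1_hs[OF assms])
  show "norm (rank1 x h u) \<le> norm x * norm h * norm (J u)" for u
    using Cauchy_Schwarz_ineq2[of x "J u"]
    using mult_right_mono[of "\<bar>x \<bullet> J u\<bar>" "norm x * norm (J u)" "norm h"]
    by (auto simp: rank1_def mult_ac)
qed (auto simp: rank1_def U0_add U0_scaleR J_add J_scaleR inner_add_right scaleR_add_left)

lemma has_sum_finite_sum:
  fixes f :: "'i \<Rightarrow> 'j \<Rightarrow> real"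
  shows "(\<And>i. i \<in> I \<Longrightarrow> (f i has_sum s i) A) \<Longrightarrow> ((\<lambda>x. \<Sum>i\<in>I. f i x) has_sum (\<Sum>i\<in>I. s i)) A"
  by (induction I rule: infinite_finite_induct) (auto intro: has_sum_add)

text \<open>Expanding the square leaves, for each pair of indices, the series of
  \<open>Q_parseval\<close>. The explicit double sum makes the norm of a random finite-rank operator
  measurable and comparable with second moments of increments.\<close>

lemma hs_square_finite_rank:
  assumes "finite I"
  shows "(hs (\<lambda>u. \<Sum>i\<in>I. c i *\<^sub>R rank1 (R (v i)) (h i) u))\<^sup>2 =
    (\<Sum>i\<in>I. \<Sum>j\<in>I. c i * c j * (blinfun_apply Q (v i) \<bullet> v j) * (h i \<bullet> h j))"
proof -
  have "((\<lambda>b. \<Sum>i\<in>I. \<Sum>j\<in>I. ((v i \<bullet> b) * (v j \<bullet> b)) * (c i * c j * (h i \<bullet> h j))) has_sum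
      (\<Sum>i\<in>I. \<Sum>j\<in>I. (blinfun_apply Q (v i) \<bullet> v j) * (c i * c j * (h i \<bullet> h j)))) B"
    by (intro has_sum_finite_sum has_sum_cmult_left Q_parseval)
  moreover have "(norm (\<Sum>i\<in>I. c i *\<^sub>R rank1 (R (v i)) (h i) b))\<^sup>2 =
      (\<Sum>i\<in>I. \<Sum>j\<in>I. ((v i \<bullet> b) * (v j \<bullet> b)) * (c i * c j * (h i \<bullet> h j)))" if "b \<in> B" for b
    using B_U0[OF that]
    by (simp add: power2_norm_eq_inner inner_sum_left inner_sum_right rank1_R)
       (simp add: sum_distrib_left mult_ac inner_commute)
  ultimately have "infsum (\<lambda>b. (norm (\<Sum>i\<in>I. c i *\<^sub>R rank1 (R (v i)) (h i) b))\<^sup>2) B =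
      (\<Sum>i\<in>I. \<Sum>j\<in>I. (blinfun_apply Q (v i) \<bullet> v j) * (c i * c j * (h i \<bullet> h j)))"
    by (simp add: infsumI cong: infsum_cong)
  then show ?thesis by (simp add: hs_square mult_ac)
qed

text \<open>The sum is \<open>L\<close> composed with the orthogonal projection of
  \<open>U0 Q\<close> onto the span of \<open>F\<close>.\<close>

lemma truncation_B:
  assumes "finite F" "F \<subseteq> B" "c \<in> B"
  shows "(\<Sum>b\<in>F. rank1 (J b) (L b) c) = (if c \<in> F then L c else 0)"
proof -
  have "(\<Sum>b\<in>F. rank1 (J b) (L b) c) = (\<Sum>b\<in>F. if b = c then L b else 0)"
    using assms by (intro sum.cong) (auto simp: rank1_B orthonormal_onD[OF J_on])
  then show ?thesis using assms by simp
qed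

lemma hs_truncation:
  assumes "ell2 L" "finite F" "F \<subseteq> B"
  shows "(hs (\<lambda>u. (\<Sum>b\<in>F. rank1 (J b) (L b) u) - L u))\<^sup>2 = (hs L)\<^sup>2 - (\<Sum>b\<in>F. (norm (L b))\<^sup>2)"
proof -
  have "((\<lambda>b. (norm (L b))\<^sup>2) has_sum ((hs L)\<^sup>2 - (\<Sum>b\<in>F. (norm (L b))\<^sup>2))) (B - F)"
    using assms by (intro has_sum_Diff hs_has_sum has_sum_finite)
  then have "((\<lambda>b. (norm ((\<Sum>c\<in>F. rank1 (J c) (L c) b) - L b))\<^sup>2) has_sum
      ((hs L)\<^sup>2 - (\<Sum>b\<in>F. (norm (L b))\<^sup>2))) B"
    by (rule has_sum_cong_neutral[THEN iffD1, rotated -1]) (use assms in \<open>auto simp: truncation_B\<close>)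
  then show ?thesis by (simp add: hs_square infsumI)
qed

end

section \<open>Square-integrable random variables\<close>

definition sqint :: "'a measure \<Rightarrow> ('a \<Rightarrow> real) \<Rightarrow> bool" where
  "sqint M f \<longleftrightarrow> f \<in> borel_measurable M \<and> integrable M (\<lambda>x. (f x)\<^sup>2)"

lemma sqint_square: "sqint M f \<Longrightarrow> integrable M (\<lambda>x. (f x)\<^sup>2)"
  by (simp add: sqint_def)

lemma sqint_mult:
  assumes "sqint M f" "sqint M g"
  shows "integrable M (\<lambda>x. f x * g x)"
proof (rule Bochner_Integration.integrable_bound)
  show "integrable M (\<lambda>x. (f x)\<^sup>2 + (g x)\<^sup>2)" using assms by (auto simp: sqint_def)
  show "(\<lambda>x. f x * g x) \<in> borel_measurable M" using assms by (auto simp: sqint_def)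
  show "AE x in M. norm (f x * g x) \<le> norm ((f x)\<^sup>2 + (g x)\<^sup>2)"
  proof (rule AE_I2)
    fix x
    have "0 \<le> (\<bar>f x\<bar> - \<bar>g x\<bar>)\<^sup>2" by simp
    then have "2 * (\<bar>f x\<bar> * \<bar>g x\<bar>) \<le> (f x)\<^sup>2 + (g x)\<^sup>2" by (simp add: power2_diff)
    moreover have "0 \<le> \<bar>f x\<bar> * \<bar>g x\<bar>" by simp
    ultimately show "norm (f x * g x) \<le> norm ((f x)\<^sup>2 + (g x)\<^sup>2)"
      unfolding real_norm_def abs_mult using abs_ge_self[of "(f x)\<^sup>2 + (g x)\<^sup>2"] by linarith
  qed
qed

lemma sqint_cmult: "sqint M f \<Longrightarrow> sqint M (\<lambda>x. c * f x)"
  by (auto simp: sqint_def power_mult_distrib)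

lemma sqint_add: "sqint M f \<Longrightarrow> sqint M g \<Longrightarrow> sqint M (\<lambda>x. f x + g x)"
  using sqint_mult[of M f g] by (auto simp: sqint_def power2_sum mult.assoc)

lemma sqint_diff: "sqint M f \<Longrightarrow> sqint M g \<Longrightarrow> sqint M (\<lambda>x. f x - g x)"
  using sqint_add[OF _ sqint_cmult[of M g "-1"], of f] by simp

lemma sqint_zero [simp]: "sqint M (\<lambda>x. 0)"
  by (simp add: sqint_def)

lemma sqint_sum: "(\<And>i. i \<in> I \<Longrightarrow> sqint M (f i)) \<Longrightarrow> sqint M (\<lambda>x. \<Sum>i\<in>I. f i x)"
  by (induction I rule: infinite_finite_induct) (auto intro: sqint_add)

lemma sqint_cong_AE:
  "sqint M f \<Longrightarrow> g \<in> borel_measurable M \<Longrightarrow> AE x in M. f x = g x \<Longrightarrow> sqint M g"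
  unfolding sqint_def
  by (auto intro: integrable_cong_AE_imp[of M "\<lambda>x. (f x)\<^sup>2"])

lemma sqint_bounded_mult:
  assumes f: "sqint M f" and g: "g \<in> borel_measurable M" "\<And>x. \<bar>g x\<bar> \<le> 1"
  shows "sqint M (\<lambda>x. g x * f x)"
  unfolding sqint_def
proof
  show "(\<lambda>x. g x * f x) \<in> borel_measurable M" using f g by (auto simp: sqint_def)
  show "integrable M (\<lambda>x. (g x * f x)\<^sup>2)"
  proof (rule Bochner_Integration.integrable_bound[OF sqint_square[OF f]])
    have "(g x)\<^sup>2 \<le> 1" for x using g(2)[of x] by (simp add: abs_square_le_1)
    then show "AE x in M. norm ((g x * f x)\<^sup>2) \<le> norm ((f x)\<^sup>2)"
      by (auto simp: power_mult_distrib intro!: mult_left_le_one_le)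
  qed (use f g in \<open>auto simp: sqint_def\<close>)
qed

lemma sqint_integral_mult_le:
  assumes f: "sqint M f" and g: "sqint M g"
  shows "\<bar>\<integral>x. f x * g x \<partial>M\<bar> \<le> sqrt (\<integral>x. (f x)\<^sup>2 \<partial>M) * sqrt (\<integral>x. (g x)\<^sup>2 \<partial>M)"
proof -
  have "\<bar>\<integral>x. f x * g x \<partial>M\<bar> \<le> (\<integral>x. \<bar>f x\<bar> * \<bar>g x\<bar> \<partial>M)"
    using integral_norm_bound[of M "\<lambda>x. f x * g x"] by (simp add: abs_mult)
  moreover have "(\<integral>x. \<bar>f x\<bar> * \<bar>g x\<bar> \<partial>M)\<^sup>2 \<le> (\<integral>x. (f x)\<^sup>2 \<partial>M) * (\<integral>x. (g x)\<^sup>2 \<partial>M)"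
  proof -
    have i: "integrable M (\<lambda>x. \<bar>f x\<bar> * \<bar>g x\<bar>)"
      using integrable_norm[OF sqint_mult[OF f g]] by (simp add: abs_mult)
    have "(\<integral>\<^sup>+x. ennreal \<bar>f x\<bar> * ennreal \<bar>g x\<bar> \<partial>M)\<^sup>2 \<le>
        (\<integral>\<^sup>+x. (ennreal \<bar>f x\<bar>)\<^sup>2 \<partial>M) * (\<integral>\<^sup>+x. (ennreal \<bar>g x\<bar>)\<^sup>2 \<partial>M)"
      using f g by (intro Cauchy_Schwarz_nn_integral) (auto simp: sqint_def)
    then show ?thesis
      using f g i
      by (simp add: sqint_def nn_integral_eq_integral ennreal_power integral_nonneg
          flip: ennreal_mult' ennreal_mult)
  qed
  ultimately have "\<bar>\<integral>x. f x * g x \<partial>M\<bar> \<le> sqrt ((\<integral>x. (f x)\<^sup>2 \<partial>M) * (\<integral>x. (g x)\<^sup>2 \<partial>M))"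
    using real_le_rsqrt by force
  then show ?thesis by (simp add: real_sqrt_mult)
qed

lemma integral_double_sum:
  fixes f :: "'i \<Rightarrow> 'j \<Rightarrow> 'a \<Rightarrow> real"
  assumes int: "\<And>i j. i \<in> I \<Longrightarrow> j \<in> J \<Longrightarrow> integrable M (f i j)"
  shows "integrable M (\<lambda>x. \<Sum>i\<in>I. \<Sum>j\<in>J. f i j x)"
    and "(\<integral>x. (\<Sum>i\<in>I. \<Sum>j\<in>J. f i j x) \<partial>M) = (\<Sum>i\<in>I. \<Sum>j\<in>J. \<integral>x. f i j x \<partial>M)"
proof -
  have inner: "integrable M (\<lambda>x. \<Sum>j\<in>J. f i j x)" if "i \<in> I" for i
    using that by (intro Bochner_Integration.integrable_sum int)
  then show "integrable M (\<lambda>x. \<Sum>i\<in>I. \<Sum>j\<in>J. f i j x)"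
    by (rule Bochner_Integration.integrable_sum)
  have "(\<integral>x. (\<Sum>i\<in>I. \<Sum>j\<in>J. f i j x) \<partial>M) = (\<Sum>i\<in>I. \<integral>x. (\<Sum>j\<in>J. f i j x) \<partial>M)"
    by (rule Bochner_Integration.integral_sum[OF inner])
  also have "\<dots> = (\<Sum>i\<in>I. \<Sum>j\<in>J. \<integral>x. f i j x \<partial>M)"
    by (intro sum.cong refl Bochner_Integration.integral_sum int)
  finally show "(\<integral>x. (\<Sum>i\<in>I. \<Sum>j\<in>J. f i j x) \<partial>M) = (\<Sum>i\<in>I. \<Sum>j\<in>J. \<integral>x. f i j x \<partial>M)" .
qed

text \<open>Continuity of the inner product of square-integrable variables, from the identity
  \<open>X' Y' = X Y - dX Y - X dY + dX dY\<close> and Cauchy-Schwarz. The filter is general because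
  the expansion of \<open>W\<close> converges along finite subsets of \<open>K\<close>.\<close>

lemma tendsto_integral_mult:
  assumes X: "sqint M X" and Y: "sqint M Y"
    and X': "\<And>i. sqint M (X' i)" and Y': "\<And>i. sqint M (Y' i)"
    and limX: "((\<lambda>i. \<integral>x. (X x - X' i x)\<^sup>2 \<partial>M) \<longlongrightarrow> 0) G"
    and limY: "((\<lambda>i. \<integral>x. (Y x - Y' i x)\<^sup>2 \<partial>M) \<longlongrightarrow> 0) G"
  shows "((\<lambda>i. \<integral>x. X' i x * Y' i x \<partial>M) \<longlongrightarrow> (\<integral>x. X x * Y x \<partial>M)) G"
proof -
  let ?dX = "\<lambda>i x. X x - X' i x" and ?dY = "\<lambda>i x. Y x - Y' i x"
  have dX: "sqint M (?dX i)" and dY: "sqint M (?dY i)" for i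
    using X Y X' Y' by (auto intro: sqint_diff)
  have z: "((\<lambda>i. \<integral>x. f i x * g i x \<partial>M) \<longlongrightarrow> 0) G"
    if "\<And>i. sqint M (f i)" "\<And>i. sqint M (g i)"
      and "((\<lambda>i. sqrt (\<integral>x. (f i x)\<^sup>2 \<partial>M) * sqrt (\<integral>x. (g i x)\<^sup>2 \<partial>M)) \<longlongrightarrow> 0) G" for f g
    by (rule Lim_null_comparison[OF always_eventually that(3)])
       (simp add: sqint_integral_mult_le that(1,2))
  note sq = tendsto_real_sqrt[OF limX, simplified] tendsto_real_sqrt[OF limY, simplified]
  have "((\<lambda>i. (\<integral>x. X x * Y x \<partial>M) - (\<integral>x. ?dX i x * Y x \<partial>M) - (\<integral>x. X x * ?dY i x \<partial>M)
      + (\<integral>x. ?dX i x * ?dY i x \<partial>M)) \<longlongrightarrow> (\<integral>x. X x * Y x \<partial>M) - 0 - 0 + 0) G"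
    by (intro tendsto_intros z dX dY X Y)
       (use sq tendsto_mult_left_zero tendsto_mult_right_zero tendsto_mult_zero in blast)+
  moreover have "(\<integral>x. X x * Y x \<partial>M) - (\<integral>x. ?dX i x * Y x \<partial>M) - (\<integral>x. X x * ?dY i x \<partial>M)
      + (\<integral>x. ?dX i x * ?dY i x \<partial>M) = (\<integral>x. X' i x * Y' i x \<partial>M)" for i
  proof -
    have "(\<integral>x. X' i x * Y' i x \<partial>M) = (\<integral>x. X x * Y x - ?dX i x * Y x - X x * ?dY i x + ?dX i x * ?dY i x \<partial>M)"
      by (rule Bochner_Integration.integral_cong) (auto simp: algebra_simps)
    then show ?thesis
      using sqint_mult[OF X Y] sqint_mult[OF dX Y] sqint_mult[OF X dY] sqint_mult[OF dX dY] by simp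
  qed
  ultimately show ?thesis by simp
qed

section \<open>Increments of Wiener processes\<close>

context normal_filtration
begin

lemma F_measurable: "0 \<le> t \<Longrightarrow> f \<in> measurable (F t) N \<Longrightarrow> f \<in> measurable M N"
  using sets_F[of t] space_F[of t] by (auto simp: measurable_def)

lemma F_measurable_mono: "0 \<le> s \<Longrightarrow> s \<le> t \<Longrightarrow> f \<in> measurable (F s) N \<Longrightarrow> f \<in> measurable (F t) N"
  using F_mono[of s t] space_F[of t] space_F[of s] by (auto simp: measurable_def)

text \<open>Passes from independence of sigma-algebras, the form in which the increments are assumed
  independent of the past, to factorisation of expectations.\<close>

lemma indep_set_integral_mult:
  fixes X Y :: "_ \<Rightarrow> real"
  assumes ind: "indep_set (sets N) (sets N')"
    and sp: "space N = space M" "space N' = space M"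
    and X: "X \<in> borel_measurable N" "integrable M X" and Y: "Y \<in> borel_measurable N'" "integrable M Y"
  shows "integrable M (\<lambda>\<omega>. X \<omega> * Y \<omega>)" "(\<integral>\<omega>. X \<omega> * Y \<omega> \<partial>M) = (\<integral>\<omega>. X \<omega> \<partial>M) * (\<integral>\<omega>. Y \<omega> \<partial>M)"
proof -
  have 1: "sigma_sets (space M) {X -` A \<inter> space M | A. A \<in> sets borel} \<subseteq> sets N"
    using X(1) sp(1) by (intro sets.sigma_sets_subset[where M = N, unfolded sp]) (auto simp: measurable_def)
  have 2: "sigma_sets (space M) {Y -` A \<inter> space M | A. A \<in> sets borel} \<subseteq> sets N'"
    using Y(1) sp(2) by (intro sets.sigma_sets_subset[where M = N', unfolded sp]) (auto simp: measurable_def)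
  have "indep_var borel X borel Y"
    unfolding indep_var_eq
  proof (intro conjI)
    show "indep_set (sigma_sets (space M) {X -` A \<inter> space M | A. A \<in> sets borel})
        (sigma_sets (space M) {Y -` A \<inter> space M | A. A \<in> sets borel})"
      using ind 1 2 unfolding indep_sets2_eq by blast
  qed (use X Y in auto)
  from indep_var_integrable[OF this] indep_var_lebesgue_integral[OF this] X Y
  show "integrable M (\<lambda>\<omega>. X \<omega> * Y \<omega>)" "(\<integral>\<omega>. X \<omega> * Y \<omega> \<partial>M) = (\<integral>\<omega>. X \<omega> \<partial>M) * (\<integral>\<omega>. Y \<omega> \<partial>M)"
    by auto
qed

end

lemma (in real_wiener) increment_moments:
  assumes "0 \<le> s" "s \<le> t" "0 \<le> l"
  shows "sqint M (\<lambda>\<omega>. B t \<omega> - B s \<omega>)" "(\<integral>\<omega>. B t \<omega> - B s \<omega> \<partial>M) = 0"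
    "(\<integral>\<omega>. (B t \<omega> - B s \<omega>)\<^sup>2 \<partial>M) = l * (t - s)"
proof -
  have m: "(\<lambda>\<omega>. B t \<omega> - B s \<omega>) \<in> borel_measurable M"
    using assms adapted by (intro borel_measurable_diff F_measurable[of t] F_measurable[of s]) auto
  have "sqint M (\<lambda>\<omega>. B t \<omega> - B s \<omega>) \<and> (\<integral>\<omega>. B t \<omega> - B s \<omega> \<partial>M) = 0 \<and>
    (\<integral>\<omega>. (B t \<omega> - B s \<omega>)\<^sup>2 \<partial>M) = l * (t - s)"
  proof (cases "s < t \<and> l > 0")
    case True
    let ?\<sigma> = "sqrt (l * (t - s))"
    have \<sigma>: "?\<sigma> > 0" using True by simp
    have D: "distributed M lborel (\<lambda>\<omega>. B t \<omega> - B s \<omega>) (normal_density 0 ?\<sigma>)"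
      using increments_normal assms True by simp
    have "integrable M (\<lambda>\<omega>. (B t \<omega> - B s \<omega>)\<^sup>2)"
      using distributed_integrable[OF D, of "\<lambda>x. x\<^sup>2"] integrable_normal_moment[OF \<sigma>, of 0 2]
      by (simp add: normal_density_nonneg)
    moreover have "(\<integral>\<omega>. B t \<omega> - B s \<omega> \<partial>M) = 0"
      by (rule normal_distributed_expectation[OF \<sigma> D])
    moreover have "(\<integral>\<omega>. (B t \<omega> - B s \<omega>)\<^sup>2 \<partial>M) = ?\<sigma>\<^sup>2"
      using normal_distributed_variance[OF \<sigma> D] normal_distributed_expectation[OF \<sigma> D] by simp
    ultimately show ?thesis using True m by (simp add: sqint_def)
  next
    case False
    have "AE \<omega> in M. B t \<omega> - B s \<omega> = 0"
      using False assms increments_zero[of s t] by (cases "s = t") auto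
    moreover from this have "AE \<omega> in M. (B t \<omega> - B s \<omega>)\<^sup>2 = 0" by auto
    ultimately have "integrable M (\<lambda>\<omega>. (B t \<omega> - B s \<omega>)\<^sup>2)" "(\<integral>\<omega>. B t \<omega> - B s \<omega> \<partial>M) = 0"
      "(\<integral>\<omega>. (B t \<omega> - B s \<omega>)\<^sup>2 \<partial>M) = 0"
      using m by (auto intro: integrable_cong_AE_imp[of _ "\<lambda>_. 0"] integral_eq_zero_AE elim: AE_mp)
    then show ?thesis using m False assms by (auto simp: sqint_def)
  qed
  then show "sqint M (\<lambda>\<omega>. B t \<omega> - B s \<omega>)" "(\<integral>\<omega>. B t \<omega> - B s \<omega> \<partial>M) = 0"
    "(\<integral>\<omega>. (B t \<omega> - B s \<omega>)\<^sup>2 \<partial>M) = l * (t - s)" by auto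
qed

lemma (in real_wiener) sqint_B:
  assumes "0 \<le> t" "0 \<le> l"
  shows "sqint M (B t)"
proof (rule sqint_cong_AE[OF increment_moments(1)[of 0 t]])
  show "AE \<omega> in M. B t \<omega> - B 0 \<omega> = B t \<omega>" using start by auto
qed (use assms adapted F_measurable in auto)

sublocale cylindrical_wiener \<subseteq> diagonal_operator Q K e lam
  using Q_nonneg e_orthonormal e_complete e_eigen by unfold_locales

context cylindrical_wiener
begin

abbreviation dW :: "real \<Rightarrow> real \<Rightarrow> 'u \<Rightarrow> 'w \<Rightarrow> real" where
  "dW s r u \<omega> \<equiv> W r u \<omega> - W s u \<omega>"

lemma beta_moments:
  assumes "k \<in> K" "0 \<le> s" "s \<le> t"
  shows "sqint M (\<lambda>\<omega>. \<beta> k t \<omega> - \<beta> k s \<omega>)" "(\<integral>\<omega>. \<beta> k t \<omega> - \<beta> k s \<omega> \<partial>M) = 0"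
    "(\<integral>\<omega>. (\<beta> k t \<omega> - \<beta> k s \<omega>)\<^sup>2 \<partial>M) = lam k * (t - s)"
proof -
  interpret real_wiener M F "lam k" "\<beta> k" by (rule \<beta>_wiener[OF assms(1)])
  show "sqint M (\<lambda>\<omega>. \<beta> k t \<omega> - \<beta> k s \<omega>)" "(\<integral>\<omega>. \<beta> k t \<omega> - \<beta> k s \<omega> \<partial>M) = 0"
    "(\<integral>\<omega>. (\<beta> k t \<omega> - \<beta> k s \<omega>)\<^sup>2 \<partial>M) = lam k * (t - s)"
    using increment_moments assms lam_nonneg by auto
qed

lemma sqint_beta: "k \<in> K \<Longrightarrow> 0 \<le> t \<Longrightarrow> sqint M (\<beta> k t)"
  using real_wiener.sqint_B[OF \<beta>_wiener] lam_nonneg by blast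

text \<open>Independence is assumed for whole paths; composing with the path functional
  \<open>p t - p s\<close> and restricting to the index sets \<open>{j}\<close> and
  \<open>{k}\<close> gives two independent centred increments.\<close>

lemma beta_orthogonal:
  assumes j: "j \<in> K" and k: "k \<in> K" and "j \<noteq> k" and t: "0 \<le> s" "s \<le> t"
  shows "(\<integral>\<omega>. (\<beta> j t \<omega> - \<beta> j s \<omega>) * (\<beta> k t \<omega> - \<beta> k s \<omega>) \<partial>M) = 0"
proof -
  have "indep_vars (\<lambda>_. borel) (\<lambda>k \<omega>. (\<lambda>p. p t - p s) (\<lambda>t\<in>{0..}. \<beta> k t \<omega>)) K"
    using t by (intro indep_vars_compose2[OF \<beta>_indep]) measurable
  then have ind: "indep_vars (\<lambda>_. borel) (\<lambda>k \<omega>. \<beta> k t \<omega> - \<beta> k s \<omega>) K"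
    using t by simp
  have "indep_var (PiM {j} (\<lambda>_. borel)) (\<lambda>\<omega>. restrict (\<lambda>i. \<beta> i t \<omega> - \<beta> i s \<omega>) {j})
      (PiM {k} (\<lambda>_. borel)) (\<lambda>\<omega>. restrict (\<lambda>i. \<beta> i t \<omega> - \<beta> i s \<omega>) {k})"
    using indep_var_restrict[OF ind, of "{j}" "{k}"] j k \<open>j \<noteq> k\<close> by simp
  from indep_var_compose[OF this measurable_component_singleton[of j] measurable_component_singleton[of k]]
  have iv: "indep_var borel (\<lambda>\<omega>. \<beta> j t \<omega> - \<beta> j s \<omega>) borel (\<lambda>\<omega>. \<beta> k t \<omega> - \<beta> k s \<omega>)"
    by (simp add: comp_def)
  have "integrable M (\<lambda>\<omega>. \<beta> i t \<omega> - \<beta> i s \<omega>)" if "i \<in> K" for i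
    using beta_moments(1)[OF that t] by (auto simp: sqint_def intro: square_integrable_imp_integrable)
  from indep_var_lebesgue_integral[OF iv this[OF j] this[OF k]] show ?thesis
    unfolding beta_moments(2)[OF j t] mult_zero_left .
qed

lemma W_measurable: "0 \<le> t \<Longrightarrow> W t u \<in> borel_measurable M"
  by (rule F_measurable[OF _ W_adapted])

text \<open>Mean-square convergence of the expansion places \<open>W t u\<close> at finite
  mean-square distance from a finite sum of square-integrable Wiener processes.\<close>

lemma sqint_W: "0 \<le> t \<Longrightarrow> sqint M (W t u)"
proof -
  assume t: "0 \<le> t"
  let ?S = "\<lambda>J \<omega>. \<Sum>k\<in>J. (e k \<bullet> u) * \<beta> k t \<omega>"
  have "eventually (\<lambda>J. (\<integral>\<^sup>+\<omega>. ennreal ((W t u \<omega> - ?S J \<omega>)\<^sup>2) \<partial>M) < 1) (finite_subsets_at_top K)"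
    using W_expansion[OF t, of u] by (rule order_tendstoD) simp
  then obtain J where J: "finite J" "J \<subseteq> K" "(\<integral>\<^sup>+\<omega>. ennreal ((W t u \<omega> - ?S J \<omega>)\<^sup>2) \<partial>M) < 1"
    by (auto simp: eventually_finite_subsets_at_top)
  have S: "sqint M (?S J)"
    using J t by (intro sqint_sum sqint_cmult sqint_beta) auto
  have "sqint M (\<lambda>\<omega>. W t u \<omega> - ?S J \<omega>)"
    unfolding sqint_def
  proof
    show "(\<lambda>\<omega>. W t u \<omega> - ?S J \<omega>) \<in> borel_measurable M"
      using W_measurable[OF t] S by (auto simp: sqint_def)
    then show "integrable M (\<lambda>\<omega>. (W t u \<omega> - ?S J \<omega>)\<^sup>2)"
      using J(3) by (intro integrableI_bounded) (auto intro: less_trans)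
  qed
  from sqint_add[OF this S] show ?thesis by simp
qed

lemma W_expansion_integral:
  assumes t: "0 \<le> t"
  shows "((\<lambda>J. \<integral>\<omega>. (W t u \<omega> - (\<Sum>k\<in>J. (e k \<bullet> u) * \<beta> k t \<omega>))\<^sup>2 \<partial>M) \<longlongrightarrow> 0) (finite_subsets_at_top K)"
proof -
  let ?S = "\<lambda>J \<omega>. \<Sum>k\<in>J. (e k \<bullet> u) * \<beta> k t \<omega>"
  have "((\<lambda>J. enn2real (\<integral>\<^sup>+\<omega>. ennreal ((W t u \<omega> - ?S J \<omega>)\<^sup>2) \<partial>M)) \<longlongrightarrow> enn2real 0) (finite_subsets_at_top K)"
    using W_expansion[OF t, of u] by (intro tendsto_enn2real) simp_all
  moreover have "eventually (\<lambda>J. enn2real (\<integral>\<^sup>+\<omega>. ennreal ((W t u \<omega> - ?S J \<omega>)\<^sup>2) \<partial>M) =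
      (\<integral>\<omega>. (W t u \<omega> - ?S J \<omega>)\<^sup>2 \<partial>M)) (finite_subsets_at_top K)"
  proof (rule eventually_finite_subsets_at_top_weakI)
    fix J assume J: "finite J" "J \<subseteq> K"
    have "sqint M (\<lambda>\<omega>. W t u \<omega> - ?S J \<omega>)"
      using J t by (intro sqint_diff sqint_W sqint_sum sqint_cmult sqint_beta) auto
    then show "enn2real (\<integral>\<^sup>+\<omega>. ennreal ((W t u \<omega> - ?S J \<omega>)\<^sup>2) \<partial>M) = (\<integral>\<omega>. (W t u \<omega> - ?S J \<omega>)\<^sup>2 \<partial>M)"
      by (intro enn2real_nn_integral_eq_integral) (auto simp: sqint_def)
  qed
  ultimately show ?thesis by (simp add: tendsto_cong)
qed

lemma sqint_dW: "0 \<le> s \<Longrightarrow> s \<le> r \<Longrightarrow> sqint M (dW s r u)"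
  by (intro sqint_diff sqint_W) auto

text \<open>Finite partial sums of the expansion are centred, and orthogonality of the
  \<open>\<beta> k\<close> leaves a single sum with weights \<open>lam k\<close>. Since
  \<open>lam k\<close> times a coordinate of \<open>u\<close> is a coordinate of \<open>Q u\<close>,
  Parseval identifies the limit.\<close>

lemma dW_moments:
  assumes sr: "0 \<le> s" "s \<le> r"
  shows "(\<integral>\<omega>. dW s r u \<omega> \<partial>M) = 0"
    and "(\<integral>\<omega>. dW s r u \<omega> * dW s r v \<omega> \<partial>M) = (r - s) * (blinfun_apply Q u \<bullet> v)"
proof -
  have r: "0 \<le> r" using sr by simp
  let ?G = "finite_subsets_at_top K"
  define d where "d k \<omega> = \<beta> k r \<omega> - \<beta> k s \<omega>" for k \<omega>
  \<comment> \<open>outside \<open>K\<close> the processes \<open>\<beta> k\<close> are arbitrary, hence the intersection\<close>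
  define S where "S u J \<omega> = (\<Sum>k\<in>J \<inter> K. (e k \<bullet> u) * d k \<omega>)" for u J \<omega>
  have d: "k \<in> K \<Longrightarrow> sqint M (d k)" for k
    unfolding d_def by (rule beta_moments(1)[OF _ sr])
  have S: "sqint M (S u J)" for u J
    unfolding S_def by (intro sqint_sum sqint_cmult d) auto
  have lim: "((\<lambda>J. \<integral>\<omega>. (dW s r u \<omega> - S u J \<omega>)\<^sup>2 \<partial>M) \<longlongrightarrow> 0) ?G" for u
  proof -
    let ?X = "\<lambda>t J \<omega>. W t u \<omega> - (\<Sum>k\<in>J. (e k \<bullet> u) * \<beta> k t \<omega>)"
    have "((\<lambda>J. 2 * (\<integral>\<omega>. (?X r J \<omega>)\<^sup>2 \<partial>M) + 2 * (\<integral>\<omega>. (?X s J \<omega>)\<^sup>2 \<partial>M)) \<longlongrightarrow> 2 * 0 + 2 * 0) ?G"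
      by (intro tendsto_intros W_expansion_integral sr r)
    then have lim0: "((\<lambda>J. 2 * (\<integral>\<omega>. (?X r J \<omega>)\<^sup>2 \<partial>M) + 2 * (\<integral>\<omega>. (?X s J \<omega>)\<^sup>2 \<partial>M)) \<longlongrightarrow> 0) ?G"
      by simp
    show ?thesis
    proof (rule Lim_null_comparison[OF _ lim0], unfold real_norm_def)
      show "\<forall>\<^sub>F J in ?G. \<bar>\<integral>\<omega>. (dW s r u \<omega> - S u J \<omega>)\<^sup>2 \<partial>M\<bar>
          \<le> 2 * (\<integral>\<omega>. (?X r J \<omega>)\<^sup>2 \<partial>M) + 2 * (\<integral>\<omega>. (?X s J \<omega>)\<^sup>2 \<partial>M)"
      proof (rule eventually_finite_subsets_at_top_weakI)
        fix J assume J: "finite J" "J \<subseteq> K"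
        have X: "sqint M (?X r J)" "sqint M (?X s J)"
          using J sr by (intro sqint_diff sqint_W sqint_sum sqint_cmult sqint_beta; force)+
        have "(\<integral>\<omega>. (dW s r u \<omega> - S u J \<omega>)\<^sup>2 \<partial>M) \<le> (\<integral>\<omega>. 2 * (?X r J \<omega>)\<^sup>2 + 2 * (?X s J \<omega>)\<^sup>2 \<partial>M)"
        proof (rule integral_mono)
          show "integrable M (\<lambda>\<omega>. (dW s r u \<omega> - S u J \<omega>)\<^sup>2)"
            using sqint_diff[OF sqint_dW[OF sr] S] by (rule sqint_square)
          show "integrable M (\<lambda>\<omega>. 2 * (?X r J \<omega>)\<^sup>2 + 2 * (?X s J \<omega>)\<^sup>2)"
            using X by (auto simp: sqint_def)
          fix \<omega>
          have "J \<inter> K = J" using J by auto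
          then have "dW s r u \<omega> - S u J \<omega> = ?X r J \<omega> - ?X s J \<omega>"
            by (simp add: S_def d_def right_diff_distrib sum_subtractf)
          then show "(dW s r u \<omega> - S u J \<omega>)\<^sup>2 \<le> 2 * (?X r J \<omega>)\<^sup>2 + 2 * (?X s J \<omega>)\<^sup>2"
            using zero_le_power2[of "?X r J \<omega> + ?X s J \<omega>"]
            by (simp only: power2_diff power2_sum) simp
        qed
        also have "\<dots> = 2 * (\<integral>\<omega>. (?X r J \<omega>)\<^sup>2 \<partial>M) + 2 * (\<integral>\<omega>. (?X s J \<omega>)\<^sup>2 \<partial>M)"
          using X by (simp add: sqint_def)
        finally show "\<bar>\<integral>\<omega>. (dW s r u \<omega> - S u J \<omega>)\<^sup>2 \<partial>M\<bar>
          \<le> 2 * (\<integral>\<omega>. (?X r J \<omega>)\<^sup>2 \<partial>M) + 2 * (\<integral>\<omega>. (?X s J \<omega>)\<^sup>2 \<partial>M)" by simp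
      qed
    qed
  qed
  have int_d: "integrable M (d k)" if "k \<in> K" for k
    using d[OF that] by (auto simp: sqint_def intro: square_integrable_imp_integrable)
  have dd: "(\<integral>\<omega>. d j \<omega> * d k \<omega> \<partial>M) = (if j = k then lam k * (r - s) else 0)" if "j \<in> K" "k \<in> K" for j k
    using beta_orthogonal[OF that _ sr] beta_moments(3)[OF that(2) sr]
    by (auto simp: d_def power2_eq_square)
  show "(\<integral>\<omega>. dW s r u \<omega> \<partial>M) = 0"
  proof -
    \<comment> \<open>With the constant 1 as second factor, the first moment becomes a case of the
      limit theorem for products.\<close>
    have one: "sqint M (\<lambda>\<omega>. 1)" by (simp add: sqint_def)
    have "((\<lambda>J. \<integral>\<omega>. S u J \<omega> * 1 \<partial>M) \<longlongrightarrow> (\<integral>\<omega>. dW s r u \<omega> * 1 \<partial>M)) ?G"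
      by (intro tendsto_integral_mult sqint_dW sr S one lim) simp
    moreover have "(\<integral>\<omega>. S u J \<omega> * 1 \<partial>M) = 0" for J
      using beta_moments(2)[OF _ sr] int_d by (simp add: S_def d_def[abs_def])
    ultimately show ?thesis
      by (simp add: tendsto_const_iff)
  qed
  have "((\<lambda>J. \<integral>\<omega>. S u J \<omega> * S v J \<omega> \<partial>M) \<longlongrightarrow> (\<integral>\<omega>. dW s r u \<omega> * dW s r v \<omega> \<partial>M)) ?G"
    by (intro tendsto_integral_mult sqint_dW sr S lim)
  moreover have "((\<lambda>J. \<integral>\<omega>. S u J \<omega> * S v J \<omega> \<partial>M) \<longlongrightarrow> (r - s) * (blinfun_apply Q u \<bullet> v)) ?G"
  proof -
    have "(\<integral>\<omega>. S u J \<omega> * S v J \<omega> \<partial>M) = (r - s) * (\<Sum>k\<in>J. (blinfun_apply Q u \<bullet> e k) * (v \<bullet> e k))"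
      if J: "finite J" "J \<subseteq> K" for J
    proof -
      have JK: "J \<inter> K = J" using J by auto
      have "(\<integral>\<omega>. S u J \<omega> * S v J \<omega> \<partial>M) =
          (\<integral>\<omega>. (\<Sum>j\<in>J. \<Sum>k\<in>J. ((e j \<bullet> u) * (e k \<bullet> v)) * (d j \<omega> * d k \<omega>)) \<partial>M)"
        unfolding S_def JK sum_product by (simp add: mult_ac)
      also have "\<dots> = (\<Sum>j\<in>J. \<Sum>k\<in>J. ((e j \<bullet> u) * (e k \<bullet> v)) * (\<integral>\<omega>. d j \<omega> * d k \<omega> \<partial>M))"
      proof -
        have int: "integrable M (\<lambda>\<omega>. ((e j \<bullet> u) * (e k \<bullet> v)) * (d j \<omega> * d k \<omega>))" if "j \<in> J" "k \<in> J" for j k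
          using that J by (intro integrable_mult_right sqint_mult d) auto
        have "(\<integral>\<omega>. (\<Sum>j\<in>J. \<Sum>k\<in>J. ((e j \<bullet> u) * (e k \<bullet> v)) * (d j \<omega> * d k \<omega>)) \<partial>M) =
            (\<Sum>j\<in>J. \<Sum>k\<in>J. \<integral>\<omega>. ((e j \<bullet> u) * (e k \<bullet> v)) * (d j \<omega> * d k \<omega>) \<partial>M)"
          by (rule integral_double_sum(2)) (rule int)
        then show ?thesis by (simp only: integral_mult_right_zero)
      qed
      also have "\<dots> = (\<Sum>j\<in>J. \<Sum>k\<in>J. if j = k then ((e j \<bullet> u) * (e k \<bullet> v)) * (lam k * (r - s)) else 0)"
        using J by (intro sum.cong refl) (auto simp: dd subset_iff)
      also have "\<dots> = (\<Sum>j\<in>J. (e j \<bullet> u) * (e j \<bullet> v) * (lam j * (r - s)))"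
        using J by simp
      also have "\<dots> = (r - s) * (\<Sum>k\<in>J. (blinfun_apply Q u \<bullet> e k) * (v \<bullet> e k))"
        using J unfolding sum_distrib_left
        by (intro sum.cong refl) (auto simp: Q_inner_e subset_iff inner_commute[of "e _"])
      finally show ?thesis .
    qed
    then have "eventually (\<lambda>J. (r - s) * (\<Sum>k\<in>J. (blinfun_apply Q u \<bullet> e k) * (v \<bullet> e k)) =
        (\<integral>\<omega>. S u J \<omega> * S v J \<omega> \<partial>M)) ?G"
      by (intro eventually_finite_subsets_at_top_weakI) auto
    moreover have "((\<lambda>J. (r - s) * (\<Sum>k\<in>J. (blinfun_apply Q u \<bullet> e k) * (v \<bullet> e k)))
        \<longlongrightarrow> (r - s) * (blinfun_apply Q u \<bullet> v)) ?G"
      using e_parseval[of "blinfun_apply Q u" v] unfolding has_sum_def by (intro tendsto_intros)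
    ultimately show ?thesis by (rule Lim_transform_eventually[rotated])
  qed
  ultimately show "(\<integral>\<omega>. dW s r u \<omega> * dW s r v \<omega> \<partial>M) = (r - s) * (blinfun_apply Q u \<bullet> v)"
    using tendsto_unique finite_subsets_at_top_neq_bot by blast
qed

text \<open>Independence is assumed for all pairings \<open>u\<close> jointly, so the product of
  increments in two directions is again measurable for the sigma-algebra that is independent of
  \<open>F s\<close>.\<close>

lemma dW_indep:
  assumes sr: "0 \<le> s" "s \<le> r" and G: "G \<in> borel_measurable (F s)" "integrable M G"
  shows "(\<integral>\<omega>. G \<omega> * dW s r u \<omega> \<partial>M) = 0"
    and "integrable M (\<lambda>\<omega>. G \<omega> * (dW s r u \<omega> * dW s r v \<omega>))"
    and "(\<integral>\<omega>. G \<omega> * (dW s r u \<omega> * dW s r v \<omega>) \<partial>M) = (\<integral>\<omega>. G \<omega> \<partial>M) * ((r - s) * (blinfun_apply Q u \<bullet> v))"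
proof -
  let ?V = "vimage_algebra (space M) (\<lambda>\<omega> u. W r u \<omega> - W s u \<omega>) (PiM UNIV (\<lambda>_. borel))"
  have m: "dW s r u \<in> borel_measurable ?V" for u
    using measurable_compose[OF measurable_vimage_algebra1[of "\<lambda>\<omega> u. W r u \<omega> - W s u \<omega>" "space M"
        "PiM UNIV (\<lambda>_. borel)"] measurable_component_singleton[of u]]
    by (simp add: space_PiM)
  note ind = indep_set_integral_mult[OF W_increments_indep[OF sr] space_F[OF sr(1)] _ G]
  show "(\<integral>\<omega>. G \<omega> * dW s r u \<omega> \<partial>M) = 0"
    using ind(2)[of "dW s r u"] m sqint_dW[OF sr] dW_moments(1)[OF sr]
    by (simp add: sqint_def square_integrable_imp_integrable)
  have m2: "(\<lambda>\<omega>. dW s r u \<omega> * dW s r v \<omega>) \<in> borel_measurable ?V"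
    by (intro borel_measurable_times m)
  show "integrable M (\<lambda>\<omega>. G \<omega> * (dW s r u \<omega> * dW s r v \<omega>))"
    "(\<integral>\<omega>. G \<omega> * (dW s r u \<omega> * dW s r v \<omega>) \<partial>M) = (\<integral>\<omega>. G \<omega> \<partial>M) * ((r - s) * (blinfun_apply Q u \<bullet> v))"
    using ind[OF _ m2] sqint_mult[OF sqint_dW[OF sr] sqint_dW[OF sr]] dW_moments(2)[OF sr] by auto
qed

end

section \<open>A domination inequality\<close>

text \<open>The integrand is 1 up to \<open>c = z\<close> and \<open>z^2 / c^2\<close> beyond; each
  piece contributes \<open>z\<close>.\<close>

lemma nn_integral_min_square:
  fixes z :: real
  assumes z: "0 \<le> z"
  shows "(\<integral>\<^sup>+c. ennreal (min 1 (z\<^sup>2 / c\<^sup>2)) * indicator {0<..} c \<partial>lborel) \<le> 2 * ennreal z"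
proof (cases "z = 0")
  case False
  then have z: "0 < z" using z by simp
  have "(\<integral>\<^sup>+c. ennreal (z\<^sup>2 / c\<^sup>2) * indicator {z..} c \<partial>lborel) = ennreal (0 - (- z\<^sup>2 / z))"
  proof (rule nn_integral_FTC_atLeast[where F = "\<lambda>c. - z\<^sup>2 / c"])
    show "DERIV (\<lambda>c. - z\<^sup>2 / c) x :> z\<^sup>2 / x\<^sup>2" if "z \<le> x" for x
      using z that by (auto intro!: derivative_eq_intros simp: power2_eq_square divide_simps)
    have "((\<lambda>c. inverse c * (- z\<^sup>2)) \<longlongrightarrow> 0 * (- z\<^sup>2)) at_top"
      by (intro tendsto_intros tendsto_inverse_0_at_top filterlim_ident)
    then show "((\<lambda>c. - z\<^sup>2 / c) \<longlongrightarrow> 0) at_top" by (simp add: divide_inverse mult.commute)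
  qed auto
  then have 1: "(\<integral>\<^sup>+c. ennreal (z\<^sup>2 / c\<^sup>2) * indicator {z..} c \<partial>lborel) = ennreal z"
    using z by (simp add: power2_eq_square)
  have 2: "(\<integral>\<^sup>+c. indicator {0..z} c \<partial>lborel) = ennreal z"
    using z by simp
  have "(\<integral>\<^sup>+c. ennreal (min 1 (z\<^sup>2 / c\<^sup>2)) * indicator {0<..} c \<partial>lborel) \<le>
      (\<integral>\<^sup>+c. indicator {0..z} c + ennreal (z\<^sup>2 / c\<^sup>2) * indicator {z..} c \<partial>lborel)"
  proof (rule nn_integral_mono)
    fix c
    show "ennreal (min 1 (z\<^sup>2 / c\<^sup>2)) * indicator {0<..} c \<le>
      indicator {0..z} c + ennreal (z\<^sup>2 / c\<^sup>2) * indicator {z..} c"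
    proof (cases "c \<le> z")
      case True
      then have "ennreal (min 1 (z\<^sup>2 / c\<^sup>2)) * indicator {0<..} c \<le> indicator {0..z} c"
        by (auto simp: indicator_def ennreal_le_1)
      then show ?thesis by (meson add_increasing2 zero_le order_trans)
    qed (auto simp: indicator_def)
  qed
  also have "\<dots> = ennreal z + ennreal z" by (subst nn_integral_add) (auto simp: 1 2)
  finally show ?thesis by (simp add: mult_2)
qed (auto simp: nn_integral_0_iff_AE)

lemma (in sigma_finite_measure) nn_integral_layer_cake:
  assumes [measurable]: "Y \<in> borel_measurable M" and pos: "\<And>\<omega>. 0 \<le> Y \<omega>"
  shows "(\<integral>\<^sup>+\<omega>. ennreal (Y \<omega>) \<partial>M) =
    (\<integral>\<^sup>+c. emeasure M {\<omega>\<in>space M. c < Y \<omega>} * indicator {0<..} c \<partial>lborel)"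
proof -
  interpret P: pair_sigma_finite lborel M by standard
  have "(\<integral>\<^sup>+\<omega>. ennreal (Y \<omega>) \<partial>M) = (\<integral>\<^sup>+\<omega>. (\<integral>\<^sup>+c. indicator {c. 0 < c \<and> c < Y \<omega>} c \<partial>lborel) \<partial>M)"
  proof (rule nn_integral_cong)
    fix \<omega>
    have "{c. 0 < c \<and> c < Y \<omega>} = {0<..<Y \<omega>}" by auto
    then show "ennreal (Y \<omega>) = (\<integral>\<^sup>+c. indicator {c. 0 < c \<and> c < Y \<omega>} c \<partial>lborel)"
      using pos[of \<omega>] by simp
  qed
  also have "\<dots> = (\<integral>\<^sup>+c. (\<integral>\<^sup>+\<omega>. indicator {c. 0 < c \<and> c < Y \<omega>} c \<partial>M) \<partial>lborel)"
    by (rule P.Fubini') (simp add: indicator_def, measurable)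
  also have "\<dots> = (\<integral>\<^sup>+c. emeasure M {\<omega>\<in>space M. c < Y \<omega>} * indicator {0<..} c \<partial>lborel)"
  proof (rule nn_integral_cong)
    fix c :: real
    have "(\<integral>\<^sup>+\<omega>. indicator {c. 0 < c \<and> c < Y \<omega>} c \<partial>M) =
        (\<integral>\<^sup>+\<omega>. indicator {\<omega>\<in>space M. c < Y \<omega>} \<omega> * indicator {0<..} c \<partial>M)"
      by (rule nn_integral_cong) (auto simp: indicator_def)
    also have "\<dots> = emeasure M {\<omega>\<in>space M. c < Y \<omega>} * indicator {0<..} c"
      by (subst nn_integral_multc) auto
    finally show "(\<integral>\<^sup>+\<omega>. indicator {c. 0 < c \<and> c < Y \<omega>} c \<partial>M) = \<dots>" .
  qed
  finally show ?thesis .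
qed

text \<open>The hypothesis is what truncation at level \<open>c\<close> and Chebyshev's inequality give for a process
  whose square is dominated by the increasing predictable process with terminal value \<open>Z\<^sup>2\<close>.\<close>

lemma (in sigma_finite_measure) domination_inequality:
  assumes Y[measurable]: "Y \<in> borel_measurable M" and Z[measurable]: "Z \<in> borel_measurable M"
    and pos: "\<And>\<omega>. 0 \<le> Y \<omega>" "\<And>\<omega>. 0 \<le> Z \<omega>"
    and dom: "\<And>c. 0 < c \<Longrightarrow> emeasure M {\<omega>\<in>space M. c < Y \<omega>} \<le>
      emeasure M {\<omega>\<in>space M. c < Z \<omega>} + (\<integral>\<^sup>+\<omega>. ennreal (min 1 ((Z \<omega>)\<^sup>2 / c\<^sup>2)) \<partial>M)"
  shows "(\<integral>\<^sup>+\<omega>. ennreal (Y \<omega>) \<partial>M) \<le> 3 * (\<integral>\<^sup>+\<omega>. ennreal (Z \<omega>) \<partial>M)"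
proof -
  interpret P: pair_sigma_finite lborel M by standard
  let ?m = "\<lambda>c \<omega>. ennreal (min 1 ((Z \<omega>)\<^sup>2 / c\<^sup>2))"
  have "(\<integral>\<^sup>+\<omega>. ennreal (Y \<omega>) \<partial>M) \<le>
     (\<integral>\<^sup>+c. emeasure M {\<omega>\<in>space M. c < Z \<omega>} * indicator {0<..} c +
        (\<integral>\<^sup>+\<omega>. ?m c \<omega> * indicator {0<..} c \<partial>M) \<partial>lborel)"
    unfolding nn_integral_layer_cake[OF Y pos(1)]
  proof (rule nn_integral_mono)
    fix c :: real
    show "emeasure M {\<omega>\<in>space M. c < Y \<omega>} * indicator {0<..} c \<le>
      emeasure M {\<omega>\<in>space M. c < Z \<omega>} * indicator {0<..} c + (\<integral>\<^sup>+\<omega>. ?m c \<omega> * indicator {0<..} c \<partial>M)"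
      using dom[of c] by (cases "0 < c") auto
  qed
  also have "\<dots> = (\<integral>\<^sup>+\<omega>. ennreal (Z \<omega>) \<partial>M) + (\<integral>\<^sup>+c. (\<integral>\<^sup>+\<omega>. ?m c \<omega> * indicator {0<..} c \<partial>M) \<partial>lborel)"
    unfolding nn_integral_layer_cake[OF Z pos(2)] by (rule nn_integral_add) measurable
  also have "(\<integral>\<^sup>+c. (\<integral>\<^sup>+\<omega>. ?m c \<omega> * indicator {0<..} c \<partial>M) \<partial>lborel) =
      (\<integral>\<^sup>+\<omega>. (\<integral>\<^sup>+c. ?m c \<omega> * indicator {0<..} c \<partial>lborel) \<partial>M)"
    by (rule P.Fubini'[symmetric]) measurable
  also have "\<dots> \<le> (\<integral>\<^sup>+\<omega>. 2 * ennreal (Z \<omega>) \<partial>M)"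
    by (intro nn_integral_mono nn_integral_min_square pos)
  also have "\<dots> = 2 * (\<integral>\<^sup>+\<omega>. ennreal (Z \<omega>) \<partial>M)" by (rule nn_integral_cmult) measurable
  finally have "(\<integral>\<^sup>+\<omega>. ennreal (Y \<omega>) \<partial>M) \<le> (\<integral>\<^sup>+\<omega>. ennreal (Z \<omega>) \<partial>M) + 2 * (\<integral>\<^sup>+\<omega>. ennreal (Z \<omega>) \<partial>M)"
    by (simp add: add_left_mono)
  also have "\<dots> = (1 + 2) * (\<integral>\<^sup>+\<omega>. ennreal (Z \<omega>) \<partial>M)" by (simp only: distrib_right mult_1)
  finally show ?thesis by simp
qed

section \<open>Elementary processes on a common partition\<close>

text \<open>On the interval \<open>(p k, p (Suc k)]\<close> the process is the random finite-rank operator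
  \<open>\<Sum>i\<in>I. 1\<^bsub>A k i\<^esub> \<langle>v i, \<cdot>\<rangle> h i\<close>.\<close>

locale partitioned = cylindrical_wiener M F Q K e lam \<beta> W
  for M :: "'w measure" and F and Q :: "'u::{real_inner, banach, second_countable_topology} \<Rightarrow>\<^sub>L 'u"
    and K e lam \<beta> W +
  fixes p :: "nat \<Rightarrow> real" and I :: "nat set" and A :: "nat \<Rightarrow> nat \<Rightarrow> 'w set"
    and v :: "nat \<Rightarrow> 'u" and h :: "nat \<Rightarrow> 'h::{real_inner, banach, second_countable_topology}"
  assumes p0: "0 \<le> p 0" and p_Suc: "p k \<le> p (Suc k)" and I: "finite I"
    and A: "i \<in> I \<Longrightarrow> A k i \<in> sets (F (p k))"
begin

definition step :: "nat \<Rightarrow> 'w \<Rightarrow> 'h" where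
  "step k \<omega> = (\<Sum>i\<in>I. (indicator (A k i) \<omega> * dW (p k) (p (Suc k)) (v i) \<omega>) *\<^sub>R h i)"

definition op :: "nat \<Rightarrow> 'w \<Rightarrow> 'u \<Rightarrow> 'h" where
  "op k \<omega> u = (\<Sum>i\<in>I. indicator (A k i) \<omega> *\<^sub>R rank1 (R (v i)) (h i) u)"

definition energy :: "nat \<Rightarrow> 'w \<Rightarrow> real" where
  "energy N \<omega> = (\<Sum>k<N. (p (Suc k) - p k) * (hs (op k \<omega>))\<^sup>2)"

lemma p_mono: "i \<le> j \<Longrightarrow> p i \<le> p j"
  by (rule lift_Suc_mono_le[of p, OF p_Suc])

lemma p_nonneg: "0 \<le> p k"
  using p0 p_mono[of 0 k] by simp

lemma A_indicator: "k \<le> l \<Longrightarrow> i \<in> I \<Longrightarrow> (indicator (A k i) :: 'w \<Rightarrow> real) \<in> borel_measurable (F (p l))"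
  using A[of i k] F_mono[of "p k" "p l"] p_nonneg p_mono by (intro borel_measurable_indicator) auto

lemma A_indicator_M: "i \<in> I \<Longrightarrow> (indicator (A k i) :: 'w \<Rightarrow> real) \<in> borel_measurable M"
  using A_indicator[of k k i] p_nonneg by (auto intro: F_measurable)

lemma hs_op_square: "(hs (op k \<omega>))\<^sup>2 = (\<Sum>i\<in>I. \<Sum>j\<in>I. indicator (A k i) \<omega> * indicator (A k j) \<omega> *
    (blinfun_apply Q (v i) \<bullet> v j) * (h i \<bullet> h j))"
  unfolding op_def by (rule hs_square_finite_rank[OF I])

lemma hs_op_measurable: "k \<le> l \<Longrightarrow> (\<lambda>\<omega>. (hs (op k \<omega>))\<^sup>2) \<in> borel_measurable (F (p l))"
  unfolding hs_op_square by (intro borel_measurable_sum borel_measurable_times A_indicator) auto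

text \<open>The shift of index is the predictability of the energy: the cell from \<open>p k\<close>
  to \<open>p (Suc k)\<close> is already counted, but its operator depends only on the sets
  \<open>A k i\<close>, known at time \<open>p k\<close>.\<close>

lemma energy_measurable: "(\<lambda>\<omega>. energy (Suc k) \<omega>) \<in> borel_measurable (F (p k))"
  unfolding energy_def
  by (intro borel_measurable_sum borel_measurable_times hs_op_measurable) auto

lemma energy_measurable_M [measurable]: "energy N \<in> borel_measurable M"
proof (cases N)
  case (Suc k)
  then show ?thesis using energy_measurable[of k] p_nonneg by (auto intro: F_measurable)
qed (simp add: energy_def[abs_def])

lemma energy_term_nonneg: "0 \<le> (p (Suc k) - p k) * (hs (op k \<omega>))\<^sup>2"
  using p_Suc[of k] by simp

lemma energy_nonneg: "0 \<le> energy N \<omega>"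
  unfolding energy_def by (intro sum_nonneg energy_term_nonneg)

lemma energy_mono: "m \<le> n \<Longrightarrow> energy m \<omega> \<le> energy n \<omega>"
  unfolding energy_def by (intro sum_mono2) (auto intro: energy_term_nonneg)

lemma step_measurable [measurable]: "step k \<in> borel_measurable M"
  unfolding step_def[abs_def] using p_nonneg
  by (intro borel_measurable_sum borel_measurable_scaleR borel_measurable_times A_indicator_M
      borel_measurable_diff W_measurable borel_measurable_const)

section \<open>Orthogonality of the increments and the isometry\<close>

abbreviation pairing :: "nat \<Rightarrow> nat \<Rightarrow> nat \<Rightarrow> nat \<Rightarrow> 'w \<Rightarrow> real" where
  "pairing k l i j \<omega> \<equiv> (indicator (A k i) \<omega> * dW (p k) (p (Suc k)) (v i) \<omega>) *
     (indicator (A l j) \<omega> * dW (p l) (p (Suc l)) (v j) \<omega>)"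

lemma sqint_factor: "i \<in> I \<Longrightarrow> sqint M (\<lambda>\<omega>. indicator (A k i) \<omega> * dW (p k) (p (Suc k)) (v i) \<omega>)"
  using p_nonneg p_Suc by (intro sqint_bounded_mult sqint_dW A_indicator_M) (auto simp: indicator_def)

lemma pairing_integrable: "i \<in> I \<Longrightarrow> j \<in> I \<Longrightarrow> integrable M (pairing k l i j)"
  by (intro sqint_mult sqint_factor)

text \<open>Everything except the later increment is known at \<open>p l\<close>, because the
  earlier cell ends by then; it is collected into one factor \<open>?G\<close>, against which the
  later increment has mean zero.\<close>

lemma pairing_integral_less:
  assumes "i \<in> I" "j \<in> I" "k < l"
  shows "(\<integral>\<omega>. pairing k l i j \<omega> \<partial>M) = 0"
proof -
  let ?G = "\<lambda>\<omega>. indicator (A l j) \<omega> * (indicator (A k i) \<omega> * dW (p k) (p (Suc k)) (v i) \<omega>)"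
  have le: "p (Suc k) \<le> p l" using assms by (intro p_mono) simp
  have "W t u \<in> borel_measurable (F (p l))" if "t \<le> p l" "0 \<le> t" for t u
    using that by (intro F_measurable_mono[OF _ _ W_adapted]) auto
  then have "?G \<in> borel_measurable (F (p l))"
    using assms le p_nonneg p_Suc[of k]
    by (intro borel_measurable_times A_indicator borel_measurable_diff) (auto intro: order_trans)
  moreover have "sqint M ?G"
    using assms by (intro sqint_bounded_mult sqint_factor A_indicator_M) (auto simp: indicator_def)
  then have "integrable M ?G" by (auto simp: sqint_def intro: square_integrable_imp_integrable)
  ultimately have "(\<integral>\<omega>. ?G \<omega> * dW (p l) (p (Suc l)) (v j) \<omega> \<partial>M) = 0"
    by (intro dW_indep(1) p_nonneg p_Suc)
  then show ?thesis by (simp add: mult_ac)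
qed

lemma pairing_integral_same:
  assumes "i \<in> I" "j \<in> I"
  shows "(\<integral>\<omega>. pairing k k i j \<omega> \<partial>M) =
    (p (Suc k) - p k) * (\<integral>\<omega>. indicator (A k i) \<omega> * indicator (A k j) \<omega> * (blinfun_apply Q (v i) \<bullet> v j) \<partial>M)"
proof -
  let ?G = "\<lambda>\<omega>. indicator (A k i) \<omega> * indicator (A k j) \<omega> :: real"
  have m: "?G \<in> borel_measurable (F (p k))"
    using assms by (intro borel_measurable_times A_indicator) auto
  have "integrable M ?G"
    using F_measurable[OF p_nonneg m] by (intro integrable_const_bound[where B = 1]) (auto simp: indicator_def)
  from dW_indep(3)[OF p_nonneg p_Suc m this, of "v i" "v j"]
  have "(\<integral>\<omega>. ?G \<omega> * (dW (p k) (p (Suc k)) (v i) \<omega> * dW (p k) (p (Suc k)) (v j) \<omega>) \<partial>M) =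
      (\<integral>\<omega>. ?G \<omega> \<partial>M) * ((p (Suc k) - p k) * (blinfun_apply Q (v i) \<bullet> v j))" .
  moreover have "(\<integral>\<omega>. pairing k k i j \<omega> \<partial>M) =
      (\<integral>\<omega>. ?G \<omega> * (dW (p k) (p (Suc k)) (v i) \<omega> * dW (p k) (p (Suc k)) (v j) \<omega>) \<partial>M)"
    by (rule Bochner_Integration.integral_cong) (simp_all only: mult_ac)
  ultimately show ?thesis by simp
qed

lemma step_inner: "step k \<omega> \<bullet> step l \<omega> = (\<Sum>i\<in>I. \<Sum>j\<in>I. pairing k l i j \<omega> * (h i \<bullet> h j))"
  unfolding step_def inner_sum_left inner_sum_right
  by (subst sum.swap) (simp add: sum_distrib_left mult_ac inner_commute)

lemma step_inner_integrable: "integrable M (\<lambda>\<omega>. step k \<omega> \<bullet> step l \<omega>)"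
  unfolding step_inner
  by (intro Bochner_Integration.integrable_sum integrable_mult_left pairing_integrable)

lemma step_inner_integral:
  "(\<integral>\<omega>. step k \<omega> \<bullet> step l \<omega> \<partial>M) = (\<Sum>i\<in>I. \<Sum>j\<in>I. (\<integral>\<omega>. pairing k l i j \<omega> \<partial>M) * (h i \<bullet> h j))"
proof -
  have int: "integrable M (\<lambda>\<omega>. pairing k l i j \<omega> * (h i \<bullet> h j))" if "i \<in> I" "j \<in> I" for i j
    using that by (intro integrable_mult_left pairing_integrable)
  have "(\<integral>\<omega>. step k \<omega> \<bullet> step l \<omega> \<partial>M) = (\<Sum>i\<in>I. \<Sum>j\<in>I. \<integral>\<omega>. pairing k l i j \<omega> * (h i \<bullet> h j) \<partial>M)"
    unfolding step_inner by (rule integral_double_sum(2)) (rule int)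
  then show ?thesis by (simp only: integral_mult_left_zero)
qed

lemma step_orthogonal: "k \<noteq> l \<Longrightarrow> (\<integral>\<omega>. step k \<omega> \<bullet> step l \<omega> \<partial>M) = 0"
proof (induction k l rule: linorder_wlog)
  case (le k l)
  then show ?case
    unfolding step_inner_integral by (intro sum.neutral ballI) (simp add: pairing_integral_less)
qed (simp add: inner_commute)

text \<open>Both sides are the same double sum: the covariance of the increments supplies exactly
  the coefficients of \<open>hs_op_square\<close>.\<close>

lemma hs_op_integrable: "integrable M (\<lambda>\<omega>. (hs (op k \<omega>))\<^sup>2)"
  and step_square_integral: "(\<integral>\<omega>. step k \<omega> \<bullet> step k \<omega> \<partial>M) = (p (Suc k) - p k) * (\<integral>\<omega>. (hs (op k \<omega>))\<^sup>2 \<partial>M)"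
proof -
  let ?g = "\<lambda>i j \<omega>. indicator (A k i) \<omega> * indicator (A k j) \<omega> * (blinfun_apply Q (v i) \<bullet> v j)"
  have g: "integrable M (?g i j)" if "i \<in> I" "j \<in> I" for i j
    using that
    by (intro integrable_mult_left integrable_const_bound[where B = 1] borel_measurable_times A_indicator_M)
       (auto simp: indicator_def)
  have int: "integrable M (\<lambda>\<omega>. ?g i j \<omega> * (h i \<bullet> h j))" if "i \<in> I" "j \<in> I" for i j
    using that by (intro integrable_mult_left[OF g])
  show "integrable M (\<lambda>\<omega>. (hs (op k \<omega>))\<^sup>2)"
    unfolding hs_op_square by (rule integral_double_sum(1)) (rule int)
  have "(\<integral>\<omega>. (hs (op k \<omega>))\<^sup>2 \<partial>M) = (\<Sum>i\<in>I. \<Sum>j\<in>I. \<integral>\<omega>. ?g i j \<omega> * (h i \<bullet> h j) \<partial>M)"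
    unfolding hs_op_square by (rule integral_double_sum(2)) (rule int)
  then have hs_int: "(\<integral>\<omega>. (hs (op k \<omega>))\<^sup>2 \<partial>M) = (\<Sum>i\<in>I. \<Sum>j\<in>I. (\<integral>\<omega>. ?g i j \<omega> \<partial>M) * (h i \<bullet> h j))"
    by (simp only: integral_mult_left_zero)
  have "(\<integral>\<omega>. step k \<omega> \<bullet> step k \<omega> \<partial>M) =
      (\<Sum>i\<in>I. \<Sum>j\<in>I. ((p (Suc k) - p k) * (\<integral>\<omega>. ?g i j \<omega> \<partial>M)) * (h i \<bullet> h j))"
    unfolding step_inner_integral by (intro sum.cong refl) (simp only: pairing_integral_same)
  also have "\<dots> = (p (Suc k) - p k) * (\<Sum>i\<in>I. \<Sum>j\<in>I. (\<integral>\<omega>. ?g i j \<omega> \<partial>M) * (h i \<bullet> h j))"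
    by (simp only: sum_distrib_left mult.assoc)
  finally show "(\<integral>\<omega>. step k \<omega> \<bullet> step k \<omega> \<partial>M) = (p (Suc k) - p k) * (\<integral>\<omega>. (hs (op k \<omega>))\<^sup>2 \<partial>M)"
    unfolding hs_int .
qed

lemma isometry:
  "integrable M (\<lambda>\<omega>. (norm (\<Sum>k<N. step k \<omega>))\<^sup>2)"
  "(\<integral>\<omega>. (norm (\<Sum>k<N. step k \<omega>))\<^sup>2 \<partial>M) = (\<integral>\<omega>. energy N \<omega> \<partial>M)"
  "integrable M (energy N)"
proof -
  have eq: "(norm (\<Sum>k<N. step k \<omega>))\<^sup>2 = (\<Sum>k<N. \<Sum>l<N. step k \<omega> \<bullet> step l \<omega>)" for \<omega>
    by (simp add: power2_norm_eq_inner inner_sum_left inner_sum_right)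
       (subst sum.swap, simp)
  show "integrable M (\<lambda>\<omega>. (norm (\<Sum>k<N. step k \<omega>))\<^sup>2)"
    unfolding eq by (rule integral_double_sum(1)[OF step_inner_integrable])
  show "integrable M (energy N)"
    unfolding energy_def[abs_def]
    by (intro Bochner_Integration.integrable_sum integrable_mult_right hs_op_integrable)
  have "(\<integral>\<omega>. (norm (\<Sum>k<N. step k \<omega>))\<^sup>2 \<partial>M) = (\<Sum>k<N. \<Sum>l<N. \<integral>\<omega>. step k \<omega> \<bullet> step l \<omega> \<partial>M)"
    unfolding eq by (rule integral_double_sum(2)[OF step_inner_integrable])
  also have "\<dots> = (\<Sum>k<N. \<Sum>l<N. if l = k then (\<integral>\<omega>. step k \<omega> \<bullet> step k \<omega> \<partial>M) else 0)"
    by (intro sum.cong refl) (auto simp: step_orthogonal)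
  also have "\<dots> = (\<Sum>k<N. (p (Suc k) - p k) * (\<integral>\<omega>. (hs (op k \<omega>))\<^sup>2 \<partial>M))"
    by (simp add: step_square_integral)
  also have "\<dots> = (\<Sum>k<N. \<integral>\<omega>. (p (Suc k) - p k) * (hs (op k \<omega>))\<^sup>2 \<partial>M)"
    by (simp only: integral_mult_right_zero)
  also have "\<dots> = (\<integral>\<omega>. energy N \<omega> \<partial>M)"
    unfolding energy_def
    by (rule Bochner_Integration.integral_sum[symmetric]) (intro integrable_mult_right hs_op_integrable)
  finally show "(\<integral>\<omega>. (norm (\<Sum>k<N. step k \<omega>))\<^sup>2 \<partial>M) = (\<integral>\<omega>. energy N \<omega> \<partial>M)" .
qed

lemma nn_isometry:
  "(\<integral>\<^sup>+\<omega>. ennreal ((norm (\<Sum>k<N. step k \<omega>))\<^sup>2) \<partial>M) = (\<integral>\<^sup>+\<omega>. ennreal (energy N \<omega>) \<partial>M)"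
  using isometry[of N] by (simp add: nn_integral_eq_integral energy_nonneg)

text \<open>A stopping rule tested on \<open>energy (Suc k)\<close> and not on
  \<open>energy k\<close>: a cell is kept only if the energy including that cell is still within the
  level. This excludes overshoot, and by \<open>energy_measurable\<close> the decision is known at
  \<open>p k\<close>.\<close>

definition cut :: "real \<Rightarrow> nat \<Rightarrow> nat \<Rightarrow> 'w set" where
  "cut c k i = A k i \<inter> {\<omega>\<in>space M. energy (Suc k) \<omega> \<le> c}"

lemma cut_partitioned: "partitioned M F Q K e lam \<beta> W p I (cut c)"
proof
  fix i k assume "i \<in> I"
  have "{\<omega>\<in>space (F (p k)). energy (Suc k) \<omega> \<le> c} \<in> sets (F (p k))"
    using energy_measurable[of k] by measurable
  then show "cut c k i \<in> sets (F (p k))"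
    unfolding cut_def using A[OF \<open>i \<in> I\<close>, of k] space_F[OF p_nonneg[of k]] by auto
qed (rule p0 p_Suc I)+

text \<open>An instance of Lenglart's domination argument. On paths with terminal energy at most
  \<open>c^2\<close> truncation changes nothing; the other paths are charged to the tail of
  \<open>sqrt (energy N)\<close>.\<close>

theorem burkholder_inequality:
  "(\<integral>\<^sup>+\<omega>. ennreal (norm (\<Sum>k<N. step k \<omega>)) \<partial>M) \<le> 3 * (\<integral>\<^sup>+\<omega>. ennreal (sqrt (energy N \<omega>)) \<partial>M)"
proof (rule domination_inequality)
  fix c :: real assume c: "0 < c"
  interpret C: partitioned M F Q K e lam \<beta> W p I "cut (c\<^sup>2)" v h by (rule cut_partitioned)
  have c2: "0 < c\<^sup>2" using c by simp
  have ind: "indicator (cut (c\<^sup>2) k i) \<omega> = (if energy (Suc k) \<omega> \<le> c\<^sup>2 then indicator (A k i) \<omega> else (0::real))"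
    if "\<omega> \<in> space M" for k i \<omega>
    using that by (auto simp: cut_def indicator_def)
  have step_C: "C.step k \<omega> = (if energy (Suc k) \<omega> \<le> c\<^sup>2 then step k \<omega> else 0)" if "\<omega> \<in> space M" for k \<omega>
    using that by (simp add: C.step_def step_def ind)
  have op_C: "C.op k \<omega> = (if energy (Suc k) \<omega> \<le> c\<^sup>2 then op k \<omega> else (\<lambda>u. 0))" if "\<omega> \<in> space M" for k \<omega>
    using that by (auto simp: C.op_def op_def ind fun_eq_iff)
  \<comment> \<open>Energies increase with the index, so the kept cells form an initial segment:
    either \<open>energy (Suc n)\<close> is still within the level, or cell \<open>n\<close>
    contributes nothing.\<close>
  have energy_C: "C.energy n \<omega> \<le> min (c\<^sup>2) (energy n \<omega>)" if \<omega>: "\<omega> \<in> space M" for n \<omega>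
  proof (induction n)
    case (Suc n)
    show ?case
    proof (cases "energy (Suc n) \<omega> \<le> c\<^sup>2")
      case True
      then have "C.energy (Suc n) \<omega> \<le> energy (Suc n) \<omega>"
        using Suc by (simp add: C.energy_def energy_def op_C[OF \<omega>])
      then show ?thesis using True by simp
    next
      case False
      then have "C.energy (Suc n) \<omega> = C.energy n \<omega>"
        by (simp add: C.energy_def op_C[OF \<omega>])
      then show ?thesis using Suc energy_mono[of n "Suc n" \<omega>] by simp
    qed
  qed (simp add: C.energy_def energy_def)
  let ?Y = "\<lambda>\<omega>. norm (\<Sum>k<N. step k \<omega>)" and ?Y' = "\<lambda>\<omega>. norm (\<Sum>k<N. C.step k \<omega>)"
  have same: "?Y \<omega> = ?Y' \<omega>" if "\<omega> \<in> space M" "energy N \<omega> \<le> c\<^sup>2" for \<omega>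
  proof -
    have "step k \<omega> = C.step k \<omega>" if "k < N" for k
      using energy_mono[of "Suc k" N \<omega>] that \<open>energy N \<omega> \<le> c\<^sup>2\<close> by (simp add: step_C[OF \<open>\<omega> \<in> space M\<close>])
    then show ?thesis by simp
  qed
  have "{\<omega>\<in>space M. c < ?Y \<omega>} \<subseteq> {\<omega>\<in>space M. c < sqrt (energy N \<omega>)} \<union> {\<omega>\<in>space M. c < ?Y' \<omega>}"
  proof clarify
    fix \<omega> assume *: "\<omega> \<in> space M" "c < ?Y \<omega>" "\<not> c < ?Y' \<omega>"
    then have "c\<^sup>2 < energy N \<omega>" using same[of \<omega>] by force
    then show "c < sqrt (energy N \<omega>)" using c by (simp add: real_less_rsqrt)
  qed
  then have "emeasure M {\<omega>\<in>space M. c < ?Y \<omega>} \<le>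
      emeasure M ({\<omega>\<in>space M. c < sqrt (energy N \<omega>)} \<union> {\<omega>\<in>space M. c < ?Y' \<omega>})"
    by (intro emeasure_mono) measurable
  also have "\<dots> \<le> emeasure M {\<omega>\<in>space M. c < sqrt (energy N \<omega>)} + emeasure M {\<omega>\<in>space M. c < ?Y' \<omega>}"
    by (intro emeasure_subadditive) measurable
  \<comment> \<open>Chebyshev's inequality for the truncated sum: by the isometry its second moment
    is its mean energy, which is pathwise at most both \<open>c^2\<close> and
    \<open>energy N\<close>.\<close>
  also have "emeasure M {\<omega>\<in>space M. c < ?Y' \<omega>} \<le> (\<integral>\<^sup>+\<omega>. ennreal (min 1 ((sqrt (energy N \<omega>))\<^sup>2 / c\<^sup>2)) \<partial>M)"
  proof -
    have "emeasure M {\<omega>\<in>space M. c < ?Y' \<omega>} = (\<integral>\<^sup>+\<omega>. indicator {\<omega>\<in>space M. c < ?Y' \<omega>} \<omega> \<partial>M)"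
      by simp
    also have "\<dots> \<le> (\<integral>\<^sup>+\<omega>. ennreal (1 / c\<^sup>2) * ennreal ((?Y' \<omega>)\<^sup>2) \<partial>M)"
    proof (rule nn_integral_mono)
      fix \<omega>
      have "1 \<le> 1 / c\<^sup>2 * (?Y' \<omega>)\<^sup>2" if "c < ?Y' \<omega>"
        using power_mono[of c "?Y' \<omega>" 2] c that by (simp add: divide_simps)
      then show "indicator {\<omega>\<in>space M. c < ?Y' \<omega>} \<omega> \<le> ennreal (1 / c\<^sup>2) * ennreal ((?Y' \<omega>)\<^sup>2)"
        using c by (auto simp: indicator_def simp flip: ennreal_mult')
    qed
    also have "\<dots> = ennreal (1 / c\<^sup>2) * (\<integral>\<^sup>+\<omega>. ennreal (C.energy N \<omega>) \<partial>M)"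
      unfolding C.nn_isometry[symmetric] by (rule nn_integral_cmult) measurable
    also have "\<dots> = (\<integral>\<^sup>+\<omega>. ennreal (1 / c\<^sup>2) * ennreal (C.energy N \<omega>) \<partial>M)"
      by (rule nn_integral_cmult[symmetric]) measurable
    also have "\<dots> \<le> (\<integral>\<^sup>+\<omega>. ennreal (min 1 ((sqrt (energy N \<omega>))\<^sup>2 / c\<^sup>2)) \<partial>M)"
    proof (rule nn_integral_mono)
      fix \<omega> assume "\<omega> \<in> space M"
      then have "1 / c\<^sup>2 * C.energy N \<omega> \<le> min 1 ((sqrt (energy N \<omega>))\<^sup>2 / c\<^sup>2)"
        using energy_C[of \<omega> N] c2 energy_nonneg[of N \<omega>] by (simp add: divide_simps)
      then show "ennreal (1 / c\<^sup>2) * ennreal (C.energy N \<omega>) \<le> ennreal (min 1 ((sqrt (energy N \<omega>))\<^sup>2 / c\<^sup>2))"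
        by (simp flip: ennreal_mult' add: ennreal_leI)
    qed
    finally show ?thesis .
  qed
  finally show "emeasure M {\<omega>\<in>space M. c < ?Y \<omega>} \<le> emeasure M {\<omega>\<in>space M. c < sqrt (energy N \<omega>)} +
      (\<integral>\<^sup>+\<omega>. ennreal (min 1 ((sqrt (energy N \<omega>))\<^sup>2 / c\<^sup>2)) \<partial>M)"
    by (simp add: add_left_mono)
qed (auto simp: energy_nonneg)

end

section \<open>Isometry and Burkholder inequality for elementary processes\<close>

text \<open>The telescoping identity is stated for every \<open>f\<close> because it is used twice:
  with a path of \<open>W\<close> it splits the integral, and with a jump function it splits the
  indicator of a time interval.\<close>

lemma common_partition:
  fixes P :: "real set"
  assumes P: "finite P" "P \<subseteq> {0..}"
  obtains p :: "nat \<Rightarrow> real" and N where "0 \<le> p 0" "\<And>k. p k \<le> p (Suc k)" "\<And>k. k < N \<Longrightarrow> p (Suc k) \<in> P"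
    "\<And>a b (f::real \<Rightarrow> real). a \<in> P \<Longrightarrow> b \<in> P \<Longrightarrow> a \<le> b \<Longrightarrow>
      f b - f a = (\<Sum>k<N. if a \<le> p k \<and> p (Suc k) \<le> b then f (p (Suc k)) - f (p k) else 0)"
proof (cases "P = {}")
  case True
  then show ?thesis using that[of "\<lambda>_. 0" 0] by simp
next
  case False
  define xs where "xs = sorted_list_of_set P"
  define N where "N = length xs - 1"
  \<comment> \<open>Past the last point the sequence stays constant, so monotonicity holds for all
    \<open>k\<close> and empty or one-point \<open>P\<close> cause no harm to the indexing.\<close>
  define p where "p k = xs ! min k N" for k
  have xs: "set xs = P" "sorted_wrt (<) xs" "sorted xs" using P by (auto simp: xs_def)
  then have "xs \<noteq> []" using False by auto
  then have len: "length xs = Suc N" by (simp add: N_def)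
  have le_iff: "xs ! i \<le> xs ! j \<longleftrightarrow> i \<le> j" if "i \<le> N" "j \<le> N" for i j
    using sorted_nth_mono[OF xs(3), of i j] sorted_wrt_nth_less[OF xs(2), of j i] that len
    by (cases "i \<le> j") auto
  have mem: "p k \<in> P" for k
    unfolding p_def xs(1)[symmetric] using len by (intro nth_mem) auto
  show ?thesis
  proof
    show "0 \<le> p 0" using mem[of 0] P(2) by auto
    show "p k \<le> p (Suc k)" for k unfolding p_def by (subst le_iff) auto
    show "p (Suc k) \<in> P" for k by (rule mem)
    fix a b :: real and f :: "real \<Rightarrow> real" assume "a \<in> P" "b \<in> P" "a \<le> b"
    then obtain m n where mn: "a = xs ! m" "b = xs ! n" "m \<le> N" "n \<le> N"
      unfolding xs(1)[symmetric] in_set_conv_nth len by (metis less_Suc_eq_le)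
    then have "m \<le> n" using \<open>a \<le> b\<close> le_iff by simp
    have "(\<Sum>k<N. if a \<le> p k \<and> p (Suc k) \<le> b then f (p (Suc k)) - f (p k) else 0) =
        (\<Sum>k<N. if m \<le> k \<and> Suc k \<le> n then f (xs ! Suc k) - f (xs ! k) else 0)"
      using mn by (intro sum.cong refl) (simp add: p_def le_iff)
    also have "\<dots> = (\<Sum>k\<in>{m..<n}. f (xs ! Suc k) - f (xs ! k))"
      using mn by (intro sum.mono_neutral_cong_right) auto
    also have "\<dots> = f b - f a" using sum_Suc_diff'[OF \<open>m \<le> n\<close>, of "\<lambda>k. f (xs ! k)"] mn by simp
    finally show "f b - f a = (\<Sum>k<N. if a \<le> p k \<and> p (Suc k) \<le> b then f (p (Suc k)) - f (p k) else 0)" ..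
  qed
qed

context cylindrical_wiener
begin

text \<open>The intervals of a list may overlap. Refining all of them to one partition makes the
  integral a sum of martingale differences and the process constant in time on each cell, so the
  estimates for \<open>partitioned\<close> apply.\<close>

lemma elementary_estimates:
  fixes E :: "('w, 'u, 'h::{real_inner, banach, second_countable_topology}) elementary"
  assumes E: "elementary F t E"
  shows elem_integral_measurable: "elem_integral W E \<in> borel_measurable M"
    and elem_isometry: "(\<integral>\<^sup>+\<omega>. ennreal ((norm (elem_integral W E \<omega>))\<^sup>2) \<partial>M) =
      (\<integral>\<^sup>+\<omega>. (\<integral>\<^sup>+\<tau>\<in>{0..t}. ennreal ((hs (elem_process Q E \<tau> \<omega>))\<^sup>2) \<partial>lborel) \<partial>M)"
    and elem_isometry_finite: "(\<integral>\<^sup>+\<omega>. ennreal ((norm (elem_integral W E \<omega>))\<^sup>2) \<partial>M) < \<infinity>"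
    and elem_burkholder: "(\<integral>\<^sup>+\<omega>. ennreal (norm (elem_integral W E \<omega>)) \<partial>M) \<le>
      3 * (\<integral>\<^sup>+\<omega>. ennreal (sqrt (enn2real
        (\<integral>\<^sup>+\<tau>\<in>{0..t}. ennreal ((hs (elem_process Q E \<tau> \<omega>))\<^sup>2) \<partial>lborel))) \<partial>M)"
proof -
  let ?n = "length E"
  define s where "s i = fst (E ! i)" for i
  define r where "r i = fst (snd (E ! i))" for i
  define D where "D i = fst (snd (snd (E ! i)))" for i
  define v where "v i = fst (snd (snd (snd (E ! i))))" for i
  define h where "h i = snd (snd (snd (snd (E ! i))))" for i
  have nth: "E ! i = (s i, r i, D i, v i, h i)" for i
    by (simp add: s_def r_def D_def v_def h_def)
  have el: "0 \<le> s i \<and> s i < r i \<and> r i \<le> t \<and> D i \<in> sets (F (s i))" if "i < ?n" for i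
    using E that nth[of i] unfolding elementary_def by (metis (no_types, lifting) case_prodD nth_mem)
  define P where "P = s ` {..<?n} \<union> r ` {..<?n}"
  have "finite P" "P \<subseteq> {0..}" "P \<subseteq> {..t}" using el by (force simp: P_def)+
  then obtain p :: "nat \<Rightarrow> real" and N where p: "0 \<le> p 0" "\<And>k. p k \<le> p (Suc k)" "\<And>k. k < N \<Longrightarrow> p (Suc k) \<in> P"
    and tel: "\<And>a b (f::real \<Rightarrow> real). a \<in> P \<Longrightarrow> b \<in> P \<Longrightarrow> a \<le> b \<Longrightarrow>
      f b - f a = (\<Sum>k<N. if a \<le> p k \<and> p (Suc k) \<le> b then f (p (Suc k)) - f (p k) else 0)"
    using common_partition[of P] by blast
  \<comment> \<open>An entry is switched on exactly on the cells inside its own interval;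
    \<open>D i\<close>, known at \<open>s i\<close>, is still known at the later time
    \<open>p k\<close>.\<close>
  define A where "A k i = (if s i \<le> p k \<and> p (Suc k) \<le> r i then D i else {})" for k i
  interpret partitioned M F Q K e lam \<beta> W p "{..<?n}" A v h
  proof
    fix i k assume "i \<in> {..<?n}"
    then show "A k i \<in> sets (F (p k))" using el[of i] F_mono[of "s i" "p k"] by (auto simp: A_def)
  qed (use p in auto)
  have tel_i: "indicator (D i) \<omega> * (f (r i) - f (s i)) = (\<Sum>k<N. indicator (A k i) \<omega> * (f (p (Suc k)) - f (p k)))"
    if "i < ?n" for i \<omega> and f :: "real \<Rightarrow> real"
  proof -
    have eq: "f (r i) - f (s i) = (\<Sum>k<N. if s i \<le> p k \<and> p (Suc k) \<le> r i then f (p (Suc k)) - f (p k) else 0)"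
      using that el[OF that] by (intro tel) (auto simp: P_def)
    show ?thesis unfolding eq sum_distrib_left by (intro sum.cong refl) (simp add: A_def)
  qed
  have int: "elem_integral W E \<omega> = (\<Sum>k<N. step k \<omega>)" for \<omega>
  proof -
    have "elem_integral W E \<omega> = (\<Sum>i<?n. (indicator (D i) \<omega> * (W (r i) (v i) \<omega> - W (s i) (v i) \<omega>)) *\<^sub>R h i)"
      unfolding elem_integral_def by (simp add: sum_list_sum_nth atLeast0LessThan nth)
    also have "\<dots> = (\<Sum>i<?n. \<Sum>k<N. (indicator (A k i) \<omega> * dW (p k) (p (Suc k)) (v i) \<omega>) *\<^sub>R h i)"
    proof (intro sum.cong refl)
      fix i assume "i \<in> {..<?n}"
      then show "(indicator (D i) \<omega> * (W (r i) (v i) \<omega> - W (s i) (v i) \<omega>)) *\<^sub>R h i =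
          (\<Sum>k<N. (indicator (A k i) \<omega> * dW (p k) (p (Suc k)) (v i) \<omega>) *\<^sub>R h i)"
        using tel_i[of i \<omega> "\<lambda>x. W x (v i) \<omega>"] by (simp flip: scaleR_sum_left)
    qed
    also have "\<dots> = (\<Sum>k<N. step k \<omega>)" unfolding step_def by (rule sum.swap)
    finally show ?thesis .
  qed
  have proc: "elem_process Q E \<tau> \<omega> b = (\<Sum>k<N. (indicator {p k<..p (Suc k)} \<tau> :: real) *\<^sub>R op k \<omega> b)"
    if "b \<in> B" for \<tau> \<omega> b
  proof -
    \<comment> \<open>The indicator of a half-open interval is an increment of the jump function
      \<open>c \<mapsto> (if \<tau> \<le> c then 1 else 0)\<close>, so \<open>tel_i\<close> applies
      to it as it did to \<open>W\<close>.\<close>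
    have ind: "indicator {a<..c} \<tau> = (if \<tau> \<le> c then 1 else 0) - (if \<tau> \<le> a then 1 else (0::real))" if "a \<le> c" for a c
      using that by (auto simp: indicator_def)
    have "elem_process Q E \<tau> \<omega> b = (\<Sum>i<?n. (indicator {s i<..r i} \<tau> * indicator (D i) \<omega> * (v i \<bullet> b)) *\<^sub>R h i)"
      using B_U0[OF that] unfolding elem_process_def by (simp add: sum_list_sum_nth atLeast0LessThan nth)
    also have "\<dots> = (\<Sum>i<?n. \<Sum>k<N. (indicator (A k i) \<omega> * indicator {p k<..p (Suc k)} \<tau> * (v i \<bullet> b)) *\<^sub>R h i)"
    proof (intro sum.cong refl)
      fix i assume "i \<in> {..<?n}"
      then have eq: "indicator {s i<..r i} \<tau> * indicator (D i) \<omega> = (\<Sum>k<N. indicator (A k i) \<omega> * (indicator {p k<..p (Suc k)} \<tau> :: real))"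
        using tel_i[of i \<omega> "\<lambda>c. if \<tau> \<le> c then 1 else 0"] el[of i] p(2) by (simp add: ind mult.commute)
      show "(indicator {s i<..r i} \<tau> * indicator (D i) \<omega> * (v i \<bullet> b)) *\<^sub>R h i =
          (\<Sum>k<N. (indicator (A k i) \<omega> * indicator {p k<..p (Suc k)} \<tau> * (v i \<bullet> b)) *\<^sub>R h i)"
        unfolding eq sum_distrib_right scaleR_sum_left ..
    qed
    also have "\<dots> = (\<Sum>k<N. \<Sum>i<?n. (indicator (A k i) \<omega> * indicator {p k<..p (Suc k)} \<tau> * (v i \<bullet> b)) *\<^sub>R h i)"
      by (rule sum.swap)
    also have "\<dots> = (\<Sum>k<N. (indicator {p k<..p (Suc k)} \<tau> :: real) *\<^sub>R op k \<omega> b)"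
      unfolding op_def scaleR_sum_right using B_U0[OF that] by (simp add: rank1_R mult_ac)
    finally show ?thesis .
  qed
  \<comment> \<open>The cells are disjoint, so at a given time at most one operator is active and no
    cross terms arise.\<close>
  have hs_proc: "(hs (elem_process Q E \<tau> \<omega>))\<^sup>2 = (\<Sum>k<N. indicator {p k<..p (Suc k)} \<tau> * (hs (op k \<omega>))\<^sup>2)" for \<tau> \<omega>
  proof (cases "\<exists>k<N. \<tau> \<in> {p k<..p (Suc k)}")
    case True
    then obtain k where k: "k < N" "\<tau> \<in> {p k<..p (Suc k)}" by blast
    have "\<tau> \<notin> {p l<..p (Suc l)}" if "l \<noteq> k" for l
      using that k p_mono[of "Suc l" k] p_mono[of "Suc k" l] by (cases "l < k") auto
    then have ind: "indicator {p l<..p (Suc l)} \<tau> = (if l = k then 1 else (0::real))" for l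
      using k by (auto simp: indicator_def)
    have "hs (elem_process Q E \<tau> \<omega>) = hs (op k \<omega>)"
      using k by (intro hs_cong) (simp add: proc ind if_distrib[of "\<lambda>c. c *\<^sub>R _"] cong: if_cong)
    then show ?thesis using k by (simp add: ind if_distrib[of "\<lambda>c. c * _"] cong: if_cong)
  next
    case False
    then have z: "indicator {p k<..p (Suc k)} \<tau> = (0::real)" if "k < N" for k
      using that by (auto simp: indicator_def)
    then have "hs (elem_process Q E \<tau> \<omega>) = hs (\<lambda>u. 0 :: 'h)"
      by (intro hs_cong) (simp add: proc)
    then show ?thesis using z by simp
  qed
  have en: "(\<integral>\<^sup>+\<tau>\<in>{0..t}. ennreal ((hs (elem_process Q E \<tau> \<omega>))\<^sup>2) \<partial>lborel) = ennreal (energy N \<omega>)" for \<omega>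
  proof -
    have "(\<integral>\<^sup>+\<tau>\<in>{0..t}. ennreal ((hs (elem_process Q E \<tau> \<omega>))\<^sup>2) \<partial>lborel) =
        (\<integral>\<^sup>+\<tau>. (\<Sum>k<N. ennreal ((hs (op k \<omega>))\<^sup>2) * indicator {p k<..p (Suc k)} \<tau>) \<partial>lborel)"
    proof (rule nn_integral_cong)
      fix \<tau> :: real
      have sub: "k < N \<Longrightarrow> {p k<..p (Suc k)} \<subseteq> {0..t}" for k
        using p(3)[of k] p_nonneg[of k] \<open>P \<subseteq> {..t}\<close> by auto
      have "ennreal ((hs (elem_process Q E \<tau> \<omega>))\<^sup>2) * indicator {0..t} \<tau> =
          (\<Sum>k<N. ennreal ((hs (op k \<omega>))\<^sup>2) * indicator {p k<..p (Suc k)} \<tau>) * indicator {0..t} \<tau>"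
        unfolding hs_proc by (subst sum_ennreal[symmetric]) (auto simp: indicator_def intro!: sum.cong)
      also have "\<dots> = (\<Sum>k<N. ennreal ((hs (op k \<omega>))\<^sup>2) * indicator {p k<..p (Suc k)} \<tau>)"
        unfolding sum_distrib_right
      proof (intro sum.cong refl)
        fix k assume "k \<in> {..<N}"
        then show "ennreal ((hs (op k \<omega>))\<^sup>2) * indicator {p k<..p (Suc k)} \<tau> * indicator {0..t} \<tau> =
            ennreal ((hs (op k \<omega>))\<^sup>2) * indicator {p k<..p (Suc k)} \<tau>"
          using subsetD[OF sub[of k], of \<tau>] by (auto simp: indicator_def)
      qed
      finally show "ennreal ((hs (elem_process Q E \<tau> \<omega>))\<^sup>2) * indicator {0..t} \<tau> = \<dots>" .
    qed
    also have "\<dots> = (\<Sum>k<N. ennreal ((hs (op k \<omega>))\<^sup>2) * ennreal (p (Suc k) - p k))"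
      using p(2) by (subst nn_integral_sum) (auto simp: nn_integral_cmult_indicator)
    also have "\<dots> = ennreal (energy N \<omega>)"
      unfolding energy_def using p(2)
      by (subst sum_ennreal[symmetric]) (auto simp: ennreal_mult' mult.commute)
    finally show ?thesis .
  qed
  have intE: "elem_integral W E = (\<lambda>\<omega>. \<Sum>k<N. step k \<omega>)" using int by auto
  show "elem_integral W E \<in> borel_measurable M" unfolding intE by measurable
  show "(\<integral>\<^sup>+\<omega>. ennreal ((norm (elem_integral W E \<omega>))\<^sup>2) \<partial>M) =
      (\<integral>\<^sup>+\<omega>. (\<integral>\<^sup>+\<tau>\<in>{0..t}. ennreal ((hs (elem_process Q E \<tau> \<omega>))\<^sup>2) \<partial>lborel) \<partial>M)"
    unfolding en int by (rule nn_isometry)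
  show "(\<integral>\<^sup>+\<omega>. ennreal ((norm (elem_integral W E \<omega>))\<^sup>2) \<partial>M) < \<infinity>"
    unfolding int using isometry(1)[of N] by (simp add: nn_integral_eq_integral)
  show "(\<integral>\<^sup>+\<omega>. ennreal (norm (elem_integral W E \<omega>)) \<partial>M) \<le>
      3 * (\<integral>\<^sup>+\<omega>. ennreal (sqrt (enn2real
        (\<integral>\<^sup>+\<tau>\<in>{0..t}. ennreal ((hs (elem_process Q E \<tau> \<omega>))\<^sup>2) \<partial>lborel))) \<partial>M)"
    unfolding en int using burkholder_inequality[of N] by (simp add: energy_nonneg)
qed

section \<open>The predictable measure space\<close>

text \<open>Time times probability, restricted to the predictable sigma-algebra: measurability for
  \<open>nu t\<close> means predictability, while integrals are still computed by Fubini. The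
  integral in the definition of \<open>N2\<close> is the squared norm for this measure.\<close>

definition nu :: "real \<Rightarrow> (real \<times> 'w) measure" where
  "nu t = restr_to_subalg (restrict_space (lborel \<Otimes>\<^sub>M M) ({0..t} \<times> space M)) (predictable M F t)"

abbreviation pred_generator :: "real \<Rightarrow> (real \<times> 'w) set set" where
  "pred_generator t \<equiv> {{s<..r} \<times> A | s r A. 0 \<le> s \<and> s < r \<and> r \<le> t \<and> A \<in> sets (F s)} \<union>
      {{0} \<times> A | A. A \<in> sets (F 0)}"

lemma F_subset: "0 \<le> s \<Longrightarrow> A \<in> sets (F s) \<Longrightarrow> A \<subseteq> space M"
  using sets_F[of s] sets.sets_into_space by blast

lemma F_sets_M: "0 \<le> s \<Longrightarrow> A \<in> sets (F s) \<Longrightarrow> A \<in> sets M"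
  using sets_F[of s] by blast

lemma pred_generator_Pow: "0 \<le> t \<Longrightarrow> pred_generator t \<subseteq> Pow ({0..t} \<times> space M)"
  using F_subset by fastforce

lemma space_predictable: "0 \<le> t \<Longrightarrow> space (predictable M F t) = {0..t} \<times> space M"
  unfolding predictable_def by (rule space_measure_of[OF pred_generator_Pow])

lemma sets_predictable:
  "0 \<le> t \<Longrightarrow> sets (predictable M F t) = sigma_sets ({0..t} \<times> space M) (pred_generator t)"
  unfolding predictable_def by (rule sets_measure_of[OF pred_generator_Pow])

lemma rect_sets: "{0..t::real} \<times> space M \<in> sets (lborel \<Otimes>\<^sub>M M)"
  by (intro pair_measureI) auto

lemma subalgebra_predictable:
  assumes "0 \<le> t"
  shows "subalgebra (restrict_space (lborel \<Otimes>\<^sub>M M) ({0..t} \<times> space M)) (predictable M F t)"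
  unfolding subalgebra_def
proof
  show sp: "space (predictable M F t) = space (restrict_space (lborel \<Otimes>\<^sub>M M) ({0..t} \<times> space M))"
    by (auto simp: space_predictable[OF assms] space_restrict_space space_pair_measure)
  show "sets (predictable M F t) \<subseteq> sets (restrict_space (lborel \<Otimes>\<^sub>M M) ({0..t} \<times> space M))"
    unfolding sets_predictable[OF assms]
  proof (rule sets.sigma_sets_subset')
    show "pred_generator t \<subseteq> sets (restrict_space (lborel \<Otimes>\<^sub>M M) ({0..t} \<times> space M))"
    proof
      fix P assume P: "P \<in> pred_generator t"
      then have "P \<in> sets (lborel \<Otimes>\<^sub>M M)" by (auto intro!: pair_measureI intro: F_sets_M)
      moreover have "P \<subseteq> {0..t} \<times> space M" using P pred_generator_Pow[OF assms] by blast
      ultimately show "P \<in> sets (restrict_space (lborel \<Otimes>\<^sub>M M) ({0..t} \<times> space M))"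
        by (simp add: sets_restrict_space_iff space_pair_measure Int_absorb2 rect_sets Sigma_mono)
    qed
    show "{0..t} \<times> space M \<in> sets (restrict_space (lborel \<Otimes>\<^sub>M M) ({0..t} \<times> space M))"
      using sets.top[of "restrict_space (lborel \<Otimes>\<^sub>M M) ({0..t} \<times> space M)"]
      by (simp add: sp[symmetric] space_predictable[OF assms])
  qed
qed

lemma sets_nu: "0 \<le> t \<Longrightarrow> sets (nu t) = sets (predictable M F t)"
  unfolding nu_def by (rule sets_restr_to_subalg[OF subalgebra_predictable])

lemma space_nu: "0 \<le> t \<Longrightarrow> space (nu t) = {0..t} \<times> space M"
  using sets_eq_imp_space_eq[OF sets_nu] space_predictable by simp

lemma nu_measurable_pair:
  fixes f :: "real \<times> 'w \<Rightarrow> ennreal"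
  assumes "0 \<le> t" "f \<in> borel_measurable (nu t)"
  shows "(\<lambda>x. f x * indicator ({0..t} \<times> space M) x) \<in> borel_measurable (lborel \<Otimes>\<^sub>M M)"
proof -
  have "f \<in> borel_measurable (predictable M F t)"
    using assms(2) measurable_cong_sets[OF sets_nu[OF assms(1)] refl] by blast
  then have "f \<in> borel_measurable (restrict_space (lborel \<Otimes>\<^sub>M M) ({0..t} \<times> space M))"
    by (rule measurable_from_subalg[OF subalgebra_predictable[OF assms(1)]])
  then show ?thesis
    by (subst (asm) borel_measurable_restrict_space_iff_ennreal) (auto simp: rect_sets space_pair_measure)
qed

lemma nu_integral_measurable:
  fixes f :: "real \<times> 'w \<Rightarrow> ennreal"
  assumes t: "0 \<le> t" and f: "f \<in> borel_measurable (nu t)"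
  shows "(\<lambda>\<omega>. \<integral>\<^sup>+\<tau>\<in>{0..t}. f (\<tau>, \<omega>) \<partial>lborel) \<in> borel_measurable M"
proof -
  have "(\<lambda>(\<omega>, \<tau>). f (\<tau>, \<omega>) * indicator ({0..t} \<times> space M) (\<tau>, \<omega>)) \<in> borel_measurable (M \<Otimes>\<^sub>M lborel)"
    using measurable_compose[OF measurable_pair_swap' nu_measurable_pair[OF t f]] by (simp add: split_def)
  from lborel.borel_measurable_nn_integral[OF this]
  have "(\<lambda>\<omega>. \<integral>\<^sup>+\<tau>. f (\<tau>, \<omega>) * indicator ({0..t} \<times> space M) (\<tau>, \<omega>) \<partial>lborel) \<in> borel_measurable M" .
  then show ?thesis
    by (rule measurable_cong[THEN iffD1, rotated]) (auto simp: indicator_def intro!: nn_integral_cong)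
qed

lemma nn_integral_nu:
  fixes f :: "real \<times> 'w \<Rightarrow> ennreal"
  assumes t: "0 \<le> t" and f: "f \<in> borel_measurable (nu t)"
  shows "(\<integral>\<^sup>+x. f x \<partial>nu t) = (\<integral>\<^sup>+\<omega>. (\<integral>\<^sup>+\<tau>\<in>{0..t}. f (\<tau>, \<omega>) \<partial>lborel) \<partial>M)"
proof -
  interpret P: pair_sigma_finite lborel M by standard
  have "f \<in> borel_measurable (predictable M F t)"
    using f measurable_cong_sets[OF sets_nu[OF t] refl] by blast
  then have "(\<integral>\<^sup>+x. f x \<partial>nu t) = (\<integral>\<^sup>+x. f x \<partial>(restrict_space (lborel \<Otimes>\<^sub>M M) ({0..t} \<times> space M)))"
    unfolding nu_def by (rule nn_integral_subalgebra2[OF subalgebra_predictable[OF t]])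
  also have "\<dots> = (\<integral>\<^sup>+x. f x * indicator ({0..t} \<times> space M) x \<partial>(lborel \<Otimes>\<^sub>M M))"
    by (rule nn_integral_restrict_space) (auto simp: space_pair_measure rect_sets)
  also have "\<dots> = (\<integral>\<^sup>+\<omega>. (\<integral>\<^sup>+\<tau>. f (\<tau>, \<omega>) * indicator ({0..t} \<times> space M) (\<tau>, \<omega>) \<partial>lborel) \<partial>M)"
    by (rule P.nn_integral_snd[OF nu_measurable_pair[OF t f], symmetric])
  also have "\<dots> = (\<integral>\<^sup>+\<omega>. (\<integral>\<^sup>+\<tau>\<in>{0..t}. f (\<tau>, \<omega>) \<partial>lborel) \<partial>M)"
    by (intro nn_integral_cong) (auto simp: indicator_def)
  finally show ?thesis .
qed

lemma nu_interval: "0 \<le> s \<Longrightarrow> s < r \<Longrightarrow> r \<le> t \<Longrightarrow> A \<in> sets (F s) \<Longrightarrow> {s<..r} \<times> A \<in> sets (nu t)"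
  by (auto simp: sets_nu sets_predictable intro!: sigma_sets.Basic)

lemma nu_zero: "0 \<le> t \<Longrightarrow> A \<in> sets (F 0) \<Longrightarrow> {0} \<times> A \<in> sets (nu t)"
  by (auto simp: sets_nu sets_predictable intro!: sigma_sets.Basic)

text \<open>Elementary processes live on intervals open at the left and never charge time 0; the
  generators located there are null and may be approximated by zero.\<close>

lemma emeasure_nu_zero: "0 \<le> t \<Longrightarrow> A \<in> sets (F 0) \<Longrightarrow> emeasure (nu t) ({0} \<times> A) = 0"
proof -
  assume t: "0 \<le> t" and A: "A \<in> sets (F 0)"
  have ind: "indicator ({0} \<times> A) (\<tau>, \<omega>) * indicator {0..t} \<tau> =
      (indicator A \<omega> * indicator {0} \<tau> :: ennreal)" for \<tau> :: real and \<omega>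
    using t by (auto simp: indicator_def)
  have "emeasure (nu t) ({0} \<times> A) = (\<integral>\<^sup>+x. indicator ({0} \<times> A) x \<partial>nu t)"
    using nu_zero[OF t A] by simp
  also have "\<dots> = (\<integral>\<^sup>+\<omega>. (\<integral>\<^sup>+\<tau>. indicator A \<omega> * indicator {0::real} \<tau> \<partial>lborel) \<partial>M)"
    unfolding nn_integral_nu[OF t borel_measurable_indicator[OF nu_zero[OF t A]]] ind ..
  also have "\<dots> = 0" by (simp add: nn_integral_cmult)
  finally show ?thesis .
qed

lemma finite_measure_nu: "0 \<le> t \<Longrightarrow> finite_measure (nu t)"
proof
  assume t: "0 \<le> t"
  have "emeasure (nu t) (space (nu t)) = (\<integral>\<^sup>+x. 1 \<partial>nu t)" by simp
  also have "\<dots> = (\<integral>\<^sup>+\<omega>. (\<integral>\<^sup>+\<tau>\<in>{0..t}. 1 \<partial>lborel) \<partial>M)" by (rule nn_integral_nu[OF t]) simp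
  also have "\<dots> = ennreal t" using t by (simp add: emeasure_space_1)
  finally show "emeasure (nu t) (space (nu t)) \<noteq> \<infinity>" by simp
qed

section \<open>Density of elementary processes\<close>

text \<open>Processes are written as functions of the pair \<open>(\<tau>, \<omega>)\<close>. Since the basis is countable,
  measurability of the coordinates suffices for measurability of the Hilbert--Schmidt norm, and
  it is stable under sums without any appeal to separability of \<open>L20 Q\<close>.\<close>

definition cmeas :: "real \<Rightarrow> (real \<times> 'w \<Rightarrow> 'u \<Rightarrow> 'h::{real_inner, banach, second_countable_topology}) \<Rightarrow> bool" where
  "cmeas t G \<longleftrightarrow> (\<forall>x\<in>space (nu t). G x \<in> L20 Q) \<and> (\<forall>b\<in>B. (\<lambda>x. G x b) \<in> borel_measurable (nu t))"

lemma cmeas_L20: "cmeas t G \<Longrightarrow> x \<in> space (nu t) \<Longrightarrow> G x \<in> L20 Q"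
  by (simp add: cmeas_def)

lemma cmeas_ell2: "cmeas t G \<Longrightarrow> x \<in> space (nu t) \<Longrightarrow> ell2 (G x)"
  by (intro L20_ell2 cmeas_L20)

lemma cmeas_coordinate: "cmeas t G \<Longrightarrow> b \<in> B \<Longrightarrow> (\<lambda>x. G x b) \<in> borel_measurable (nu t)"
  by (simp add: cmeas_def)

lemma cmeas_add: "cmeas t G \<Longrightarrow> cmeas t G' \<Longrightarrow> cmeas t (\<lambda>x u. G x u + G' x u)"
  by (auto simp: cmeas_def intro!: L20_add borel_measurable_add)

lemma cmeas_diff: "cmeas t G \<Longrightarrow> cmeas t G' \<Longrightarrow> cmeas t (\<lambda>x u. G x u - G' x u)"
  by (auto simp: cmeas_def intro!: L20_diff borel_measurable_diff)

lemma cmeas_rank1: "ker_perp y \<Longrightarrow> f \<in> borel_measurable (nu t) \<Longrightarrow> cmeas t (\<lambda>x. rank1 y (f x))"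
  by (auto simp: cmeas_def rank1_B rank1_L20 cong: measurable_cong)

text \<open>The infinite sum is a supremum over the finite subsets of the basis, of which there are
  only countably many.\<close>

lemma hs_square_measurable:
  assumes G: "cmeas t G"
  shows "(\<lambda>x. ennreal ((hs (G x))\<^sup>2)) \<in> borel_measurable (nu t)"
proof -
  have "(\<lambda>x. SUP C\<in>{C. finite C \<and> C \<subseteq> B}. ennreal (\<Sum>b\<in>C. (norm (G x b))\<^sup>2)) \<in> borel_measurable (nu t)"
    by (intro borel_measurable_SUP countable_Collect_finite_subset countable_B
        measurable_compose[OF _ measurable_ennreal] borel_measurable_sum borel_measurable_power
        measurable_compose[OF _ borel_measurable_norm] cmeas_coordinate[OF G]) auto
  moreover have "ennreal ((hs (G x))\<^sup>2) = (SUP C\<in>{C. finite C \<and> C \<subseteq> B}. ennreal (\<Sum>b\<in>C. (norm (G x b))\<^sup>2))"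
    if "x \<in> space (nu t)" for x
    unfolding hs_square using cmeas_ell2[OF G that]
    by (intro infsum_nonneg_is_SUPREMUM_ennreal) (auto simp: ell2_def)
  ultimately show ?thesis by (simp cong: measurable_cong)
qed

lemma nu_section_measurable:
  assumes t: "0 \<le> t" and G: "cmeas t (\<lambda>x. \<Phi> (fst x) (snd x))" and \<omega>: "\<omega> \<in> space M"
  shows "(\<lambda>\<tau>. ennreal ((hs (\<Phi> \<tau> \<omega>))\<^sup>2) * indicator {0..t} \<tau>) \<in> borel_measurable lborel"
  using measurable_compose[OF measurable_Pair2'[OF \<omega>, of lborel] nu_measurable_pair[OF t hs_square_measurable[OF G]]] \<omega>
  by (simp add: indicator_times)

text \<open>A squared distance, so the triangle inequality holds only with factors 2, which suffices
  for convergence to zero.\<close>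

definition d2 :: "real \<Rightarrow> (real \<times> 'w \<Rightarrow> 'u \<Rightarrow> 'h::{real_inner, banach, second_countable_topology}) \<Rightarrow>
    (real \<times> 'w \<Rightarrow> 'u \<Rightarrow> 'h) \<Rightarrow> ennreal" where
  "d2 t G G' = (\<integral>\<^sup>+x. ennreal ((hs (\<lambda>u. G x u - G' x u))\<^sup>2) \<partial>nu t)"

lemma d2_cong: "(\<And>x b. x \<in> space (nu t) \<Longrightarrow> b \<in> B \<Longrightarrow> norm (G x b - G' x b) = norm (L x b - L' x b)) \<Longrightarrow>
    d2 t G G' = d2 t L L'"
  unfolding d2_def by (intro nn_integral_cong arg_cong[where f = "\<lambda>c. ennreal (c\<^sup>2)"] hs_cong)

lemma nn_integral_le_double_sum:
  fixes f :: "'x \<Rightarrow> real"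
  assumes "(\<lambda>x. ennreal (g x)) \<in> borel_measurable N" "(\<lambda>x. ennreal (k x)) \<in> borel_measurable N"
    and "\<And>x. x \<in> space N \<Longrightarrow> f x \<le> 2 * g x + 2 * k x" "\<And>x. 0 \<le> g x" "\<And>x. 0 \<le> k x"
  shows "(\<integral>\<^sup>+x. ennreal (f x) \<partial>N) \<le> 2 * (\<integral>\<^sup>+x. ennreal (g x) \<partial>N) + 2 * (\<integral>\<^sup>+x. ennreal (k x) \<partial>N)"
proof -
  have "(\<integral>\<^sup>+x. ennreal (f x) \<partial>N) \<le> (\<integral>\<^sup>+x. 2 * ennreal (g x) + 2 * ennreal (k x) \<partial>N)"
  proof (rule nn_integral_mono)
    fix x assume "x \<in> space N"
    then have "ennreal (f x) \<le> ennreal (2 * g x + 2 * k x)" by (intro ennreal_leI assms)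
    also have "\<dots> = 2 * ennreal (g x) + 2 * ennreal (k x)"
      using assms(4,5)[of x] by (simp add: ennreal_plus ennreal_mult)
    finally show "ennreal (f x) \<le> 2 * ennreal (g x) + 2 * ennreal (k x)" .
  qed
  also have "\<dots> = 2 * (\<integral>\<^sup>+x. ennreal (g x) \<partial>N) + 2 * (\<integral>\<^sup>+x. ennreal (k x) \<partial>N)"
    using assms(1,2) by (simp add: nn_integral_add nn_integral_cmult)
  finally show ?thesis .
qed

lemma d2_triangle:
  assumes "cmeas t G" "cmeas t G'" "cmeas t G''"
  shows "d2 t G G'' \<le> 2 * d2 t G G' + 2 * d2 t G' G''"
  unfolding d2_def using assms
  by (intro nn_integral_le_double_sum hs_square_measurable cmeas_diff hs_diff_square_le cmeas_ell2[of t])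
     (auto intro: cmeas_diff)

lemma d2_add:
  assumes "cmeas t G1" "cmeas t G1'" "cmeas t G2" "cmeas t G2'"
  shows "d2 t (\<lambda>x u. G1 x u + G2 x u) (\<lambda>x u. G1' x u + G2' x u) \<le> 2 * d2 t G1 G1' + 2 * d2 t G2 G2'"
proof -
  have "d2 t (\<lambda>x u. G1 x u + G2 x u) (\<lambda>x u. G1' x u + G2' x u) =
      d2 t (\<lambda>x u. G1 x u - G1' x u) (\<lambda>x u. G2' x u - G2 x u)"
    by (rule d2_cong) (simp add: algebra_simps)
  also have "\<dots> \<le> 2 * d2 t (\<lambda>x u. G1 x u - G1' x u) (\<lambda>x u. 0) + 2 * d2 t (\<lambda>x u. 0) (\<lambda>x u. G2' x u - G2 x u)"
    using assms L20_zero by (intro d2_triangle cmeas_diff) (auto simp: cmeas_def)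
  also have "d2 t (\<lambda>x u. G1 x u - G1' x u) (\<lambda>x u. 0) = d2 t G1 G1'" by (rule d2_cong) simp
  also have "d2 t (\<lambda>x u. 0) (\<lambda>x u. G2' x u - G2 x u) = d2 t G2 G2'" by (rule d2_cong) simp
  finally show ?thesis .
qed

section \<open>Elementary processes and their closure under \<open>d2\<close>\<close>

abbreviation el :: "('w, 'u, 'h::{real_inner, banach, second_countable_topology}) elementary \<Rightarrow> real \<times> 'w \<Rightarrow> 'u \<Rightarrow> 'h" where
  "el E x \<equiv> elem_process Q E (fst x) (snd x)"

lemma elementary_Nil: "elementary F t []"
  by (simp add: elementary_def)

lemma elementary_append: "elementary F t (E @ E') \<longleftrightarrow> elementary F t E \<and> elementary F t E'"
  by (simp add: elementary_def ball_Un)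

lemma el_Nil: "el [] x u = 0"
  by (simp add: elem_process_def)

lemma el_append: "el (E @ E') x u = el E x u + el E' x u"
  by (simp add: elem_process_def)

lemma el_Cons: "el ((s, r, A, v, h) # E) x u =
    rank1 (R v) ((indicator ({s<..r} \<times> A) x :: real) *\<^sub>R h) u + el E x u"
proof (cases "u \<in> U0 Q")
  case True
  then show ?thesis by (simp add: elem_process_def rank1_R indicator_times mult_ac)
qed (simp add: elem_process_def rank1_def)

lemma cmeas_el:
  fixes E :: "('w, 'u, 'h::{real_inner, banach, second_countable_topology}) elementary"
  shows "0 \<le> t \<Longrightarrow> elementary F t E \<Longrightarrow> cmeas t (el E)"
proof (induction E)
  case Nil
  have "el [] = (\<lambda>x u. 0 :: 'h)" by (simp add: fun_eq_iff el_Nil)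
  then show ?case by (simp add: cmeas_def L20_zero)
next
  case (Cons a E)
  obtain s r A v h where a: "a = (s, r, A, v, h)" by (cases a) auto
  have "{s<..r} \<times> A \<in> sets (nu t)" "elementary F t E"
    using Cons.prems nu_interval by (auto simp: elementary_def a)
  then have "cmeas t (\<lambda>x u. rank1 (R v) ((indicator ({s<..r} \<times> A) x :: real) *\<^sub>R h) u + el E x u)"
    using Cons by (intro cmeas_add cmeas_rank1 ker_perp_R) auto
  moreover have "el (a # E) = (\<lambda>x u. rank1 (R v) ((indicator ({s<..r} \<times> A) x :: real) *\<^sub>R h) u + el E x u)"
    by (simp add: fun_eq_iff a el_Cons)
  ultimately show ?case by simp
qed

definition approximable :: "real \<Rightarrow> (real \<times> 'w \<Rightarrow> 'u \<Rightarrow> 'h::{real_inner, banach, second_countable_topology}) \<Rightarrow> bool" where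
  "approximable t G \<longleftrightarrow> cmeas t G \<and> (\<forall>\<epsilon>>0. \<exists>E. elementary F t E \<and> d2 t (el E) G < ennreal \<epsilon>)"

lemma approximable_cmeas: "approximable t G \<Longrightarrow> cmeas t G"
  by (simp add: approximable_def)

text \<open>Closedness of the closure. The factors 2 in \<open>d2_triangle\<close> explain the
  tolerance \<open>\<epsilon>/4\<close>.\<close>

lemma approximable_limit:
  assumes t: "0 \<le> t" and G: "cmeas t G" and lim: "\<And>\<epsilon>. 0 < \<epsilon> \<Longrightarrow> \<exists>G'. approximable t G' \<and> d2 t G' G < ennreal \<epsilon>"
  shows "approximable t G"
  unfolding approximable_def
proof (intro conjI allI impI G)
  fix \<epsilon> :: real assume \<epsilon>: "0 < \<epsilon>"
  then obtain G' where G': "approximable t G'" "d2 t G' G < ennreal (\<epsilon>/4)"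
    using lim[of "\<epsilon>/4"] by auto
  then obtain E where E: "elementary F t E" "d2 t (el E) G' < ennreal (\<epsilon>/4)"
    using \<epsilon> unfolding approximable_def by (meson zero_less_divide_iff zero_less_numeral)
  have "d2 t (el E) G \<le> 2 * d2 t (el E) G' + 2 * d2 t G' G"
    by (intro d2_triangle cmeas_el t E G approximable_cmeas G')
  also have "\<dots> < 2 * ennreal (\<epsilon>/4) + 2 * ennreal (\<epsilon>/4)"
    by (intro add_strict_mono ennreal_mult_strict_left_mono E G') auto
  also have "\<dots> = ennreal \<epsilon>"
    using \<epsilon> by (simp flip: ennreal_numeral ennreal_mult ennreal_plus)
  finally show "\<exists>E. elementary F t E \<and> d2 t (el E) G < ennreal \<epsilon>" using E by blast
qed

lemma approximable_tendsto:
  assumes "0 \<le> t" "cmeas t G" "\<And>n::nat. approximable t (G' n)" "(\<lambda>n. d2 t (G' n) G) \<longlonglongrightarrow> 0"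
  shows "approximable t G"
proof (rule approximable_limit[OF assms(1,2)])
  fix \<epsilon> :: real assume "0 < \<epsilon>"
  then have "eventually (\<lambda>n. d2 t (G' n) G < ennreal \<epsilon>) sequentially"
    by (intro order_tendstoD(2)[OF assms(4)]) simp
  then show "\<exists>G'. approximable t G' \<and> d2 t G' G < ennreal \<epsilon>"
    using assms(3) by (auto simp: eventually_sequentially)
qed

lemma approximable_add:
  assumes t: "0 \<le> t" and G: "approximable t G" "approximable t G'"
  shows "approximable t (\<lambda>x u. G x u + G' x u)"
  unfolding approximable_def
proof (intro conjI allI impI cmeas_add approximable_cmeas G)
  fix \<epsilon> :: real assume \<epsilon>: "0 < \<epsilon>"
  then have "0 < \<epsilon>/4" by simp
  then obtain E E' where E: "elementary F t E" "d2 t (el E) G < ennreal (\<epsilon>/4)"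
      "elementary F t E'" "d2 t (el E') G' < ennreal (\<epsilon>/4)"
    using G unfolding approximable_def by blast
  have "d2 t (el (E @ E')) (\<lambda>x u. G x u + G' x u) =
      d2 t (\<lambda>x u. el E x u + el E' x u) (\<lambda>x u. G x u + G' x u)"
    by (rule d2_cong) (simp add: el_append)
  also have "\<dots> \<le> 2 * d2 t (el E) G + 2 * d2 t (el E') G'"
    by (intro d2_add cmeas_el t E approximable_cmeas G)
  also have "\<dots> < 2 * ennreal (\<epsilon>/4) + 2 * ennreal (\<epsilon>/4)"
    by (intro add_strict_mono ennreal_mult_strict_left_mono E) auto
  also have "\<dots> = ennreal \<epsilon>"
    using \<epsilon> by (simp flip: ennreal_numeral ennreal_mult ennreal_plus)
  finally show "\<exists>E. elementary F t E \<and> d2 t (el E) (\<lambda>x u. G x u + G' x u) < ennreal \<epsilon>"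
    using E elementary_append by blast
qed

lemma approximable_cong:
  assumes "approximable t G" "cmeas t G'" "\<And>x b. x \<in> space (nu t) \<Longrightarrow> b \<in> B \<Longrightarrow> G x b = G' x b"
  shows "approximable t G'"
proof -
  have "d2 t (el E) G = d2 t (el E) G'" for E by (rule d2_cong) (simp add: assms(3))
  then show ?thesis using assms unfolding approximable_def by auto
qed

lemma cmeas_zero: "cmeas t (\<lambda>x u. 0)"
  by (simp add: cmeas_def L20_zero)

lemma approximable_null:
  assumes "0 \<le> t" "cmeas t G" "d2 t (\<lambda>x u. 0) G = 0"
  shows "approximable t G"
  unfolding approximable_def using assms elementary_Nil
  by (auto intro!: exI[of _ "[]"] simp: el_Nil[abs_def])

lemma approximable_zero: "0 \<le> t \<Longrightarrow> approximable t (\<lambda>x u. 0)"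
  by (rule approximable_null) (auto simp: cmeas_zero d2_def)

lemma approximable_sum:
  "finite I \<Longrightarrow> 0 \<le> t \<Longrightarrow> (\<And>i. i \<in> I \<Longrightarrow> approximable t (G i)) \<Longrightarrow> approximable t (\<lambda>x u. \<Sum>i\<in>I. G i x u)"
  by (induction I rule: finite_induct) (auto intro: approximable_add approximable_zero)

lemma rank1_diff: "rank1 y h u - rank1 y h' u = rank1 y (h - h') u"
  and rank1_diff_left: "rank1 y h u - rank1 y' h u = rank1 (y - y') h u"
  and rank1_add: "rank1 y h u + rank1 y h' u = rank1 y (h + h') u"
  and rank1_sum: "(\<Sum>i\<in>I. rank1 y (f i) u) = rank1 y (\<Sum>i\<in>I. f i) u"
  by (auto simp: rank1_def scaleR_diff_right inner_diff_left scaleR_diff_left scaleR_add_right scaleR_sum_right)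

lemma d2_rank1: "ker_perp y \<Longrightarrow> d2 t (\<lambda>x. rank1 y (f x)) (\<lambda>x. rank1 y (g x)) =
    (\<integral>\<^sup>+x. ennreal ((norm y * norm (f x - g x))\<^sup>2) \<partial>nu t)"
  by (simp add: d2_def rank1_diff rank1_hs)

text \<open>A pi-lambda argument over the generators of the predictable sigma-algebra: they are
  stable under intersection, complements follow by subtraction from the whole space, and disjoint
  unions by continuity of the finite measure \<open>nu t\<close>.\<close>

lemma approximable_indicator:
  fixes h :: "'h::{real_inner, banach, second_countable_topology}"
  assumes t: "0 \<le> t" and P: "P \<in> sets (nu t)"
  shows "approximable t (\<lambda>x. rank1 (R v) ((indicator P x :: real) *\<^sub>R h))"
proof -
  let ?r = "\<lambda>P h x. rank1 (R v) ((indicator P x :: real) *\<^sub>R h)"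
  have cm: "P \<in> sets (nu t) \<Longrightarrow> cmeas t (?r P h)" for P and h :: 'h
    by (intro cmeas_rank1 ker_perp_R borel_measurable_scaleR borel_measurable_indicator borel_measurable_const)
  have interval: "approximable t (?r ({s<..r} \<times> A) h)"
    if "0 \<le> s" "s < r" "r \<le> t" "A \<in> sets (F s)" for s r A and h :: 'h
  proof -
    have "d2 t (el [(s, r, A, v, h)]) (?r ({s<..r} \<times> A) h) = d2 t (\<lambda>x u. 0) (\<lambda>x u. 0 :: 'h)"
      by (rule d2_cong) (simp add: el_Cons el_Nil)
    then have "d2 t (el [(s, r, A, v, h)]) (?r ({s<..r} \<times> A) h) = 0" by (simp add: d2_def)
    moreover have "elementary F t [(s, r, A, v, h)]" using that by (simp add: elementary_def)
    ultimately show ?thesis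
      using cm[OF nu_interval[OF that]] unfolding approximable_def
      by (intro conjI allI impI exI[of _ "[(s, r, A, v, h)]"]) simp_all
  qed
  have zero: "approximable t (?r ({0} \<times> A) h)" if A: "A \<in> sets (F 0)" for A and h :: 'h
  proof (rule approximable_null[OF t cm[OF nu_zero[OF t A]]])
    have "d2 t (\<lambda>x u. 0) (?r ({0} \<times> A) h) = (\<integral>\<^sup>+x. ennreal ((norm (R v) * norm h)\<^sup>2) * indicator ({0} \<times> A) x \<partial>nu t)"
      unfolding d2_def
      by (intro nn_integral_cong) (auto simp: rank1_hs ker_perp_R indicator_def)
    also have "\<dots> = 0" using nu_zero[OF t A] emeasure_nu_zero[OF t A] by (simp add: nn_integral_cmult_indicator)
    finally show "d2 t (\<lambda>x u. 0) (?r ({0} \<times> A) h) = 0" .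
  qed
  \<comment> \<open>The whole space is the slice at time 0 together with
    \<open>{0<..t} \<times> space M\<close>; for \<open>t = 0\<close> the second piece is no
    generator and the first is everything.\<close>
  have space: "approximable t (?r ({0..t} \<times> space M) h)" for h :: 'h
  proof (cases "t = 0")
    case True
    then show ?thesis using zero[of "space M"] space_F[of 0] sets.top[of "F 0"] by simp
  next
    case False
    have m: "space M \<in> sets (F 0)" using space_F[of 0] sets.top[of "F 0"] by simp
    have "approximable t (\<lambda>x u. ?r ({0} \<times> space M) h x u + ?r ({0<..t} \<times> space M) h x u)"
      using False t m by (intro approximable_add zero interval) auto
    moreover have "indicator ({0} \<times> space M) x + indicator ({0<..t} \<times> space M) x = (indicator ({0..t} \<times> space M) x :: real)"
      for x :: "real \<times> 'w"
      using t by (auto simp: indicator_def split: prod.splits)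
    ultimately show ?thesis by (simp add: rank1_add flip: scaleR_add_left)
  qed
  have sig: "P \<in> sigma_sets ({0..t} \<times> space M) (pred_generator t)"
    using P by (simp add: sets_nu sets_predictable t)
  \<comment> \<open>Two rectangles meet in one that starts at the later of the two left ends, when
    both base sets are known. The empty set is a generator, as a slice over the empty event.\<close>
  have "Int_stable (pred_generator t)"
  proof (rule Int_stableI)
    fix P P' assume PP: "P \<in> pred_generator t" "P' \<in> pred_generator t"
    have empty: "{} \<in> pred_generator t" by blast
    have intervals: "{s<..r} \<times> A \<inter> {s'<..r'} \<times> A' \<in> pred_generator t"
      if "0 \<le> s" "r \<le> t" "A \<in> sets (F s)" "0 \<le> s'" "r' \<le> t" "A' \<in> sets (F s')" for s r A s' r' A'
    proof (cases "max s s' < min r r'")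
      case True
      have "A \<inter> A' \<in> sets (F (max s s'))"
        using F_mono[of s "max s s'"] F_mono[of s' "max s s'"] that by (intro sets.Int) auto
      moreover have "{s<..r} \<times> A \<inter> {s'<..r'} \<times> A' = {max s s'<..min r r'} \<times> (A \<inter> A')" by auto
      moreover have "0 \<le> max s s'" "min r r' \<le> t" using that by auto
      ultimately show ?thesis using True by blast
    next
      case False
      then have "{s<..r} \<times> A \<inter> {s'<..r'} \<times> A' = {}" by auto
      then show ?thesis using empty by metis
    qed
    have zeros: "{0} \<times> A \<inter> {0} \<times> A' \<in> pred_generator t" if "A \<in> sets (F 0)" "A' \<in> sets (F 0)" for A A'
    proof -
      have "{0} \<times> A \<inter> {0} \<times> A' = {0::real} \<times> (A \<inter> A')" "A \<inter> A' \<in> sets (F 0)" using that by auto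
      then show ?thesis by blast
    qed
    have mixed: "{0} \<times> A \<inter> {s<..r} \<times> A' = {}" "{s<..r} \<times> A' \<inter> {0} \<times> A = {}"
      if "0 \<le> s" for s r :: real and A A' :: "'w set"
      using that by auto
    from PP show "P \<inter> P' \<in> pred_generator t"
    proof (elim UnE)
      assume "P \<in> {{s<..r} \<times> A | s r A. 0 \<le> s \<and> s < r \<and> r \<le> t \<and> A \<in> sets (F s)}"
        "P' \<in> {{s<..r} \<times> A | s r A. 0 \<le> s \<and> s < r \<and> r \<le> t \<and> A \<in> sets (F s)}"
      then show ?thesis using intervals by (elim CollectE exE conjE) (simp only:)
    next
      assume "P \<in> {{0} \<times> A | A. A \<in> sets (F 0)}" "P' \<in> {{0} \<times> A | A. A \<in> sets (F 0)}"
      then show ?thesis using zeros by (elim CollectE exE conjE) (simp only:)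
    next
      assume "P \<in> {{s<..r} \<times> A | s r A. 0 \<le> s \<and> s < r \<and> r \<le> t \<and> A \<in> sets (F s)}"
        "P' \<in> {{0} \<times> A | A. A \<in> sets (F 0)}"
      then have "P \<inter> P' = {}" using mixed by auto
      then show ?thesis using empty by metis
    next
      assume "P \<in> {{0} \<times> A | A. A \<in> sets (F 0)}"
        "P' \<in> {{s<..r} \<times> A | s r A. 0 \<le> s \<and> s < r \<and> r \<le> t \<and> A \<in> sets (F s)}"
      then have "P \<inter> P' = {}" using mixed by auto
      then show ?thesis using empty by metis
    qed
  qed
  \<comment> \<open>The vector \<open>h\<close> is quantified inside the induction because the
    complement is reached by adding the approximation for \<open>- h\<close>.\<close>
  from this pred_generator_Pow[OF t] sig have "\<forall>h::'h. approximable t (?r P h)"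
  proof (induction rule: sigma_sets_induct_disjoint)
    case (basic P)
    then show ?case using interval zero by auto
  next
    case empty
    have "rank1 (R v) ((indicator {} x :: real) *\<^sub>R h) = (\<lambda>u. 0)" for x :: "real \<times> 'w" and h :: 'h
      by (simp add: rank1_def fun_eq_iff)
    then show ?case using approximable_zero[OF t] by simp
  next
    case (compl P)
    have P: "P \<in> sets (nu t)" using compl(1) by (simp add: sets_nu sets_predictable t)
    show ?case
    proof
      fix h :: 'h
      have "approximable t (\<lambda>x u. ?r ({0..t} \<times> space M) h x u + ?r P (- h) x u)"
        by (intro approximable_add t space compl(2)[THEN spec])
      then show "approximable t (?r ({0..t} \<times> space M - P) h)"
      proof (rule approximable_cong)
        show "cmeas t (?r ({0..t} \<times> space M - P) h)"
          using P sets.compl_sets[OF P] by (intro cm) (simp add: space_nu[OF t])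
        fix x b assume "x \<in> space (nu t)"
        then show "?r ({0..t} \<times> space M) h x b + ?r P (- h) x b = ?r ({0..t} \<times> space M - P) h x b"
          by (simp add: rank1_add) (auto simp: indicator_def space_nu[OF t] rank1_def)
      qed
    qed
  next
    case (union P)
    have P: "P i \<in> sets (nu t)" for i using union(2) by (auto simp: sets_nu sets_predictable t)
    let ?P = "\<Union>(range P)" and ?Pn = "\<lambda>n. \<Union>i<n. P i"
    show ?case
    proof
      fix h :: 'h
      show "approximable t (?r ?P h)"
      proof (rule approximable_tendsto[OF t])
        show "cmeas t (?r ?P h)" using P by (intro cm) auto
        show "approximable t (\<lambda>x u. \<Sum>i<n. ?r (P i) h x u)" for n
          by (intro approximable_sum t finite_lessThan union(3)[THEN spec])
        have "d2 t (\<lambda>x u. \<Sum>i<n. ?r (P i) h x u) (?r ?P h) = ennreal ((norm (R v) * norm h)\<^sup>2) * emeasure (nu t) (?P - ?Pn n)" for n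
        proof -
          have "(\<Sum>i<n. indicator (P i) x) = (indicator (?Pn n) x :: real)" for x
            using union(1) by (subst indicator_UN_disjoint) (auto simp: disjoint_family_on_def)
          then have "d2 t (\<lambda>x u. \<Sum>i<n. ?r (P i) h x u) (?r ?P h) = d2 t (?r (?Pn n) h) (?r ?P h)"
            by (simp add: rank1_sum flip: scaleR_sum_left)
          also have "\<dots> = (\<integral>\<^sup>+x. ennreal ((norm (R v) * norm h)\<^sup>2) * indicator (?P - ?Pn n) x \<partial>nu t)"
            unfolding d2_rank1[OF ker_perp_R]
            by (intro nn_integral_cong) (auto simp: indicator_def)
          also have "\<dots> = ennreal ((norm (R v) * norm h)\<^sup>2) * emeasure (nu t) (?P - ?Pn n)"
            using P by (intro nn_integral_cmult_indicator) auto
          finally show ?thesis .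
        qed
        moreover have "(\<lambda>n. ennreal ((norm (R v) * norm h)\<^sup>2) * emeasure (nu t) (?P - ?Pn n))
            \<longlonglongrightarrow> ennreal ((norm (R v) * norm h)\<^sup>2) * 0"
        proof (rule ennreal_tendsto_cmult)
          interpret N: finite_measure "nu t" by (rule finite_measure_nu[OF t])
          have "(\<lambda>n. emeasure (nu t) (?P - ?Pn n)) \<longlonglongrightarrow> emeasure (nu t) (\<Inter>n. ?P - ?Pn n)"
            using P by (intro Lim_emeasure_decseq) (auto simp: decseq_def)
          also have "(\<Inter>n. ?P - ?Pn n) = {}" by auto
          finally show "(\<lambda>n. emeasure (nu t) (?P - ?Pn n)) \<longlonglongrightarrow> 0" by simp
        qed simp
        ultimately show "(\<lambda>n. d2 t (\<lambda>x u. \<Sum>i<n. ?r (P i) h x u) (?r ?P h)) \<longlonglongrightarrow> 0" by simp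
      qed
    qed
  qed
  then show ?thesis by blast
qed

lemma approximable_simple:
  fixes f :: "real \<times> 'w \<Rightarrow> 'h::{real_inner, banach, second_countable_topology}"
  assumes t: "0 \<le> t" and f: "simple_function (nu t) f"
  shows "approximable t (\<lambda>x. rank1 (R v) (f x))"
proof -
  let ?P = "\<lambda>y. f -` {y} \<inter> space (nu t)"
  have fin: "finite (f ` space (nu t))" using f by (rule simple_functionD)
  have "approximable t (\<lambda>x u. \<Sum>y\<in>f ` space (nu t). rank1 (R v) ((indicator (?P y) x :: real) *\<^sub>R y) u)"
    using f by (intro approximable_sum fin t approximable_indicator) (auto dest: simple_functionD)
  then show ?thesis
  proof (rule approximable_cong)
    show "cmeas t (\<lambda>x. rank1 (R v) (f x))"
      by (intro cmeas_rank1 ker_perp_R borel_measurable_simple_function f)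
    fix x b assume x: "x \<in> space (nu t)"
    have "(\<Sum>y\<in>f ` space (nu t). (indicator (?P y) x :: real) *\<^sub>R y) =
        (\<Sum>y\<in>f ` space (nu t). if y = f x then y else 0)"
      using x by (intro sum.cong) (auto simp: indicator_def)
    then show "(\<Sum>y\<in>f ` space (nu t). rank1 (R v) ((indicator (?P y) x :: real) *\<^sub>R y) b) = rank1 (R v) (f x) b"
      using x fin by (simp add: rank1_sum)
  qed
qed

lemma approximable_rank1_R:
  fixes f :: "real \<times> 'w \<Rightarrow> 'h::{real_inner, banach, second_countable_topology}"
  assumes t: "0 \<le> t" and f: "f \<in> borel_measurable (nu t)" and fin: "(\<integral>\<^sup>+x. ennreal ((norm (f x))\<^sup>2) \<partial>nu t) < \<infinity>"
  shows "approximable t (\<lambda>x. rank1 (R v) (f x))"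
proof -
  obtain g where g: "\<And>i. simple_function (nu t) (g i)" "\<And>x. x \<in> space (nu t) \<Longrightarrow> (\<lambda>i. g i x) \<longlonglongrightarrow> f x"
    and bd: "\<And>i x. x \<in> space (nu t) \<Longrightarrow> dist (g i x) 0 \<le> 2 * dist (f x) 0"
    using borel_measurable_implies_sequence_metric[OF f, of 0] by blast
  have gm: "g i \<in> borel_measurable (nu t)" for i by (rule borel_measurable_simple_function[OF g(1)])
  show ?thesis
  proof (rule approximable_tendsto[OF t cmeas_rank1[OF ker_perp_R f] approximable_simple[OF t g(1)]])
    \<comment> \<open>The simple approximants satisfy
      \<open>norm (g i x) \<le> 2 * norm (f x)\<close>, so the differences are bounded by
      \<open>3 * norm (f x)\<close>, which gives the dominating function.\<close>
    have "(\<lambda>i. \<integral>\<^sup>+x. ennreal ((norm (R v) * norm (g i x - f x))\<^sup>2) \<partial>nu t) \<longlonglongrightarrow> (\<integral>\<^sup>+x. 0 \<partial>nu t)"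
    proof (rule nn_integral_dominated_convergence[where w = "\<lambda>x. ennreal ((3 * norm (R v))\<^sup>2) * ennreal ((norm (f x))\<^sup>2)"])
      show "(\<integral>\<^sup>+x. ennreal ((3 * norm (R v))\<^sup>2) * ennreal ((norm (f x))\<^sup>2) \<partial>nu t) < \<infinity>"
        using f fin by (simp add: nn_integral_cmult ennreal_mult_less_top)
      show "AE x in nu t. ennreal ((norm (R v) * norm (g i x - f x))\<^sup>2) \<le> ennreal ((3 * norm (R v))\<^sup>2) * ennreal ((norm (f x))\<^sup>2)" for i
      proof (rule AE_I2)
        fix x assume "x \<in> space (nu t)"
        then have "norm (g i x - f x) \<le> 3 * norm (f x)"
          using bd[of x i] norm_triangle_ineq4[of "g i x" "f x"] by simp
        then have "(norm (R v) * norm (g i x - f x))\<^sup>2 \<le> (norm (R v) * (3 * norm (f x)))\<^sup>2"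
          by (intro power_mono mult_left_mono) auto
        then show "ennreal ((norm (R v) * norm (g i x - f x))\<^sup>2) \<le> ennreal ((3 * norm (R v))\<^sup>2) * ennreal ((norm (f x))\<^sup>2)"
          by (auto simp: power_mult_distrib mult_ac simp flip: ennreal_mult' intro!: ennreal_leI)
      qed
      show "AE x in nu t. (\<lambda>i. ennreal ((norm (R v) * norm (g i x - f x))\<^sup>2)) \<longlonglongrightarrow> 0"
      proof (rule AE_I2)
        fix x assume "x \<in> space (nu t)"
        then have "(\<lambda>i. g i x - f x) \<longlonglongrightarrow> 0" using g(2) LIM_zero by blast
        then have "(\<lambda>i. (norm (R v) * norm (g i x - f x))\<^sup>2) \<longlonglongrightarrow> (norm (R v) * norm (0::'h))\<^sup>2"
          by (intro tendsto_intros)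
        then have "(\<lambda>i. ennreal ((norm (R v) * norm (g i x - f x))\<^sup>2)) \<longlonglongrightarrow> ennreal 0"
          by (intro tendsto_ennrealI) simp
        then show "(\<lambda>i. ennreal ((norm (R v) * norm (g i x - f x))\<^sup>2)) \<longlonglongrightarrow> 0" by simp
      qed
    qed (use gm f in measurable)
    then show "(\<lambda>i. d2 t (\<lambda>x. rank1 (R v) (g i x)) (\<lambda>x. rank1 (R v) (f x))) \<longlonglongrightarrow> 0"
      by (simp add: d2_rank1 ker_perp_R)
  qed
qed

text \<open>Elementary operators only reach functionals of the form \<open>R v\<close>; a general
  \<open>y\<close> in \<open>ker_perp\<close> is a limit of these, and replacing it costs the
  squared norm of \<open>R v - y\<close> times the second moment of \<open>f\<close>.\<close>

lemma approximable_rank1: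
  fixes f :: "real \<times> 'w \<Rightarrow> 'h::{real_inner, banach, second_countable_topology}"
  assumes t: "0 \<le> t" and y: "ker_perp y"
    and f: "f \<in> borel_measurable (nu t)" and fin: "(\<integral>\<^sup>+x. ennreal ((norm (f x))\<^sup>2) \<partial>nu t) < \<infinity>"
  shows "approximable t (\<lambda>x. rank1 y (f x))"
proof (rule approximable_limit[OF t cmeas_rank1[OF y f]])
  fix \<epsilon> :: real assume \<epsilon>: "0 < \<epsilon>"
  define c where "c = enn2real (\<integral>\<^sup>+x. ennreal ((norm (f x))\<^sup>2) \<partial>nu t)"
  have c: "(\<integral>\<^sup>+x. ennreal ((norm (f x))\<^sup>2) \<partial>nu t) = ennreal c" "0 \<le> c"
    using fin by (auto simp: c_def less_top)
  \<comment> \<open>The divisor \<open>c + 1\<close> stays positive when \<open>f\<close> vanishes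
    almost everywhere.\<close>
  obtain v where v: "norm (R v - y) < sqrt (\<epsilon> / (c + 1))"
    using R_dense[OF y, of "sqrt (\<epsilon> / (c + 1))"] \<epsilon> c by auto
  then have v2: "(norm (R v - y))\<^sup>2 < \<epsilon> / (c + 1)"
    using power_strict_mono[OF v, of 2] \<epsilon> c by simp
  have "d2 t (\<lambda>x. rank1 (R v) (f x)) (\<lambda>x. rank1 y (f x)) =
      (\<integral>\<^sup>+x. ennreal ((norm (R v - y))\<^sup>2) * ennreal ((norm (f x))\<^sup>2) \<partial>nu t)"
    by (simp add: d2_def rank1_diff_left rank1_hs ker_perp_diff ker_perp_R y power_mult_distrib ennreal_mult)
  also have "\<dots> = ennreal ((norm (R v - y))\<^sup>2) * ennreal c"
    using f by (simp add: nn_integral_cmult c(1))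
  also have "\<dots> = ennreal ((norm (R v - y))\<^sup>2 * c)" using c by (simp add: ennreal_mult)
  also have "\<dots> < ennreal \<epsilon>"
  proof (rule ennreal_lessI[OF \<epsilon>])
    have "(norm (R v - y))\<^sup>2 * c \<le> \<epsilon> / (c + 1) * c" using v2 c by (intro mult_right_mono) auto
    also have "\<dots> < \<epsilon>" using \<epsilon> c by (simp add: divide_simps)
    finally show "(norm (R v - y))\<^sup>2 * c < \<epsilon>" .
  qed
  finally have "d2 t (\<lambda>x. rank1 (R v) (f x)) (\<lambda>x. rank1 y (f x)) < ennreal \<epsilon>" .
  then show "\<exists>G'. approximable t G' \<and> d2 t G' (\<lambda>x. rank1 y (f x)) < ennreal \<epsilon>"
    using approximable_rank1_R[OF t f fin, of v] by (intro exI[of _ "\<lambda>x. rank1 (R v) (f x)"] conjI)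
qed

text \<open>Projecting onto finitely many basis vectors leaves a finite sum of rank-one processes.
  The error is the tail of the Parseval series, at most the squared norm itself, so dominated
  convergence applies.\<close>

theorem elementary_dense:
  fixes G :: "real \<times> 'w \<Rightarrow> 'u \<Rightarrow> 'h::{real_inner, banach, second_countable_topology}"
  assumes t: "0 \<le> t" and G: "cmeas t G" and fin: "(\<integral>\<^sup>+x. ennreal ((hs (G x))\<^sup>2) \<partial>nu t) < \<infinity>"
  shows "approximable t G"
proof -
  define Bn where "Bn n = {b\<in>B. to_nat_on B b < n}" for n
  have Bn: "finite (Bn n)" "Bn n \<subseteq> B" for n
  proof -
    have "inj_on (to_nat_on B) (Bn n)"
      using inj_on_to_nat_on[OF countable_B] by (rule inj_on_subset) (auto simp: Bn_def)
    moreover have "to_nat_on B ` Bn n \<subseteq> {..<n}" by (auto simp: Bn_def)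
    ultimately show "finite (Bn n)" by (meson finite_imageD finite_lessThan finite_subset)
  qed (auto simp: Bn_def)
  \<comment> \<open>The Parseval series converges along all finite subsets; an exhausting sequence
    is extracted because dominated convergence works with sequences.\<close>
  have lim_Bn: "filterlim Bn (finite_subsets_at_top B) sequentially"
    unfolding filterlim_def le_filter_def eventually_filtermap
  proof (intro allI impI)
    fix P assume "eventually P (finite_subsets_at_top B)"
    then obtain C where C: "finite C" "C \<subseteq> B" "\<And>D. finite D \<Longrightarrow> C \<subseteq> D \<Longrightarrow> D \<subseteq> B \<Longrightarrow> P D"
      by (auto simp: eventually_finite_subsets_at_top)
    obtain m where m: "\<forall>k\<in>to_nat_on B ` C. k < m"
      using finite_nat_set_iff_bounded[of "to_nat_on B ` C"] C(1) by auto
    have "P (Bn n)" if "m \<le> n" for n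
      using C(2) m that by (intro C(3) Bn) (force simp: Bn_def)
    then show "\<forall>\<^sub>F n in sequentially. P (Bn n)" by (auto simp: eventually_sequentially)
  qed
  let ?G = "\<lambda>n x u. \<Sum>b\<in>Bn n. rank1 (J b) (G x b) u"
  have coord: "(\<lambda>x. G x b) \<in> borel_measurable (nu t)" if "b \<in> B" for b
    using G that by (simp add: cmeas_def)
  show ?thesis
  proof (rule approximable_tendsto[OF t G])
    fix n show "approximable t (?G n)"
    proof (intro approximable_sum Bn t approximable_rank1)
      fix b assume "b \<in> Bn n"
      then have b: "b \<in> B" using Bn by auto
      show "ker_perp (J b)" by (rule ker_perp_J[OF B_U0[OF b]])
      show "(\<lambda>x. G x b) \<in> borel_measurable (nu t)" by (rule coord[OF b])
      have "(\<integral>\<^sup>+x. ennreal ((norm (G x b))\<^sup>2) \<partial>nu t) \<le> (\<integral>\<^sup>+x. ennreal ((hs (G x))\<^sup>2) \<partial>nu t)"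
      proof (intro nn_integral_mono ennreal_leI power_mono)
        fix x assume "x \<in> space (nu t)"
        then show "norm (G x b) \<le> hs (G x)"
          using hs_finite_le[OF cmeas_ell2[OF G], of x "{b}"] b by (simp add: L2_set_def)
      qed simp
      then show "(\<integral>\<^sup>+x. ennreal ((norm (G x b))\<^sup>2) \<partial>nu t) < \<infinity>" using fin by (rule le_less_trans)
    qed
  next
    have d2_eq: "d2 t (?G n) G = (\<integral>\<^sup>+x. ennreal ((hs (G x))\<^sup>2 - (\<Sum>b\<in>Bn n. (norm (G x b))\<^sup>2)) \<partial>nu t)" for n
      unfolding d2_def by (intro nn_integral_cong) (simp add: hs_truncation[OF cmeas_ell2[OF G] Bn])
    have hm: "(\<lambda>x. (hs (G x))\<^sup>2) \<in> borel_measurable (nu t)"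
      using borel_measurable_enn2real[OF hs_square_measurable[OF G]] by simp
    have "(\<lambda>n. \<integral>\<^sup>+x. ennreal ((hs (G x))\<^sup>2 - (\<Sum>b\<in>Bn n. (norm (G x b))\<^sup>2)) \<partial>nu t) \<longlonglongrightarrow> (\<integral>\<^sup>+x. 0 \<partial>nu t)"
    proof (rule nn_integral_dominated_convergence[OF _ _ _ _ fin])
      show "(\<lambda>x. ennreal ((hs (G x))\<^sup>2 - (\<Sum>b\<in>Bn n. (norm (G x b))\<^sup>2))) \<in> borel_measurable (nu t)" for n
        using coord Bn(2)[of n]
        by (intro measurable_compose[OF _ measurable_ennreal] borel_measurable_diff hm borel_measurable_sum
            borel_measurable_power measurable_compose[OF _ borel_measurable_norm]) auto
      show "AE x in nu t. ennreal ((hs (G x))\<^sup>2 - (\<Sum>b\<in>Bn n. (norm (G x b))\<^sup>2)) \<le> ennreal ((hs (G x))\<^sup>2)" for n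
        by (intro AE_I2 ennreal_leI) (simp add: sum_nonneg)
      show "AE x in nu t. (\<lambda>n. ennreal ((hs (G x))\<^sup>2 - (\<Sum>b\<in>Bn n. (norm (G x b))\<^sup>2))) \<longlonglongrightarrow> 0"
      proof (rule AE_I2)
        fix x assume x: "x \<in> space (nu t)"
        have "(\<lambda>n. \<Sum>b\<in>Bn n. (norm (G x b))\<^sup>2) \<longlonglongrightarrow> (hs (G x))\<^sup>2"
          using hs_has_sum[OF cmeas_ell2[OF G x]] filterlim_compose[OF _ lim_Bn]
          unfolding has_sum_def by blast
        then have "(\<lambda>n. (hs (G x))\<^sup>2 - (\<Sum>b\<in>Bn n. (norm (G x b))\<^sup>2)) \<longlonglongrightarrow> (hs (G x))\<^sup>2 - (hs (G x))\<^sup>2"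
          by (intro tendsto_intros)
        then have "(\<lambda>n. ennreal ((hs (G x))\<^sup>2 - (\<Sum>b\<in>Bn n. (norm (G x b))\<^sup>2))) \<longlonglongrightarrow> ennreal 0"
          by (intro tendsto_ennrealI) simp
        then show "(\<lambda>n. ennreal ((hs (G x))\<^sup>2 - (\<Sum>b\<in>Bn n. (norm (G x b))\<^sup>2))) \<longlonglongrightarrow> 0" by simp
      qed
    qed (use hs_square_measurable[OF G] in auto)
    then show "(\<lambda>n. d2 t (?G n) G) \<longlonglongrightarrow> 0" by (simp add: d2_eq)
  qed
qed

end

section \<open>Completeness of the space of square-integrable random variables\<close>

lemma ennreal_power2_le_imp_le: "(x::ennreal)\<^sup>2 \<le> y\<^sup>2 \<Longrightarrow> x \<le> y"
proof (rule ccontr)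
  assume *: "x\<^sup>2 \<le> y\<^sup>2" "\<not> x \<le> y"
  then have "y < x" by simp
  then have y: "y < \<top>" using less_top_ennreal order.strict_trans2 by (metis top_greatest)
  show False
  proof (cases x)
    case (real r)
    then obtain s where "y = ennreal s" "0 \<le> s" using y by (cases y) auto
    then show False using * real power_strict_mono[of s r 2] by (auto simp: ennreal_power)
  next
    case top
    obtain s where s: "y = ennreal s" "0 \<le> s" using y by (cases y) auto
    have "x\<^sup>2 = \<top>" using top by (simp add: power2_eq_square ennreal_top_mult)
    then show False using *(1) s by (simp add: ennreal_power top_unique)
  qed
qed

lemma (in prob_space) nn_integral_square_le:
  assumes [measurable]: "f \<in> borel_measurable M"
  shows "(\<integral>\<^sup>+x. f x \<partial>M)\<^sup>2 \<le> (\<integral>\<^sup>+x. (f x)\<^sup>2 \<partial>M)"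
  using Cauchy_Schwarz_nn_integral[of f M "\<lambda>_. 1"] by (simp add: emeasure_space_1)

lemma (in prob_space) nn_integral_le_of_square:
  assumes "f \<in> borel_measurable M" "(\<integral>\<^sup>+x. (f x)\<^sup>2 \<partial>M) \<le> c\<^sup>2"
  shows "(\<integral>\<^sup>+x. f x \<partial>M) \<le> c"
  using nn_integral_square_le[OF assms(1)] assms(2) ennreal_power2_le_imp_le order_trans by blast

text \<open>The geometric rate makes the sum of the norms of successive differences integrable, so
  the sequence converges almost surely; Fatou's lemma returns the rate for the limit.\<close>

lemma (in prob_space) L2_complete:
  fixes X :: "nat \<Rightarrow> 'a \<Rightarrow> 'h::{banach, second_countable_topology}"
  assumes X [measurable]: "\<And>n. X n \<in> borel_measurable M"
    and cauchy: "\<And>n m. n \<le> m \<Longrightarrow> (\<integral>\<^sup>+\<omega>. ennreal ((norm (X n \<omega> - X m \<omega>))\<^sup>2) \<partial>M) \<le> (ennreal (c * (1/2)^n))\<^sup>2"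
    and c: "0 \<le> c"
  obtains Y where "Y \<in> borel_measurable M"
    "\<And>n. (\<integral>\<^sup>+\<omega>. ennreal ((norm (X n \<omega> - Y \<omega>))\<^sup>2) \<partial>M) \<le> (ennreal (c * (1/2)^n))\<^sup>2"
proof
  \<comment> \<open>Where the sequence diverges this is an unspecified value, which affects only a
    null set.\<close>
  define Y where "Y \<omega> = lim (\<lambda>n. X n \<omega>)" for \<omega>
  show Y [measurable]: "Y \<in> borel_measurable M"
    unfolding Y_def[abs_def] by (rule borel_measurable_lim_metric) (rule X)
  have "(\<integral>\<^sup>+\<omega>. (\<Sum>n. ennreal (norm (X (Suc n) \<omega> - X n \<omega>))) \<partial>M) = (\<Sum>n. \<integral>\<^sup>+\<omega>. ennreal (norm (X (Suc n) \<omega> - X n \<omega>)) \<partial>M)"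
    by (rule nn_integral_suminf) measurable
  also have "\<dots> \<le> (\<Sum>n. ennreal (c * (1/2)^n))"
  proof (rule suminf_le)
    fix n
    show "(\<integral>\<^sup>+\<omega>. ennreal (norm (X (Suc n) \<omega> - X n \<omega>)) \<partial>M) \<le> ennreal (c * (1/2)^n)"
    proof (rule nn_integral_le_of_square)
      show "(\<integral>\<^sup>+\<omega>. (ennreal (norm (X (Suc n) \<omega> - X n \<omega>)))\<^sup>2 \<partial>M) \<le> (ennreal (c * (1/2)^n))\<^sup>2"
        using cauchy[of n "Suc n"]
        unfolding ennreal_power[OF norm_ge_zero] norm_minus_commute[of "X n _"] by simp
    qed measurable
  qed auto
  also have "\<dots> = ennreal (\<Sum>n. c * (1/2)^n)"
    using c by (intro suminf_ennreal2) (auto intro!: summable_mult summable_geometric)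
  also have "\<dots> < \<infinity>" by simp
  finally have "AE \<omega> in M. (\<Sum>n. ennreal (norm (X (Suc n) \<omega> - X n \<omega>))) \<noteq> \<infinity>"
    by (intro nn_integral_PInf_AE) auto
  then have lim: "AE \<omega> in M. (\<lambda>n. X n \<omega>) \<longlonglongrightarrow> Y \<omega>"
  proof eventually_elim
    fix \<omega> assume "(\<Sum>n. ennreal (norm (X (Suc n) \<omega> - X n \<omega>))) \<noteq> \<infinity>"
    then have "summable (\<lambda>n. norm (X (Suc n) \<omega> - X n \<omega>))"
      by (intro summable_suminf_not_top) auto
    then have "summable (\<lambda>n. X (Suc n) \<omega> - X n \<omega>)" by (rule summable_norm_cancel)
    then have "convergent (\<lambda>n. \<Sum>i<n. X (Suc i) \<omega> - X i \<omega>)"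
      by (simp add: summable_iff_convergent)
    then have "convergent (\<lambda>n. X n \<omega> - X 0 \<omega>)" by (simp only: sum_lessThan_telescope[of "\<lambda>n. X n \<omega>"])
    then have "convergent (\<lambda>n. X n \<omega> - X 0 \<omega> + X 0 \<omega>)" by (intro convergent_add convergent_const)
    then show "(\<lambda>n. X n \<omega>) \<longlonglongrightarrow> Y \<omega>" by (simp add: Y_def convergent_LIMSEQ_iff)
  qed
  show "(\<integral>\<^sup>+\<omega>. ennreal ((norm (X n \<omega> - Y \<omega>))\<^sup>2) \<partial>M) \<le> (ennreal (c * (1/2)^n))\<^sup>2" for n
  proof -
    have "(\<integral>\<^sup>+\<omega>. ennreal ((norm (X n \<omega> - Y \<omega>))\<^sup>2) \<partial>M) =
        (\<integral>\<^sup>+\<omega>. liminf (\<lambda>m. ennreal ((norm (X n \<omega> - X m \<omega>))\<^sup>2)) \<partial>M)"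
      using lim
    proof (intro nn_integral_cong_AE, eventually_elim)
      fix \<omega> assume "(\<lambda>n. X n \<omega>) \<longlonglongrightarrow> Y \<omega>"
      then have "(\<lambda>m. ennreal ((norm (X n \<omega> - X m \<omega>))\<^sup>2)) \<longlonglongrightarrow> ennreal ((norm (X n \<omega> - Y \<omega>))\<^sup>2)"
        by (intro tendsto_ennrealI tendsto_intros)
      then show "ennreal ((norm (X n \<omega> - Y \<omega>))\<^sup>2) = liminf (\<lambda>m. ennreal ((norm (X n \<omega> - X m \<omega>))\<^sup>2))"
        by (rule lim_imp_Liminf[OF trivial_limit_sequentially, symmetric])
    qed
    also have "\<dots> \<le> liminf (\<lambda>m. \<integral>\<^sup>+\<omega>. ennreal ((norm (X n \<omega> - X m \<omega>))\<^sup>2) \<partial>M)"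
      by (rule nn_integral_liminf) measurable
    also have "\<dots> \<le> (ennreal (c * (1/2)^n))\<^sup>2"
      by (rule Liminf_le) (auto simp: eventually_sequentially intro!: exI[of _ n] cauchy)
    finally show ?thesis .
  qed
qed

section \<open>Existence of the stochastic integral\<close>

context cylindrical_wiener
begin

lemma mtopology_openin_iff:
  "openin (Metric_space.mtopology (L20 Q) (\<lambda>L L'. hs (\<lambda>u. L u - L' u :: 'h::real_inner))) V \<longleftrightarrow>
    V \<subseteq> L20 Q \<and> (\<forall>L\<in>V. \<exists>r>0. \<forall>L'\<in>L20 Q. hs (\<lambda>u. L u - L' u) < r \<longrightarrow> L' \<in> V)"
proof -
  interpret MS: Metric_space "L20 Q" "\<lambda>L L'. hs (\<lambda>u. L u - L' u :: 'h)" by (rule L20_metric)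
  have ball: "MS.mball L r \<subseteq> V \<longleftrightarrow> (\<forall>L'\<in>L20 Q. hs (\<lambda>u. L u - L' u) < r \<longrightarrow> L' \<in> V)" if "L \<in> L20 Q" for L r
    using that by (auto simp only: subset_iff MS.in_mball Ball_def)
  show ?thesis
    unfolding MS.openin_mtopology
  proof (intro conj_cong refl)
    assume V: "V \<subseteq> L20 Q"
    have "(\<exists>r>0. MS.mball L r \<subseteq> V) \<longleftrightarrow> (\<exists>r>0. \<forall>L'\<in>L20 Q. hs (\<lambda>u. L u - L' u) < r \<longrightarrow> L' \<in> V)"
      if "L \<in> V" for L
      by (simp only: ball[OF subsetD[OF V that]])
    then show "(\<forall>L. L \<in> V \<longrightarrow> (\<exists>r>0. MS.mball L r \<subseteq> V)) \<longleftrightarrow>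
      (\<forall>L\<in>V. \<exists>r>0. \<forall>L'\<in>L20 Q. hs (\<lambda>u. L u - L' u) < r \<longrightarrow> L' \<in> V)"
      unfolding Ball_def[of V] by (simp only: cong: imp_cong)
  qed
qed

lemma space_L20_borel: "space (L20_borel Q :: ('u \<Rightarrow> 'h::real_inner) measure) = L20 Q"
  and sets_L20_borel: "sets (L20_borel Q :: ('u \<Rightarrow> 'h::real_inner) measure) = sigma_sets (L20 Q)
     {V. openin (Metric_space.mtopology (L20 Q) (\<lambda>L L'. hs (\<lambda>u. L u - L' u))) V}"
proof -
  have "{V. openin (Metric_space.mtopology (L20 Q) (\<lambda>L L'. hs (\<lambda>u. L u - L' u :: 'h))) V} \<subseteq> Pow (L20 Q)"
    by (auto simp: mtopology_openin_iff)
  then show "space (L20_borel Q :: ('u \<Rightarrow> 'h) measure) = L20 Q"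
    and "sets (L20_borel Q :: ('u \<Rightarrow> 'h) measure) = sigma_sets (L20 Q)
     {V. openin (Metric_space.mtopology (L20 Q) (\<lambda>L L'. hs (\<lambda>u. L u - L' u))) V}"
    unfolding L20_borel_def by auto
qed

text \<open>Evaluation at a basis vector is a contraction from \<open>L20 Q\<close> with its metric,
  hence preimages of open sets are open.\<close>

lemma evaluation_measurable:
  assumes b: "b \<in> B"
  shows "(\<lambda>L. L b :: 'h::{real_inner, second_countable_topology}) \<in> borel_measurable (L20_borel Q)"
proof (rule borel_measurableI)
  fix V :: "'h set" assume V: "open V"
  have "openin (Metric_space.mtopology (L20 Q) (\<lambda>L L'. hs (\<lambda>u. L u - L' u))) {L\<in>L20 Q. L b \<in> V}"
    unfolding mtopology_openin_iff
  proof (intro conjI ballI)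
    fix L assume L: "L \<in> {L\<in>L20 Q. L b \<in> V}"
    then obtain r where r: "0 < r" "ball (L b) r \<subseteq> V" using V openE by blast
    have "L' b \<in> V" if L': "L' \<in> L20 Q" "hs (\<lambda>u. L u - L' u) < r" for L'
    proof -
      have "norm (L b - L' b) \<le> hs (\<lambda>u. L u - L' u)"
        using hs_finite_le[of "\<lambda>u. L u - L' u" "{b}"] L L' b
        by (simp add: L2_set_def L20_ell2 L20_diff)
      then show ?thesis using r L' by (auto simp: dist_norm)
    qed
    then show "\<exists>r>0. \<forall>L'\<in>L20 Q. hs (\<lambda>u. L u - L' u) < r \<longrightarrow> L' \<in> {L\<in>L20 Q. L b \<in> V}"
      using r(1) by auto
  qed auto
  moreover have "(\<lambda>L. L b) -` V \<inter> space (L20_borel Q) = {L\<in>L20 Q. L b \<in> V}"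
    by (auto simp: space_L20_borel)
  ultimately show "(\<lambda>L. L b) -` V \<inter> space (L20_borel Q) \<in> sets (L20_borel Q)"
    by (simp add: sets_L20_borel sigma_sets.Basic)
qed

definition energy_of :: "real \<Rightarrow> (real \<Rightarrow> 'w \<Rightarrow> 'u \<Rightarrow> 'h::real_inner) \<Rightarrow> 'w \<Rightarrow> ennreal" where
  "energy_of t \<Phi> \<omega> = (\<integral>\<^sup>+\<tau>\<in>{0..t}. ennreal ((hs (\<Phi> \<tau> \<omega>))\<^sup>2) \<partial>lborel)"

lemma N2_cmeas:
  fixes \<Phi> :: "real \<Rightarrow> 'w \<Rightarrow> 'u \<Rightarrow> 'h::{real_inner, banach, second_countable_topology}"
  assumes t: "0 \<le> t" and \<Phi>: "\<Phi> \<in> N2 M F Q t"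
  shows "cmeas t (\<lambda>x. \<Phi> (fst x) (snd x))"
proof -
  have m: "(\<lambda>x. \<Phi> (fst x) (snd x)) \<in> measurable (nu t) (L20_borel Q)"
    using \<Phi> by (simp add: N2_def split_def measurable_cong_sets[OF sets_nu[OF t] refl])
  show ?thesis
    unfolding cmeas_def
    using measurable_space[OF m] measurable_compose[OF m evaluation_measurable]
    by (auto simp: space_L20_borel)
qed

lemma energy_of_measurable:
  assumes "0 \<le> t" "cmeas t (\<lambda>x. \<Phi> (fst x) (snd x))"
  shows "energy_of t \<Phi> \<in> borel_measurable M"
  using nu_integral_measurable[OF assms(1) hs_square_measurable[OF assms(2)]]
  by (simp add: energy_of_def[abs_def])

lemma energy_of_integral:
  assumes "0 \<le> t" "cmeas t (\<lambda>x. \<Phi> (fst x) (snd x))"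
  shows "(\<integral>\<^sup>+\<omega>. energy_of t \<Phi> \<omega> \<partial>M) = (\<integral>\<^sup>+x. ennreal ((hs (\<Phi> (fst x) (snd x)))\<^sup>2) \<partial>nu t)"
  using nn_integral_nu[OF assms(1) hs_square_measurable[OF assms(2)]]
  by (simp add: energy_of_def)

lemma N2_energy_finite:
  fixes \<Phi> :: "real \<Rightarrow> 'w \<Rightarrow> 'u \<Rightarrow> 'h::{real_inner, banach, second_countable_topology}"
  shows "\<Phi> \<in> N2 M F Q t \<Longrightarrow> (\<integral>\<^sup>+\<omega>. energy_of t \<Phi> \<omega> \<partial>M) < \<infinity>"
  by (simp add: N2_def energy_of_def)

lemma d2_energy:
  assumes "0 \<le> t" "elementary F t E" "cmeas t (\<lambda>x. \<Phi> (fst x) (snd x))"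
  shows "d2 t (el E) (\<lambda>x. \<Phi> (fst x) (snd x)) =
    (\<integral>\<^sup>+\<omega>. energy_of t (\<lambda>\<tau> \<omega> u. elem_process Q E \<tau> \<omega> u - \<Phi> \<tau> \<omega> u) \<omega> \<partial>M)"
  using energy_of_integral[OF assms(1), of "\<lambda>\<tau> \<omega> u. elem_process Q E \<tau> \<omega> u - \<Phi> \<tau> \<omega> u"]
    cmeas_diff[OF cmeas_el[OF assms(1,2)] assms(3)]
  by (simp add: d2_def)

section \<open>Existence of the integral as a limit of elementary integrals\<close>

definition neg :: "('w, 'u, 'h::{real_inner, banach, second_countable_topology}) elementary \<Rightarrow> ('w, 'u, 'h) elementary" where
  "neg E = map (\<lambda>(s, r, A, v, h). (s, r, A, v, - h)) E"

lemma elementary_neg: "elementary F t (neg E) = elementary F t E"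
  by (induction E) (auto simp: elementary_def neg_def)

lemma el_neg: "el (neg E) x u = - el E x u"
  unfolding elem_process_def neg_def by (induction E) auto

lemma elem_integral_neg: "elem_integral W (neg E) \<omega> = - elem_integral W E \<omega>"
  unfolding elem_integral_def neg_def by (induction E) auto

lemma elem_integral_append: "elem_integral W (E @ E') \<omega> = elem_integral W E \<omega> + elem_integral W E' \<omega>"
  by (simp add: elem_integral_def)

text \<open>The difference of two elementary processes is again one, coded by
  \<open>E @ neg E'\<close>, so the isometry for single processes controls distances.\<close>

lemma elem_integral_dist:
  fixes E :: "('w, 'u, 'h::{real_inner, banach, second_countable_topology}) elementary"
  assumes t: "0 \<le> t" and E: "elementary F t E" "elementary F t E'"
  shows "(\<integral>\<^sup>+\<omega>. ennreal ((norm (elem_integral W E \<omega> - elem_integral W E' \<omega>))\<^sup>2) \<partial>M) = d2 t (el E) (el E')"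
proof -
  have el: "elementary F t (E @ neg E')" using E by (simp add: elementary_append elementary_neg)
  have eq: "el (E @ neg E') x = (\<lambda>u. el E x u - el E' x u)" for x
    by (simp add: fun_eq_iff el_append el_neg)
  have "(\<integral>\<^sup>+\<omega>. ennreal ((norm (elem_integral W (E @ neg E') \<omega>))\<^sup>2) \<partial>M) =
      (\<integral>\<^sup>+\<omega>. energy_of t (elem_process Q (E @ neg E')) \<omega> \<partial>M)"
    unfolding energy_of_def by (rule elem_isometry[OF el])
  also have "\<dots> = (\<integral>\<^sup>+x. ennreal ((hs (el (E @ neg E') x))\<^sup>2) \<partial>nu t)"
    by (rule energy_of_integral[OF t cmeas_el[OF t el]])
  finally show ?thesis by (simp add: eq d2_def elem_integral_append elem_integral_neg)
qed

text \<open>Without this the choice in \<open>stoch_integral\<close> would be arbitrary.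
  Approximants at squared distance below \<open>(1/4)^n\<close> have integrals that are Cauchy at a
  geometric rate.\<close>

lemma stoch_integral_exists:
  fixes \<Phi> :: "real \<Rightarrow> 'w \<Rightarrow> 'u \<Rightarrow> 'h::{real_inner, banach, second_countable_topology}"
  assumes t: "0 \<le> t" and \<Phi>: "\<Phi> \<in> N2 M F Q t"
  shows "\<exists>X. has_stoch_integral M F Q W t \<Phi> X"
proof -
  let ?G = "\<lambda>x. \<Phi> (fst x) (snd x)"
  have cm: "cmeas t ?G" by (rule N2_cmeas[OF t \<Phi>])
  have "approximable t ?G"
    using N2_energy_finite[OF \<Phi>] by (intro elementary_dense t cm) (simp add: energy_of_integral[OF t cm])
  then have "\<forall>n. \<exists>E. elementary F t E \<and> d2 t (el E) ?G < ennreal ((1/4)^n)"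
    unfolding approximable_def by (metis zero_less_divide_1_iff zero_less_numeral zero_less_power)
  then obtain E where E: "\<And>n. elementary F t (E n)" "\<And>n. d2 t (el (E n)) ?G < ennreal ((1/4)^n)"
    by metis
  \<comment> \<open>For \<open>n \<le> m\<close> the squared distance of two integrals is at most
    \<open>4 * (1/4)^n\<close>, the square of the rate \<open>2 * (1/2)^n\<close> expected by
    \<open>L2_complete\<close>.\<close>
  have quarter: "(2 * (1/2::real)^n)\<^sup>2 = 4 * (1/4)^n" for n
  proof -
    have "(1/2::real)^n * (1/2)^n = (1/4)^n" by (simp flip: power_mult_distrib)
    then show ?thesis by (simp add: power2_eq_square)
  qed
  have d2_sym: "d2 t ?G (el (E m)) = d2 t (el (E m)) ?G" for m
    by (rule d2_cong) (rule norm_minus_commute)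
  have X: "elem_integral W (E n) \<in> borel_measurable M" for n
    by (rule elem_integral_measurable[OF E(1)])
  obtain Y where Y: "Y \<in> borel_measurable M"
    and YE: "\<And>n. (\<integral>\<^sup>+\<omega>. ennreal ((norm (elem_integral W (E n) \<omega> - Y \<omega>))\<^sup>2) \<partial>M) \<le> (ennreal (2 * (1/2)^n))\<^sup>2"
  proof (rule L2_complete[of "\<lambda>n. elem_integral W (E n)" 2])
    fix n m :: nat assume "n \<le> m"
    have "(\<integral>\<^sup>+\<omega>. ennreal ((norm (elem_integral W (E n) \<omega> - elem_integral W (E m) \<omega>))\<^sup>2) \<partial>M) = d2 t (el (E n)) (el (E m))"
      by (rule elem_integral_dist[OF t E(1) E(1)])
    also have "\<dots> \<le> 2 * d2 t (el (E n)) ?G + 2 * d2 t ?G (el (E m))"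
      by (intro d2_triangle cmeas_el t E cm)
    also have "\<dots> \<le> 2 * ennreal ((1/4)^n) + 2 * ennreal ((1/4)^m)"
      unfolding d2_sym by (intro add_mono mult_left_mono less_imp_le[OF E(2)]) auto
    also have "\<dots> = ennreal (2 * (1/4)^n + 2 * (1/4)^m)"
      by (simp add: ennreal_plus ennreal_mult)
    also have "\<dots> \<le> ennreal ((2 * (1/2)^n)\<^sup>2)"
    proof (rule ennreal_leI)
      have "(1/4::real)^m \<le> (1/4)^n" using \<open>n \<le> m\<close> by (intro power_decreasing) auto
      then show "2 * (1/4)^n + 2 * (1/4)^m \<le> (2 * (1/2::real)^n)\<^sup>2"
        unfolding quarter by simp
    qed
    also have "\<dots> = (ennreal (2 * (1/2)^n))\<^sup>2" by (simp add: ennreal_power)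
    finally show "(\<integral>\<^sup>+\<omega>. ennreal ((norm (elem_integral W (E n) \<omega> - elem_integral W (E m) \<omega>))\<^sup>2) \<partial>M) \<le> \<dots>" .
  qed (use X in auto)
  have pow0: "(\<lambda>n. ennreal (c * a^n)) \<longlonglongrightarrow> 0" if "0 \<le> a" "a < 1" for a c :: real
  proof -
    have "(\<lambda>n. c * a^n) \<longlonglongrightarrow> c * 0" using that by (intro tendsto_intros LIMSEQ_realpow_zero)
    then show ?thesis using tendsto_ennrealI[of "\<lambda>n. c * a^n" 0] by simp
  qed
  have "(\<lambda>n. \<integral>\<^sup>+\<omega>. ennreal ((norm (elem_integral W (E n) \<omega> - Y \<omega>))\<^sup>2) \<partial>M) \<longlonglongrightarrow> 0"
  proof (rule tendsto_sandwich[OF _ _ tendsto_const])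
    show "(\<lambda>n. ennreal (4 * (1/4)^n)) \<longlonglongrightarrow> 0" by (rule pow0) auto
    have "(\<integral>\<^sup>+\<omega>. ennreal ((norm (elem_integral W (E n) \<omega> - Y \<omega>))\<^sup>2) \<partial>M) \<le> ennreal (4 * (1/4)^n)" for n
      using YE[of n] ennreal_power[of "2 * (1/2)^n" 2] unfolding quarter by simp
    then show "\<forall>\<^sub>F n in sequentially. (\<integral>\<^sup>+\<omega>. ennreal ((norm (elem_integral W (E n) \<omega> - Y \<omega>))\<^sup>2) \<partial>M) \<le> ennreal (4 * (1/4)^n)"
      by simp
  qed auto
  moreover have "(\<lambda>n. d2 t (el (E n)) ?G) \<longlonglongrightarrow> 0"
  proof (rule tendsto_sandwich[OF _ _ tendsto_const])
    show "(\<lambda>n. ennreal (1 * (1/4)^n)) \<longlonglongrightarrow> 0" by (rule pow0) auto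
  qed (use E(2) in \<open>simp_all add: less_imp_le\<close>)
  moreover have "(\<integral>\<^sup>+\<omega>. ennreal ((norm (Y \<omega>))\<^sup>2) \<partial>M) < \<infinity>"
  proof -
    have "(\<integral>\<^sup>+\<omega>. ennreal ((norm (Y \<omega>))\<^sup>2) \<partial>M) \<le>
        2 * (\<integral>\<^sup>+\<omega>. ennreal ((norm (elem_integral W (E 0) \<omega>))\<^sup>2) \<partial>M) +
        2 * (\<integral>\<^sup>+\<omega>. ennreal ((norm (elem_integral W (E 0) \<omega> - Y \<omega>))\<^sup>2) \<partial>M)"
    proof (rule nn_integral_le_double_sum)
      fix \<omega>
      have "norm (Y \<omega>) \<le> norm (elem_integral W (E 0) \<omega>) + norm (elem_integral W (E 0) \<omega> - Y \<omega>)"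
        using norm_triangle_ineq4[of "elem_integral W (E 0) \<omega>" "elem_integral W (E 0) \<omega> - Y \<omega>"] by simp
      then have "(norm (Y \<omega>))\<^sup>2 \<le> (norm (elem_integral W (E 0) \<omega>) + norm (elem_integral W (E 0) \<omega> - Y \<omega>))\<^sup>2"
        by (intro power_mono) auto
      also have "\<dots> \<le> 2 * (norm (elem_integral W (E 0) \<omega>))\<^sup>2 + 2 * (norm (elem_integral W (E 0) \<omega> - Y \<omega>))\<^sup>2"
        using sum_squares_bound[of "norm (elem_integral W (E 0) \<omega>)" "norm (elem_integral W (E 0) \<omega> - Y \<omega>)"]
        by (simp add: power2_sum)
      finally show "(norm (Y \<omega>))\<^sup>2 \<le> \<dots>" .
    qed (use X Y in auto)
    also have "\<dots> < \<infinity>"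
      using elem_isometry_finite[OF E(1)[of 0]] order.strict_trans1[OF YE[of 0], of \<infinity>]
      by (simp add: ennreal_mult_less_top ennreal_power)
    finally show ?thesis .
  qed
  ultimately show ?thesis
    unfolding has_stoch_integral_def using E(1) \<Phi> Y d2_energy[OF t E(1) cm]
    by (intro exI[of _ Y] conjI exI[of _ E]) (auto simp: energy_of_def)
qed

section \<open>The first-moment estimate\<close>

text \<open>Since \<open>enn2real\<close> sends infinity to 0, finiteness of \<open>y\<close> and
  \<open>z\<close> is essential. The factor 2 in place of the square root of 2 is a convenience; it
  doubles 3 to 6 below.\<close>

lemma sqrt_enn2real_le:
  assumes "x \<le> 2 * y + 2 * z" "y < \<infinity>" "z < \<infinity>"
  shows "sqrt (enn2real x) \<le> 2 * sqrt (enn2real y) + 2 * sqrt (enn2real z)"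
proof -
  obtain y' z' where yz: "y = ennreal y'" "z = ennreal z'" "0 \<le> y'" "0 \<le> z'"
    using assms(2,3) by (cases y; cases z) auto
  have "x \<le> ennreal (2 * y' + 2 * z')" using assms(1) yz by (simp add: ennreal_plus ennreal_mult)
  then have "enn2real x \<le> 2 * y' + 2 * z'" using yz by (intro enn2real_leI) auto
  also have "\<dots> \<le> (2 * sqrt y' + 2 * sqrt z')\<^sup>2" using yz by (simp add: power2_sum power_mult_distrib)
  finally have "sqrt (enn2real x) \<le> sqrt ((2 * sqrt y' + 2 * sqrt z')\<^sup>2)" by (rule real_sqrt_le_mono)
  then show ?thesis using yz by simp
qed

lemma nn_integral_sqrt_square_le:
  assumes "f \<in> borel_measurable M"
  shows "(\<integral>\<^sup>+\<omega>. ennreal (sqrt (enn2real (f \<omega>))) \<partial>M)\<^sup>2 \<le> (\<integral>\<^sup>+\<omega>. f \<omega> \<partial>M)"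
proof -
  have "(\<integral>\<^sup>+\<omega>. ennreal (sqrt (enn2real (f \<omega>))) \<partial>M)\<^sup>2 \<le> (\<integral>\<^sup>+\<omega>. (ennreal (sqrt (enn2real (f \<omega>))))\<^sup>2 \<partial>M)"
    using assms by (intro nn_integral_square_le) measurable
  also have "\<dots> \<le> (\<integral>\<^sup>+\<omega>. f \<omega> \<partial>M)"
  proof (rule nn_integral_mono)
    fix \<omega> show "(ennreal (sqrt (enn2real (f \<omega>))))\<^sup>2 \<le> f \<omega>"
      by (cases "f \<omega>") (auto simp: ennreal_power)
  qed
  finally show ?thesis .
qed

lemma tendsto_zero_of_square:
  fixes a b :: "nat \<Rightarrow> ennreal"
  assumes le: "\<And>n. (a n)\<^sup>2 \<le> b n" and b: "b \<longlonglongrightarrow> 0"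
  shows "a \<longlonglongrightarrow> 0"
proof (rule order_tendstoI)
  fix \<epsilon> :: ennreal assume "0 < \<epsilon>"
  then have "0 < \<epsilon>\<^sup>2" by (simp add: power2_eq_square ennreal_zero_less_mult_iff)
  then have "eventually (\<lambda>n. b n < \<epsilon>\<^sup>2) sequentially" using b order_tendstoD(2) by blast
  then show "eventually (\<lambda>n. a n < \<epsilon>) sequentially"
  proof eventually_elim
    fix n assume "b n < \<epsilon>\<^sup>2"
    then have "\<not> \<epsilon>\<^sup>2 \<le> (a n)\<^sup>2" using le[of n] by (meson leD order.strict_trans1)
    then show "a n < \<epsilon>" using power_mono[of \<epsilon> "a n" 2] by force
  qed
qed auto

lemma energy_finite_AE:
  assumes "energy_of t \<Phi> \<in> borel_measurable M" "(\<integral>\<^sup>+\<omega>. energy_of t \<Phi> \<omega> \<partial>M) < \<infinity>"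
  shows "AE \<omega> in M. energy_of t \<Phi> \<omega> < \<infinity>"
  using nn_integral_PInf_AE[OF assms(1)] assms(2) by (auto simp: less_top)

text \<open>Proved for every version \<open>X\<close>. Convergence in mean square dominates
  convergence of the first moments \<open>x n\<close>, and by Jensen also of the root energies
  \<open>y n\<close> of the errors, so the elementary inequality passes to the limit.\<close>

theorem stoch_integral_bound:
  fixes \<Phi> :: "real \<Rightarrow> 'w \<Rightarrow> 'u \<Rightarrow> 'h::{real_inner, banach, second_countable_topology}"
  assumes t: "0 \<le> t" and X: "has_stoch_integral M F Q W t \<Phi> X"
  shows "(\<integral>\<^sup>+\<omega>. ennreal (norm (X \<omega>)) \<partial>M) \<le> 6 * (\<integral>\<^sup>+\<omega>. ennreal (sqrt (enn2real (energy_of t \<Phi> \<omega>))) \<partial>M)"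
proof -
  from X obtain E where \<Phi>: "\<Phi> \<in> N2 M F Q t" and Xm: "X \<in> borel_measurable M" and E: "\<And>n. elementary F t (E n)"
    and lim\<Phi>: "(\<lambda>n. \<integral>\<^sup>+\<omega>. energy_of t (\<lambda>\<tau> \<omega> u. elem_process Q (E n) \<tau> \<omega> u - \<Phi> \<tau> \<omega> u) \<omega> \<partial>M) \<longlonglongrightarrow> 0"
    and limX: "(\<lambda>n. \<integral>\<^sup>+\<omega>. ennreal ((norm (elem_integral W (E n) \<omega> - X \<omega>))\<^sup>2) \<partial>M) \<longlonglongrightarrow> 0"
    unfolding has_stoch_integral_def energy_of_def by blast
  let ?G = "\<lambda>x. \<Phi> (fst x) (snd x)"
  define \<Delta> where "\<Delta> n = (\<lambda>\<tau> \<omega> u. elem_process Q (E n) \<tau> \<omega> u - \<Phi> \<tau> \<omega> u)" for n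
  let ?e = "\<lambda>\<Phi> \<omega>. ennreal (sqrt (enn2real (energy_of t \<Phi> \<omega>)))"
  have cm: "cmeas t ?G" by (rule N2_cmeas[OF t \<Phi>])
  have cmE: "cmeas t (el (E n))" for n by (rule cmeas_el[OF t E])
  have cmD: "cmeas t (\<lambda>x. \<Delta> n (fst x) (snd x))" for n
    unfolding \<Delta>_def by (intro cmeas_diff cm cmE)
  note [measurable] = Xm elem_integral_measurable[OF E] energy_of_measurable[OF t cm]
    energy_of_measurable[OF t cmE] energy_of_measurable[OF t cmD]
  define x where "x n = (\<integral>\<^sup>+\<omega>. ennreal (norm (elem_integral W (E n) \<omega> - X \<omega>)) \<partial>M)" for n
  define y where "y n = (\<integral>\<^sup>+\<omega>. ?e (\<Delta> n) \<omega> \<partial>M)" for n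
  have x0: "x \<longlonglongrightarrow> 0"
  proof (rule tendsto_zero_of_square[OF _ limX])
    fix n show "(x n)\<^sup>2 \<le> (\<integral>\<^sup>+\<omega>. ennreal ((norm (elem_integral W (E n) \<omega> - X \<omega>))\<^sup>2) \<partial>M)"
      unfolding x_def using nn_integral_square_le[of "\<lambda>\<omega>. ennreal (norm (elem_integral W (E n) \<omega> - X \<omega>))"]
      by (simp add: ennreal_power)
  qed
  have lim\<Delta>: "(\<lambda>n. \<integral>\<^sup>+\<omega>. energy_of t (\<Delta> n) \<omega> \<partial>M) \<longlonglongrightarrow> 0"
    using lim\<Phi> by (simp add: \<Delta>_def)
  have y0: "y \<longlonglongrightarrow> 0"
    unfolding y_def[abs_def] by (rule tendsto_zero_of_square[OF nn_integral_sqrt_square_le lim\<Delta>]) measurable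
  \<comment> \<open>The approximation errors are extended reals and are known to be finite only for
    large \<open>n\<close>.\<close>
  have "eventually (\<lambda>n. (\<integral>\<^sup>+\<omega>. energy_of t (\<Delta> n) \<omega> \<partial>M) < \<infinity>) sequentially"
    using lim\<Delta> by (rule order_tendstoD) simp
  then have "eventually (\<lambda>n. (\<integral>\<^sup>+\<omega>. ennreal (norm (X \<omega>)) \<partial>M) \<le> 6 * (\<integral>\<^sup>+\<omega>. ?e \<Phi> \<omega> \<partial>M) + 6 * y n + x n) sequentially"
  proof eventually_elim
    fix n assume fin: "(\<integral>\<^sup>+\<omega>. energy_of t (\<Delta> n) \<omega> \<partial>M) < \<infinity>"
    have "(\<integral>\<^sup>+\<omega>. ennreal (norm (X \<omega>)) \<partial>M) \<le>
        (\<integral>\<^sup>+\<omega>. ennreal (norm (elem_integral W (E n) \<omega>)) + ennreal (norm (elem_integral W (E n) \<omega> - X \<omega>)) \<partial>M)"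
    proof (rule nn_integral_mono)
      fix \<omega>
      have "norm (X \<omega>) \<le> norm (elem_integral W (E n) \<omega>) + norm (elem_integral W (E n) \<omega> - X \<omega>)"
        using norm_triangle_ineq4[of "elem_integral W (E n) \<omega>" "elem_integral W (E n) \<omega> - X \<omega>"] by simp
      then show "ennreal (norm (X \<omega>)) \<le> ennreal (norm (elem_integral W (E n) \<omega>)) + ennreal (norm (elem_integral W (E n) \<omega> - X \<omega>))"
        by (simp add: ennreal_leI flip: ennreal_plus)
    qed
    also have "\<dots> = (\<integral>\<^sup>+\<omega>. ennreal (norm (elem_integral W (E n) \<omega>)) \<partial>M) + x n"
      unfolding x_def by (rule nn_integral_add) measurable
    also have "(\<integral>\<^sup>+\<omega>. ennreal (norm (elem_integral W (E n) \<omega>)) \<partial>M) \<le> 3 * (\<integral>\<^sup>+\<omega>. ?e (elem_process Q (E n)) \<omega> \<partial>M)"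
      unfolding energy_of_def by (rule elem_burkholder[OF E])
    also have "(\<integral>\<^sup>+\<omega>. ?e (elem_process Q (E n)) \<omega> \<partial>M) \<le> (\<integral>\<^sup>+\<omega>. 2 * ?e \<Phi> \<omega> + 2 * ?e (\<Delta> n) \<omega> \<partial>M)"
      using energy_finite_AE[OF energy_of_measurable[OF t cm] N2_energy_finite[OF \<Phi>]]
        energy_finite_AE[OF energy_of_measurable[OF t cmD] fin] AE_space
    proof (intro nn_integral_mono_AE, eventually_elim)
      fix \<omega> assume fin: "energy_of t \<Phi> \<omega> < \<infinity>" "energy_of t (\<Delta> n) \<omega> < \<infinity>" and \<omega>: "\<omega> \<in> space M"
      have "energy_of t (elem_process Q (E n)) \<omega> \<le>
          (\<integral>\<^sup>+\<tau>. 2 * (ennreal ((hs (\<Phi> \<tau> \<omega>))\<^sup>2) * indicator {0..t} \<tau>) + 2 * (ennreal ((hs (\<Delta> n \<tau> \<omega>))\<^sup>2) * indicator {0..t} \<tau>) \<partial>lborel)"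
        unfolding energy_of_def
      proof (rule nn_integral_mono)
        fix \<tau>
        show "ennreal ((hs (elem_process Q (E n) \<tau> \<omega>))\<^sup>2) * indicator {0..t} \<tau> \<le>
          2 * (ennreal ((hs (\<Phi> \<tau> \<omega>))\<^sup>2) * indicator {0..t} \<tau>) + 2 * (ennreal ((hs (\<Delta> n \<tau> \<omega>))\<^sup>2) * indicator {0..t} \<tau>)"
        proof (cases "\<tau> \<in> {0..t}")
          case True
          then have "(\<tau>, \<omega>) \<in> space (nu t)" using \<omega> by (simp add: space_nu[OF t])
          then have "ell2 (\<Delta> n \<tau> \<omega>)" "ell2 (\<Phi> \<tau> \<omega>)"
            using cmeas_ell2[OF cmD] cmeas_ell2[OF cm] by fastforce+
          \<comment> \<open>The triangle inequality from the elementary process through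
            \<open>\<Phi>\<close> to zero; the zero is written out to fit the three-point
            form.\<close>
          then have "(hs (\<lambda>u. elem_process Q (E n) \<tau> \<omega> u - 0))\<^sup>2 \<le>
              2 * (hs (\<lambda>u. elem_process Q (E n) \<tau> \<omega> u - \<Phi> \<tau> \<omega> u))\<^sup>2 + 2 * (hs (\<lambda>u. \<Phi> \<tau> \<omega> u - 0))\<^sup>2"
            by (intro hs_diff_square_le) (simp_all add: \<Delta>_def)
          then have "(hs (elem_process Q (E n) \<tau> \<omega>))\<^sup>2 \<le> 2 * (hs (\<Phi> \<tau> \<omega>))\<^sup>2 + 2 * (hs (\<Delta> n \<tau> \<omega>))\<^sup>2"
            by (simp add: \<Delta>_def)
          then have "ennreal ((hs (elem_process Q (E n) \<tau> \<omega>))\<^sup>2) \<le> ennreal (2 * (hs (\<Phi> \<tau> \<omega>))\<^sup>2 + 2 * (hs (\<Delta> n \<tau> \<omega>))\<^sup>2)"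
            by (rule ennreal_leI)
          then show ?thesis using True by (simp add: ennreal_plus ennreal_mult)
        qed simp
      qed
      also have "\<dots> = 2 * energy_of t \<Phi> \<omega> + 2 * energy_of t (\<Delta> n) \<omega>"
        unfolding energy_of_def using nu_section_measurable[OF t cm \<omega>] nu_section_measurable[OF t cmD \<omega>]
        by (simp add: nn_integral_add nn_integral_cmult)
      finally have "sqrt (enn2real (energy_of t (elem_process Q (E n)) \<omega>)) \<le>
          2 * sqrt (enn2real (energy_of t \<Phi> \<omega>)) + 2 * sqrt (enn2real (energy_of t (\<Delta> n) \<omega>))"
        using fin by (rule sqrt_enn2real_le)
      then have "ennreal (sqrt (enn2real (energy_of t (elem_process Q (E n)) \<omega>))) \<le>
          ennreal (2 * sqrt (enn2real (energy_of t \<Phi> \<omega>)) + 2 * sqrt (enn2real (energy_of t (\<Delta> n) \<omega>)))"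
        by (rule ennreal_leI)
      then show "?e (elem_process Q (E n)) \<omega> \<le> 2 * ?e \<Phi> \<omega> + 2 * ?e (\<Delta> n) \<omega>"
        by (simp add: ennreal_plus ennreal_mult)
    qed
    also have "\<dots> = 2 * (\<integral>\<^sup>+\<omega>. ?e \<Phi> \<omega> \<partial>M) + 2 * y n"
      unfolding y_def by (subst nn_integral_add) (auto simp: nn_integral_cmult)
    finally have "(\<integral>\<^sup>+\<omega>. ennreal (norm (X \<omega>)) \<partial>M) \<le> 3 * (2 * (\<integral>\<^sup>+\<omega>. ?e \<Phi> \<omega> \<partial>M) + 2 * y n) + x n"
      by (simp add: add_right_mono mult_left_mono)
    then show "(\<integral>\<^sup>+\<omega>. ennreal (norm (X \<omega>)) \<partial>M) \<le> 6 * (\<integral>\<^sup>+\<omega>. ?e \<Phi> \<omega> \<partial>M) + 6 * y n + x n"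
      by (simp add: distrib_left mult.assoc[symmetric])
  qed
  moreover have "(\<lambda>n. 6 * (\<integral>\<^sup>+\<omega>. ?e \<Phi> \<omega> \<partial>M) + 6 * y n + x n) \<longlonglongrightarrow> 6 * (\<integral>\<^sup>+\<omega>. ?e \<Phi> \<omega> \<partial>M) + 6 * 0 + 0"
    by (intro tendsto_add tendsto_const ennreal_tendsto_cmult x0 y0) simp
  ultimately show ?thesis
    using tendsto_lowerbound[of "\<lambda>n. 6 * (\<integral>\<^sup>+\<omega>. ?e \<Phi> \<omega> \<partial>M) + 6 * y n + x n"] by simp
qed

end

section \<open>Uniform boundedness of the resolvent\<close>

text \<open>Baire's theorem: the closed sets \<open>V n\<close> of vectors on which \<open>T\<close>
  is bounded by \<open>n\<close> cover a complete space, so one of them contains a ball, and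
  linearity spreads the bound over all directions.\<close>

lemma uniform_boundedness:
  fixes T :: "('a::banach \<Rightarrow>\<^sub>L 'b::real_normed_vector) set"
  assumes pw: "\<And>x. \<exists>c. \<forall>f\<in>T. norm (blinfun_apply f x) \<le> c"
  shows "\<exists>c. \<forall>f\<in>T. norm f \<le> c"
proof -
  define V where "V n = {x. \<forall>f\<in>T. norm (blinfun_apply f x) \<le> real n}" for n :: nat
  have cl: "closed (V n)" for n
  proof -
    have "V n = (\<Inter>f\<in>T. {x. norm (blinfun_apply f x) \<le> real n})" by (auto simp: V_def)
    moreover have "closed {x. norm (blinfun_apply f x) \<le> real n}" for f :: "'a \<Rightarrow>\<^sub>L 'b"
      by (intro closed_Collect_le continuous_intros)
    ultimately show ?thesis by auto
  qed
  have UNIV: "(\<Union>n. V n) = UNIV"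
  proof -
    have "x \<in> (\<Union>n. V n)" for x
    proof -
      obtain c where "\<forall>f\<in>T. norm (blinfun_apply f x) \<le> c" using pw by blast
      moreover obtain n where "c \<le> real n" using real_arch_simple by blast
      ultimately have "x \<in> V n" by (auto simp: V_def intro: order_trans)
      then show ?thesis by blast
    qed
    then show ?thesis by blast
  qed
  have "\<exists>n. interior (V n) \<noteq> {}"
  proof (rule ccontr)
    assume "\<nexists>n. interior (V n) \<noteq> {}"
    then have "euclidean interior_of \<Union>(range V) = {}"
      using cl by (intro Baire_category_alt) (auto simp: completely_metrizable_space_euclidean)
    then show False using UNIV by simp
  qed
  then obtain n x0 where "x0 \<in> interior (V n)" by blast
  then obtain r where r: "0 < r" "cball x0 r \<subseteq> V n"
    using open_contains_cball[of "interior (V n)"] interior_subset by blast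
  have "norm f \<le> 2 * real n / r" if f: "f \<in> T" for f
  proof (rule norm_blinfun_bound)
    fix x :: 'a
    show "norm (blinfun_apply f x) \<le> 2 * real n / r * norm x"
    proof (cases "x = 0")
      case False
      \<comment> \<open>Scaled to the radius of the ball, so that \<open>x0\<close> and
        \<open>x0 + y\<close> both lie in \<open>V n\<close>; their difference costs the factor
        2.\<close>
      define y where "y = (r / norm x) *\<^sub>R x"
      have "norm y = r" using r(1) False by (simp add: y_def)
      then have "x0 + y \<in> V n" "x0 \<in> V n" using r by (auto simp: dist_norm subset_iff)
      then have "norm (blinfun_apply f (x0 + y)) \<le> real n" "norm (blinfun_apply f x0) \<le> real n"
        using f by (auto simp: V_def)
      then have "norm (blinfun_apply f (x0 + y) - blinfun_apply f x0) \<le> 2 * real n"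
        using norm_triangle_ineq4[of "blinfun_apply f (x0 + y)" "blinfun_apply f x0"] by linarith
      then have "norm (blinfun_apply f y) \<le> 2 * real n" by (simp add: blinfun.add_right)
      then have "r / norm x * norm (blinfun_apply f x) \<le> 2 * real n"
        using r(1) by (simp add: y_def blinfun.scaleR_right)
      then show ?thesis using r(1) False by (simp add: field_simps)
    qed simp
  qed (use r(1) in simp)
  then show ?thesis by blast
qed

text \<open>Orbits over a compact interval are bounded, and uniform boundedness makes the operator
  norms bounded. Only then is the real supremum \<open>M_T\<close> an upper bound of the
  norms.\<close>

lemma strongly_continuous_bounded:
  fixes S :: "real \<Rightarrow> 'h::banach \<Rightarrow>\<^sub>L 'k::real_normed_vector"
  assumes S: "\<And>x. continuous_on {0..} (\<lambda>t. blinfun_apply (S t) x)"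
  shows "bdd_above ((\<lambda>t. norm (S t)) ` {0..T})"
proof -
  have "\<exists>c. \<forall>f\<in>S ` {0..T}. norm f \<le> c"
  proof (rule uniform_boundedness)
    fix x
    have "continuous_on {0..T} (\<lambda>t. blinfun_apply (S t) x)"
      by (rule continuous_on_subset[OF S]) auto
    then have "bounded ((\<lambda>t. blinfun_apply (S t) x) ` {0..T})"
      by (intro compact_imp_bounded compact_continuous_image) auto
    then show "\<exists>c. \<forall>f\<in>S ` {0..T}. norm (blinfun_apply f x) \<le> c"
      by (auto simp: bounded_iff)
  qed
  then show ?thesis by (auto simp: bdd_above_def)
qed

section \<open>The integrand of the stochastic convolution\<close>

context cylindrical_wiener
begin

text \<open>Strong continuity of \<open>S\<close> becomes continuity in the Hilbert--Schmidt norm: away from finitely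
  many basis vectors the uniform bound on \<open>S\<close> suffices.\<close>

lemma hs_comp_continuous:
  fixes S :: "real \<Rightarrow> 'h::{real_inner, banach, second_countable_topology} \<Rightarrow>\<^sub>L 'h"
  assumes S: "\<And>x. continuous_on I (\<lambda>t. blinfun_apply (S t) x)"
    and bd: "\<And>t. t \<in> I \<Longrightarrow> norm (S t) \<le> m" and L: "L \<in> L20 Q" and t: "t \<in> I" and \<epsilon>: "0 < \<epsilon>"
  shows "\<exists>\<delta>>0. \<forall>t'\<in>I. dist t' t < \<delta> \<longrightarrow>
    hs (\<lambda>u. blinfun_apply (S t) (L u) - blinfun_apply (S t') (L u)) < \<epsilon>"
proof -
  have m: "0 \<le> m" using bd[OF t] norm_ge_zero order_trans by blast
  \<comment> \<open>Outside \<open>C\<close> the difference of two operators has norm at most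
    \<open>2 * m\<close>, so the tail contributes at most
    \<open>2 * m * \<eta> \<le> \<epsilon>/2\<close>; \<open>m + 1\<close> guards against
    \<open>m = 0\<close>.\<close>
  define \<eta> where "\<eta> = \<epsilon> / (4 * (m + 1))"
  have \<eta>: "0 < \<eta>" using \<epsilon> m by (simp add: \<eta>_def)
  obtain C where C: "finite C" "C \<subseteq> B" "dist (\<Sum>b\<in>C. (norm (L b))\<^sup>2) ((hs L)\<^sup>2) \<le> \<eta>\<^sup>2"
    using has_sum_finite_approximation[OF hs_has_sum[OF L20_ell2[OF L]], of "\<eta>\<^sup>2"] \<eta> by auto
  define N where "N b = (if b \<in> C then 0 else L b)" for b
  have N_eq: "norm (N b) = norm ((\<Sum>c\<in>C. rank1 (J c) (L c) b) - L b)" if "b \<in> B" for b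
    using C that by (simp add: N_def truncation_B)
  have hs_N: "hs N \<le> \<eta>"
  proof (rule power2_le_imp_le)
    have "hs N = hs (\<lambda>u. (\<Sum>c\<in>C. rank1 (J c) (L c) u) - L u)" by (rule hs_cong[OF N_eq])
    then have "(hs N)\<^sup>2 = (hs L)\<^sup>2 - (\<Sum>b\<in>C. (norm (L b))\<^sup>2)"
      by (simp add: hs_truncation[OF L20_ell2[OF L] C(1,2)])
    then show "(hs N)\<^sup>2 \<le> \<eta>\<^sup>2" using C(3) by (auto simp: dist_real_def abs_if split: if_splits)
  qed (use \<eta> in simp)
  have ell2_N: "ell2 N" by (rule hs_norm_le(1)[OF L20_ell2[OF L], of N 1]) (auto simp: N_def)
  have Sx: "((\<lambda>t'. blinfun_apply (S t') x) \<longlongrightarrow> blinfun_apply (S t) x) (at t within I)" for x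
    using S[of x] t by (simp add: continuous_on_def)
  have "((\<lambda>t'. \<Sum>b\<in>C. norm (blinfun_apply (S t) (L b) - blinfun_apply (S t') (L b))) \<longlongrightarrow>
      (\<Sum>b\<in>C. norm (blinfun_apply (S t) (L b) - blinfun_apply (S t) (L b)))) (at t within I)"
    by (intro tendsto_sum tendsto_norm tendsto_diff tendsto_const Sx)
  then have "eventually (\<lambda>t'. (\<Sum>b\<in>C. norm (blinfun_apply (S t) (L b) - blinfun_apply (S t') (L b))) < \<epsilon>/2) (at t within I)"
    using \<epsilon> by (intro order_tendstoD) auto
  then obtain \<delta> where \<delta>: "0 < \<delta>"
    "\<And>t'. t' \<in> I \<Longrightarrow> t' \<noteq> t \<Longrightarrow> dist t' t < \<delta> \<Longrightarrow>
      (\<Sum>b\<in>C. norm (blinfun_apply (S t) (L b) - blinfun_apply (S t') (L b))) < \<epsilon>/2"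
    by (auto simp: eventually_at)
  show ?thesis
  proof (intro exI[of _ \<delta>] conjI ballI impI \<delta>(1))
    fix t' assume t': "t' \<in> I" "dist t' t < \<delta>"
    let ?D = "\<lambda>u. blinfun_apply (S t) (L u) - blinfun_apply (S t') (L u)"
    have small: "(\<Sum>b\<in>C. norm (?D b)) < \<epsilon>/2"
      using \<delta>(2)[OF t'(1) _ t'(2)] \<epsilon> by (cases "t' = t") auto
    define D1 where "D1 b = (if b \<in> C then ?D b else 0)" for b
    define D2 where "D2 b = (if b \<in> C then 0 else ?D b)" for b
    have D1: "ell2 D1" "hs D1 \<le> (\<Sum>b\<in>C. norm (?D b))"
    proof -
      have "L2_set (\<lambda>b. norm (D1 b)) X \<le> (\<Sum>b\<in>C. norm (?D b))" if "finite X" "X \<subseteq> B" for X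
      proof -
        have "L2_set (\<lambda>b. norm (D1 b)) X \<le> (\<Sum>b\<in>X. norm (D1 b))" by (rule L2_set_le_sum) simp
        also have "\<dots> = (\<Sum>b\<in>X \<inter> C. norm (?D b))"
          using that by (subst sum.inter_restrict) (auto simp: D1_def if_distrib intro!: sum.cong)
        also have "\<dots> \<le> (\<Sum>b\<in>C. norm (?D b))" using C by (intro sum_mono2) auto
        finally show ?thesis .
      qed
      from hs_leI[OF this] show "ell2 D1" "hs D1 \<le> (\<Sum>b\<in>C. norm (?D b))" by auto
    qed
    have D2: "norm (D2 b) \<le> (2 * m) * norm (N b)" for b
    proof (cases "b \<in> C")
      case False
      have "norm (?D b) \<le> norm (S t) * norm (L b) + norm (S t') * norm (L b)"
        by (intro order_trans[OF norm_triangle_ineq4] add_mono norm_blinfun)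
      also have "\<dots> \<le> m * norm (L b) + m * norm (L b)"
        by (intro add_mono mult_right_mono bd t t') auto
      finally show ?thesis using False by (simp add: D2_def N_def)
    qed (simp add: D2_def N_def)
    note D2' = hs_norm_le[OF ell2_N D2, simplified, OF m]
    have "hs ?D = hs (\<lambda>b. D1 b + D2 b)" by (rule hs_cong) (simp add: D1_def D2_def)
    also have "\<dots> \<le> hs D1 + hs D2" by (intro hs_add D1 D2')
    also have "hs D2 \<le> 2 * m * \<eta>" using D2'(2) mult_left_mono[OF hs_N, of "2 * m"] m by simp
    also have "2 * m * \<eta> \<le> \<epsilon>/2" using m \<epsilon> by (simp add: \<eta>_def divide_simps)
    finally show "hs ?D < \<epsilon>" using D1(2) small by simp
  qed
qed

lemma fst_measurable: "0 \<le> t \<Longrightarrow> fst \<in> borel_measurable (nu t)"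
proof (subst borel_measurable_iff_greater, intro allI)
  fix c :: real assume t: "0 \<le> t"
  have m: "space M \<in> sets (F s)" if "0 \<le> s" for s
    using space_F[OF that] sets.top[of "F s"] by simp
  consider "c < 0" | "0 \<le> c" "c < t" | "t \<le> c" by linarith
  then show "{w\<in>space (nu t). c < fst w} \<in> sets (nu t)"
  proof cases
    case 1
    then have "{w\<in>space (nu t). c < fst w} = space (nu t)" by (auto simp: space_nu[OF t])
    then show ?thesis by simp
  next
    case 2
    then have "{w\<in>space (nu t). c < fst w} = {c<..t} \<times> space M" by (auto simp: space_nu[OF t])
    then show ?thesis using nu_interval[of c t t "space M"] 2 m by simp
  next
    case 3
    then have "{w\<in>space (nu t). c < fst w} = {}" by (auto simp: space_nu[OF t])
    then show ?thesis by (simp only: sets.empty_sets)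
  qed
qed

text \<open>The integrand is predictable on the interval up to \<open>T\<close>, but the integral up
  to \<open>t\<close> uses the predictable sigma-algebra there; a generator is cut off at
  \<open>min r t\<close> or disappears.\<close>

lemma nu_restrict_measurable:
  assumes t: "0 \<le> t" "t \<le> T"
  shows "(\<lambda>x. x) \<in> measurable (nu t) (nu T)"
proof -
  have T: "0 \<le> T" using t by simp
  have "(\<lambda>x. x) \<in> measurable (nu t) (sigma ({0..T} \<times> space M) (pred_generator T))"
  proof (rule measurable_measure_of[OF pred_generator_Pow[OF T]])
    show "(\<lambda>x. x) \<in> space (nu t) \<rightarrow> {0..T} \<times> space M" using t by (auto simp: space_nu)
    fix P assume "P \<in> pred_generator T"
    then consider s r A where "P = {s<..r} \<times> A" "0 \<le> s" "s < r" "r \<le> T" "A \<in> sets (F s)"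
      | A where "P = {0} \<times> A" "A \<in> sets (F 0)" by blast
    then have "P \<inter> space (nu t) \<in> sets (nu t)"
    proof cases
      case (1 s r A)
      show ?thesis
      proof (cases "s < t")
        case True
        have "P \<inter> space (nu t) = {s<..min r t} \<times> A"
          using 1 F_subset[OF 1(2,5)] by (auto simp: space_nu[OF t(1)])
        then show ?thesis using nu_interval[of s "min r t" t A] 1 True by simp
      next
        case False
        then have "P \<inter> space (nu t) = {}" using 1 by (auto simp: space_nu[OF t(1)])
        then show ?thesis by simp
      qed
    next
      case (2 A)
      then have "P \<inter> space (nu t) = P" using F_subset[of 0 A] t by (auto simp: space_nu[OF t(1)])
      then show ?thesis using nu_zero[OF t(1) 2(2)] 2(1) by simp
    qed
    then show "(\<lambda>x. x) -` P \<inter> space (nu t) \<in> sets (nu t)" by simp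
  qed
  then show ?thesis
    by (simp add: measurable_cong_sets[OF refl sets_nu[OF T]] predictable_def)
qed

text \<open>The preimage of an open set under a jointly continuous map of time and operator is
  written as a countable union of products of a rational time interval with an open set of
  operators. Only time has to be discretised for this.\<close>

lemma convolution_integrand_L20_measurable:
  fixes S :: "real \<Rightarrow> 'h::{real_inner, banach, second_countable_topology} \<Rightarrow>\<^sub>L 'h"
  assumes t: "0 \<le> t" and S: "\<And>x. continuous_on {0..t} (\<lambda>\<tau>. blinfun_apply (S \<tau>) x)"
    and bd: "\<And>\<tau>. \<tau> \<in> {0..t} \<Longrightarrow> norm (S \<tau>) \<le> m"
    and G: "G \<in> measurable (nu t) (L20_borel Q)"
  shows "(\<lambda>x u. blinfun_apply (S (fst x)) (G x u)) \<in> measurable (nu t) (L20_borel Q)"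
proof -
  have m: "0 \<le> m" using order_trans[OF norm_ge_zero bd[of 0]] t by simp
  define D where "D L L' = hs (\<lambda>u. L u - L' u :: 'h)" for L L'
  define SL where "SL \<tau> L = (\<lambda>u. blinfun_apply (S \<tau>) (L u))" for \<tau> and L :: "'u \<Rightarrow> 'h"
  have SL: "L \<in> L20 Q \<Longrightarrow> SL \<tau> L \<in> L20 Q" for \<tau> L
    unfolding SL_def by (rule L20_comp(1))
  have GL: "x \<in> space (nu t) \<Longrightarrow> G x \<in> L20 Q" for x
    using measurable_space[OF G] by (simp add: space_L20_borel)
  let ?open = "\<lambda>V. openin (Metric_space.mtopology (L20 Q) D) V"
  have open_iff: "?open V \<longleftrightarrow> V \<subseteq> L20 Q \<and> (\<forall>L\<in>V. \<exists>r>0. \<forall>L'\<in>L20 Q. D L L' < r \<longrightarrow> L' \<in> V)" for V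
    unfolding D_def[abs_def] by (rule mtopology_openin_iff)
  have "(\<lambda>x. SL (fst x) (G x)) \<in> measurable (nu t) (sigma (L20 Q) {V. ?open V})"
  proof (rule measurable_measure_of)
    show "{V. ?open V} \<subseteq> Pow (L20 Q)" by (auto simp: open_iff)
    show "(\<lambda>x. SL (fst x) (G x)) \<in> space (nu t) \<rightarrow> L20 Q" using SL GL by auto
    fix V assume "V \<in> {V. ?open V}"
    then have V: "V \<subseteq> L20 Q" "\<And>L. L \<in> V \<Longrightarrow> \<exists>r>0. \<forall>L'\<in>L20 Q. D L L' < r \<longrightarrow> L' \<in> V"
      by (auto simp: open_iff)
    \<comment> \<open>The interior of the set of operators sent into \<open>V\<close> at all times
      between \<open>a\<close> and \<open>b\<close>; taking the interior makes it open by
      construction.\<close>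
    define U where "U a b = {L\<in>L20 Q. \<exists>r>0. \<forall>L'\<in>L20 Q. D L L' < r \<longrightarrow>
        (\<forall>\<tau>\<in>{0..t}. a < \<tau> \<and> \<tau> < b \<longrightarrow> SL \<tau> L' \<in> V)}" for a b
    have tri: "D L L'' \<le> D L L' + D L' L''" if "L \<in> L20 Q" "L' \<in> L20 Q" "L'' \<in> L20 Q" for L L' L''
      unfolding D_def using that by (intro hs_triangle L20_ell2 L20_diff)
    have "?open (U a b)" for a b
      unfolding open_iff
    proof (intro conjI ballI)
      fix L assume L: "L \<in> U a b"
      then obtain r where LL: "L \<in> L20 Q" and r: "0 < r"
        "\<And>L'. L' \<in> L20 Q \<Longrightarrow> D L L' < r \<Longrightarrow> \<forall>\<tau>\<in>{0..t}. a < \<tau> \<and> \<tau> < b \<longrightarrow> SL \<tau> L' \<in> V"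
        by (auto simp: U_def)
      have "L' \<in> U a b" if L': "L' \<in> L20 Q" "D L L' < r" for L'
      proof -
        have "\<forall>\<tau>\<in>{0..t}. a < \<tau> \<and> \<tau> < b \<longrightarrow> SL \<tau> L'' \<in> V"
          if "L'' \<in> L20 Q" "D L' L'' < r - D L L'" for L''
          using that tri[OF LL L'(1) that(1)] by (intro r(2)) auto
        then show ?thesis using L' unfolding U_def by (auto intro!: exI[of _ "r - D L L'"])
      qed
      then show "\<exists>r>0. \<forall>L'\<in>L20 Q. D L L' < r \<longrightarrow> L' \<in> U a b" using r(1) by blast
    qed (auto simp: U_def)
    then have U: "U a b \<in> sets (L20_borel Q)" for a b
      unfolding sets_L20_borel D_def[abs_def] by (auto intro: sigma_sets.Basic)
    have "(\<lambda>x. SL (fst x) (G x)) -` V \<inter> space (nu t) =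
      (\<Union>(a, b)\<in>\<rat> \<times> \<rat>. {x\<in>space (nu t). a < fst x \<and> fst x < b} \<inter> (G -` U a b \<inter> space (nu t)))"
      (is "?lhs = ?rhs")
    proof (intro equalityI subsetI)
      fix x assume x: "x \<in> ?lhs"
      then have xs: "x \<in> space (nu t)" and xt: "fst x \<in> {0..t}" by (auto simp: space_nu[OF t])
      let ?L = "G x" and ?\<tau> = "fst x"
      have L: "?L \<in> L20 Q" by (rule GL[OF xs])
      obtain r where r: "0 < r" "\<And>L'. L' \<in> L20 Q \<Longrightarrow> D (SL ?\<tau> ?L) L' < r \<Longrightarrow> L' \<in> V"
        using V(2)[of "SL ?\<tau> ?L"] x by auto
      obtain \<delta> where \<delta>: "0 < \<delta>" "\<And>\<tau>'. \<tau>' \<in> {0..t} \<Longrightarrow> dist \<tau>' ?\<tau> < \<delta> \<Longrightarrow> D (SL ?\<tau> ?L) (SL \<tau>' ?L) < r/2"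
        using hs_comp_continuous[OF S bd L xt, of "r/2"] r(1) unfolding D_def SL_def by (auto; fail)
      obtain a where a: "a \<in> \<rat>" "?\<tau> - \<delta> < a" "a < ?\<tau>" using Rats_dense_in_real[of "?\<tau> - \<delta>" ?\<tau>] \<delta>(1) by auto
      obtain b where b: "b \<in> \<rat>" "?\<tau> < b" "b < ?\<tau> + \<delta>" using Rats_dense_in_real[of ?\<tau> "?\<tau> + \<delta>"] \<delta>(1) by auto
      \<comment> \<open>The radius \<open>r\<close> is split in halves: moving the time from
        \<open>?\<tau>\<close> to \<open>\<tau>'\<close> costs less than \<open>r/2\<close> by the
        choice of \<open>\<delta>\<close>, and moving the operator costs less than
        \<open>(m + 1) * (r / (2 * (m + 1)))\<close>.\<close>
      have "SL \<tau>' L' \<in> V" if L': "L' \<in> L20 Q" "D ?L L' < r / (2 * (m + 1))" and \<tau>': "\<tau>' \<in> {0..t}" "a < \<tau>'" "\<tau>' < b" for L' \<tau>'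
      proof (rule r(2)[OF SL[OF L'(1)]])
        have d: "dist \<tau>' ?\<tau> < \<delta>" using \<tau>' a b by (auto simp: dist_real_def)
        have "D (SL \<tau>' ?L) (SL \<tau>' L') = hs (\<lambda>u. blinfun_apply (S \<tau>') (?L u - L' u))"
          by (simp add: D_def SL_def blinfun.diff_right)
        also have "\<dots> \<le> norm (S \<tau>') * D ?L L'"
          unfolding D_def by (rule L20_comp(2)[OF L20_diff[OF L L'(1)]])
        also have "\<dots> \<le> (m + 1) * D ?L L'" using bd[OF \<tau>'(1)] by (intro mult_right_mono) (auto simp: D_def)
        also have "\<dots> < (m + 1) * (r / (2 * (m + 1)))" using L'(2) m by (intro mult_strict_left_mono) auto
        also have "\<dots> = r/2"
        proof -
          have "m + 1 \<noteq> 0" using m by simp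
          then show ?thesis by (metis mult.commute mult_divide_mult_cancel_left times_divide_eq_right)
        qed
        finally show "D (SL ?\<tau> ?L) (SL \<tau>' L') < r"
          using tri[OF SL[OF L] SL[OF L] SL[OF L'(1)], of ?\<tau> \<tau>' \<tau>'] \<delta>(2)[OF \<tau>'(1) d] by simp
      qed
      moreover have "0 < r / (2 * (m + 1))" using r(1) m by simp
      ultimately have "?L \<in> U a b" using L unfolding U_def by blast
      then show "x \<in> ?rhs" using a b xs by auto
    next
      fix x assume "x \<in> ?rhs"
      then obtain a b where xs: "x \<in> space (nu t)" and ab: "a < fst x" "fst x < b" and U: "G x \<in> U a b" by auto
      have "D (G x) (G x) = 0" by (simp add: D_def)
      moreover have "fst x \<in> {0..t}" using xs by (auto simp: space_nu[OF t])
      ultimately have "SL (fst x) (G x) \<in> V" using U ab by (auto simp: U_def)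
      then show "x \<in> ?lhs" using xs by simp
    qed
    also have "\<dots> \<in> sets (nu t)"
    proof (rule sets.countable_UN')
      show "countable (\<rat> \<times> \<rat> :: (real \<times> real) set)" by (intro countable_SIGMA countable_rat)
      show "(\<lambda>(a, b). {x\<in>space (nu t). a < fst x \<and> fst x < b} \<inter> (G -` U a b \<inter> space (nu t))) ` (\<rat> \<times> \<rat>) \<subseteq> sets (nu t)"
      proof (clarify, rule sets.Int)
        fix a b :: real
        note [measurable] = fst_measurable[OF t]
        show "{x\<in>space (nu t). a < fst x \<and> fst x < b} \<in> sets (nu t)" by measurable
        show "G -` U a b \<inter> space (nu t) \<in> sets (nu t)" by (rule measurable_sets[OF G U])
      qed
    qed
    finally show "(\<lambda>x. SL (fst x) (G x)) -` V \<inter> space (nu t) \<in> sets (nu t)" .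
  qed
  then show ?thesis unfolding L20_borel_def SL_def D_def[abs_def] .
qed

lemma convolution_integrand:
  fixes S :: "real \<Rightarrow> 'h::{real_inner, banach, second_countable_topology} \<Rightarrow>\<^sub>L 'h"
  assumes t: "0 \<le> t" "t \<le> T" and S: "\<And>x. continuous_on {0..} (\<lambda>\<tau>. blinfun_apply (S \<tau>) x)"
    and bd: "\<And>\<tau>. \<tau> \<in> {0..T} \<Longrightarrow> norm (S \<tau>) \<le> m" and \<Psi>: "\<Psi> \<in> N2 M F Q T"
  defines "\<Phi> \<equiv> \<lambda>\<tau> \<omega> u. blinfun_apply (S (t - \<tau>)) (\<Psi> \<tau> \<omega> u)"
  shows "\<Phi> \<in> N2 M F Q t"
    and "\<omega> \<in> space M \<Longrightarrow> energy_of t \<Phi> \<omega> \<le> ennreal (m\<^sup>2) * energy_of T \<Psi> \<omega>"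
proof -
  have T: "0 \<le> T" using t by simp
  have m: "0 \<le> m" using order_trans[OF norm_ge_zero bd[of 0]] T by simp
  have cm\<Psi>: "cmeas T (\<lambda>x. \<Psi> (fst x) (snd x))" by (rule N2_cmeas[OF T \<Psi>])
  show le: "energy_of t \<Phi> \<omega> \<le> ennreal (m\<^sup>2) * energy_of T \<Psi> \<omega>" if \<omega>: "\<omega> \<in> space M" for \<omega>
  proof -
    have "energy_of t \<Phi> \<omega> \<le> (\<integral>\<^sup>+\<tau>. ennreal (m\<^sup>2) * (ennreal ((hs (\<Psi> \<tau> \<omega>))\<^sup>2) * indicator {0..T} \<tau>) \<partial>lborel)"
      unfolding energy_of_def
    proof (rule nn_integral_mono)
      fix \<tau>
      show "ennreal ((hs (\<Phi> \<tau> \<omega>))\<^sup>2) * indicator {0..t} \<tau> \<le>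
          ennreal (m\<^sup>2) * (ennreal ((hs (\<Psi> \<tau> \<omega>))\<^sup>2) * indicator {0..T} \<tau>)"
      proof (cases "\<tau> \<in> {0..t}")
        case True
        then have \<tau>: "\<tau> \<in> {0..T}" "t - \<tau> \<in> {0..T}" using t by auto
        then have "\<Psi> \<tau> \<omega> \<in> L20 Q" using cmeas_L20[OF cm\<Psi>, of "(\<tau>, \<omega>)"] \<omega> by (simp add: space_nu[OF T])
        then have "hs (\<Phi> \<tau> \<omega>) \<le> norm (S (t - \<tau>)) * hs (\<Psi> \<tau> \<omega>)"
          unfolding \<Phi>_def by (rule L20_comp(2))
        also have "\<dots> \<le> m * hs (\<Psi> \<tau> \<omega>)" by (intro mult_right_mono bd \<tau>) simp
        finally have "(hs (\<Phi> \<tau> \<omega>))\<^sup>2 \<le> m\<^sup>2 * (hs (\<Psi> \<tau> \<omega>))\<^sup>2"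
          using power_mono[of "hs (\<Phi> \<tau> \<omega>)" "m * hs (\<Psi> \<tau> \<omega>)" 2] by (simp add: power_mult_distrib)
        then show ?thesis using True \<tau> by (simp add: ennreal_leI flip: ennreal_mult)
      qed simp
    qed
    also have "\<dots> = ennreal (m\<^sup>2) * energy_of T \<Psi> \<omega>"
      unfolding energy_of_def by (rule nn_integral_cmult[OF nu_section_measurable[OF T cm\<Psi> \<omega>]])
    finally show ?thesis .
  qed
  have \<Psi>m: "(\<lambda>x. \<Psi> (fst x) (snd x)) \<in> measurable (nu T) (L20_borel Q)"
    using \<Psi> by (simp add: N2_def split_def measurable_cong_sets[OF sets_nu[OF T] refl])
  have "(\<lambda>x. \<Psi> (fst x) (snd x)) \<in> measurable (nu t) (L20_borel Q)"
    using measurable_compose[OF nu_restrict_measurable[OF t] \<Psi>m] by simp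
  then have "(\<lambda>x u. blinfun_apply (S (t - fst x)) (\<Psi> (fst x) (snd x) u)) \<in> measurable (nu t) (L20_borel Q)"
  proof (rule convolution_integrand_L20_measurable[OF t(1), rotated 2])
    \<comment> \<open>The family is run backwards in time, and \<open>S (t - \<tau>)\<close> is
      controlled only for \<open>\<tau>\<close> up to \<open>t\<close>; hence the compact interval
      in the measurability lemma.\<close>
    show "continuous_on {0..t} (\<lambda>\<tau>. blinfun_apply (S (t - \<tau>)) x)" for x
      by (rule continuous_on_compose2[OF S]) (auto intro!: continuous_intros)
    show "norm (S (t - \<tau>)) \<le> m" if "\<tau> \<in> {0..t}" for \<tau>
      using that t by (intro bd) auto
  qed
  then have "(\<lambda>(\<tau>, \<omega>). \<Phi> \<tau> \<omega>) \<in> measurable (predictable M F t) (L20_borel Q)"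
    by (simp add: \<Phi>_def split_def measurable_cong_sets[OF sets_nu[OF t(1)] refl])
  moreover have "(\<integral>\<^sup>+\<omega>. energy_of t \<Phi> \<omega> \<partial>M) < \<infinity>"
  proof -
    have "(\<integral>\<^sup>+\<omega>. energy_of t \<Phi> \<omega> \<partial>M) \<le> (\<integral>\<^sup>+\<omega>. ennreal (m\<^sup>2) * energy_of T \<Psi> \<omega> \<partial>M)"
      by (intro nn_integral_mono le)
    also have "\<dots> = ennreal (m\<^sup>2) * (\<integral>\<^sup>+\<omega>. energy_of T \<Psi> \<omega> \<partial>M)"
      by (rule nn_integral_cmult[OF energy_of_measurable[OF T cm\<Psi>]])
    also have "\<dots> < \<infinity>" using N2_energy_finite[OF \<Psi>] by (simp add: ennreal_mult_less_top)
    finally show ?thesis .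
  qed
  ultimately show "\<Phi> \<in> N2 M F Q t" by (simp add: N2_def energy_of_def)
qed

text \<open>The integrand changes with \<open>t\<close>, so the bound is proved for one
  \<open>t\<close> at a time. Its right side is free of \<open>t\<close> because \<open>m\<close>
  bounds \<open>S\<close> on the whole interval and the energy of \<open>\<Psi>\<close> is taken up
  to \<open>T\<close>.\<close>

lemma stoch_convolution_bound:
  fixes S :: "real \<Rightarrow> 'h::{real_inner, banach, second_countable_topology} \<Rightarrow>\<^sub>L 'h"
  assumes t: "0 \<le> t" "t \<le> T" and S: "\<And>x. continuous_on {0..} (\<lambda>\<tau>. blinfun_apply (S \<tau>) x)"
    and bd: "\<And>\<tau>. \<tau> \<in> {0..T} \<Longrightarrow> norm (S \<tau>) \<le> m" and \<Psi>: "\<Psi> \<in> N2 M F Q T"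
  shows "(\<integral>\<^sup>+\<omega>. ennreal (norm (stoch_convolution M F Q W S \<Psi> t \<omega>)) \<partial>M) \<le>
    ennreal (6 * m) * (\<integral>\<^sup>+\<omega>. ennreal (sqrt (enn2real (energy_of T \<Psi> \<omega>))) \<partial>M)"
proof -
  have T: "0 \<le> T" using t by simp
  have m: "0 \<le> m" using order_trans[OF norm_ge_zero bd[of 0]] T by simp
  define \<Phi> where "\<Phi> = (\<lambda>\<tau> \<omega> u. blinfun_apply (S (t - \<tau>)) (\<Psi> \<tau> \<omega> u))"
  have conv: "\<Phi> \<in> N2 M F Q t"
    unfolding \<Phi>_def by (rule convolution_integrand(1)[OF t S bd \<Psi>])
  have energy_le: "energy_of t \<Phi> \<omega> \<le> ennreal (m\<^sup>2) * energy_of T \<Psi> \<omega>" if "\<omega> \<in> space M" for \<omega>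
    unfolding \<Phi>_def by (rule convolution_integrand(2)[OF t S bd \<Psi> that])
  have cm\<Psi>: "cmeas T (\<lambda>x. \<Psi> (fst x) (snd x))" by (rule N2_cmeas[OF T \<Psi>])
  note [measurable] = energy_of_measurable[OF T cm\<Psi>]
  \<comment> \<open>Existence guarantees that the version selected by \<open>stoch_integral\<close>
    really is an integral.\<close>
  have "has_stoch_integral M F Q W t \<Phi> (stoch_convolution M F Q W S \<Psi> t)"
    unfolding stoch_convolution_def stoch_integral_def \<Phi>_def[symmetric]
    by (rule someI_ex[OF stoch_integral_exists[OF t(1) conv]])
  from stoch_integral_bound[OF t(1) this]
  have "(\<integral>\<^sup>+\<omega>. ennreal (norm (stoch_convolution M F Q W S \<Psi> t \<omega>)) \<partial>M) \<le>
      6 * (\<integral>\<^sup>+\<omega>. ennreal (sqrt (enn2real (energy_of t \<Phi> \<omega>))) \<partial>M)" .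
  also have "(\<integral>\<^sup>+\<omega>. ennreal (sqrt (enn2real (energy_of t \<Phi> \<omega>))) \<partial>M) \<le>
      (\<integral>\<^sup>+\<omega>. ennreal m * ennreal (sqrt (enn2real (energy_of T \<Psi> \<omega>))) \<partial>M)"
    using energy_finite_AE[OF energy_of_measurable[OF T cm\<Psi>] N2_energy_finite[OF \<Psi>]] AE_space
  proof (intro nn_integral_mono_AE, eventually_elim)
    fix \<omega> assume fin: "energy_of T \<Psi> \<omega> < \<infinity>" and \<omega>: "\<omega> \<in> space M"
    obtain c where c: "energy_of T \<Psi> \<omega> = ennreal c" "0 \<le> c" using fin by (cases "energy_of T \<Psi> \<omega>") auto
    have "energy_of t \<Phi> \<omega> \<le> ennreal (m\<^sup>2 * c)" using energy_le[OF \<omega>] c by (simp add: ennreal_mult)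
    then have "enn2real (energy_of t \<Phi> \<omega>) \<le> m\<^sup>2 * c" using c by (intro enn2real_leI) auto
    then have "sqrt (enn2real (energy_of t \<Phi> \<omega>)) \<le> sqrt (m\<^sup>2 * c)" by (rule real_sqrt_le_mono)
    then have "sqrt (enn2real (energy_of t \<Phi> \<omega>)) \<le> m * sqrt c" using m by (simp add: real_sqrt_mult)
    then show "ennreal (sqrt (enn2real (energy_of t \<Phi> \<omega>))) \<le> ennreal m * ennreal (sqrt (enn2real (energy_of T \<Psi> \<omega>)))"
      using m c by (simp add: ennreal_leI flip: ennreal_mult)
  qed
  also have "\<dots> = ennreal m * (\<integral>\<^sup>+\<omega>. ennreal (sqrt (enn2real (energy_of T \<Psi> \<omega>))) \<partial>M)"
    by (rule nn_integral_cmult) measurable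
  also have "6 * \<dots> = ennreal (6 * m) * (\<integral>\<^sup>+\<omega>. ennreal (sqrt (enn2real (energy_of T \<Psi> \<omega>))) \<partial>M)"
    using m by (simp add: ennreal_mult mult.assoc)
  finally show ?thesis by (simp add: mult_left_mono)
qed

text \<open>Links the extended integrals of the proof to the real ones of the final statement. A
  real integral would be 0 for a non-integrable function, so integrability of the root energy has to
  be secured.\<close>

lemma energy_expectation:
  fixes \<Psi> :: "real \<Rightarrow> 'w \<Rightarrow> 'u \<Rightarrow> 'h::{real_inner, banach, second_countable_topology}"
  assumes T: "0 \<le> T" and \<Psi>: "\<Psi> \<in> N2 M F Q T"
  shows "(\<integral>\<^sup>+\<omega>. ennreal (sqrt (enn2real (energy_of T \<Psi> \<omega>))) \<partial>M) =
    ennreal (\<integral>\<omega>. sqrt (LINT t:{0..T}|lborel. (hs (\<Psi> t \<omega>))\<^sup>2) \<partial>M)"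
proof -
  have cm: "cmeas T (\<lambda>x. \<Psi> (fst x) (snd x))" by (rule N2_cmeas[OF T \<Psi>])
  note [measurable] = energy_of_measurable[OF T cm]
  \<comment> \<open>This holds also on paths of infinite energy, where both sides take the default
    value 0.\<close>
  have inner: "(LINT t:{0..T}|lborel. (hs (\<Psi> t \<omega>))\<^sup>2) = enn2real (energy_of T \<Psi> \<omega>)" if \<omega>: "\<omega> \<in> space M" for \<omega>
  proof -
    let ?f = "\<lambda>\<tau>. indicator {0..T} \<tau> * (hs (\<Psi> \<tau> \<omega>))\<^sup>2"
    have eq: "ennreal (?f \<tau>) = ennreal ((hs (\<Psi> \<tau> \<omega>))\<^sup>2) * indicator {0..T} \<tau>" for \<tau>
      by (auto simp: indicator_def)
    have "(\<lambda>\<tau>. enn2real (ennreal (?f \<tau>))) \<in> borel_measurable lborel"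
      unfolding eq by (intro borel_measurable_enn2real nu_section_measurable T cm \<omega>)
    then have "?f \<in> borel_measurable lborel" by simp
    then show ?thesis
      unfolding set_lebesgue_integral_def energy_of_def real_scaleR_def
      by (subst integral_eq_nn_integral) (auto simp: eq)
  qed
  have "(\<integral>\<omega>. sqrt (LINT t:{0..T}|lborel. (hs (\<Psi> t \<omega>))\<^sup>2) \<partial>M) = (\<integral>\<omega>. sqrt (enn2real (energy_of T \<Psi> \<omega>)) \<partial>M)"
    by (rule Bochner_Integration.integral_cong) (auto simp: inner)
  also have "\<dots> = enn2real (\<integral>\<^sup>+\<omega>. ennreal (sqrt (enn2real (energy_of T \<Psi> \<omega>))) \<partial>M)"
    by (rule integral_eq_nn_integral) auto
  finally have *: "(\<integral>\<omega>. sqrt (LINT t:{0..T}|lborel. (hs (\<Psi> t \<omega>))\<^sup>2) \<partial>M) =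
      enn2real (\<integral>\<^sup>+\<omega>. ennreal (sqrt (enn2real (energy_of T \<Psi> \<omega>))) \<partial>M)" .
  \<comment> \<open>By Jensen the squared mean of the root energy is at most the mean energy, which
    is finite by membership in \<open>N2\<close>.\<close>
  have "(\<integral>\<^sup>+\<omega>. ennreal (sqrt (enn2real (energy_of T \<Psi> \<omega>))) \<partial>M)\<^sup>2 < \<infinity>"
    using nn_integral_sqrt_square_le[OF energy_of_measurable[OF T cm]] N2_energy_finite[OF \<Psi>] by (rule order.strict_trans1)
  then have "(\<integral>\<^sup>+\<omega>. ennreal (sqrt (enn2real (energy_of T \<Psi> \<omega>))) \<partial>M) < \<infinity>"
    by (auto simp: power2_eq_square ennreal_mult_less_top)
  then show ?thesis unfolding * by (simp add: less_top)
qed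

end

text \<open>The constant is chosen before all data. On the left the expectations and their supremum
  are taken in \<open>ennreal\<close>, so finiteness of the first moments is part of the
  conclusion.\<close>

theorem theorem3:
  shows "\<exists>C::real. C > 0 \<and>
    (\<forall>(M :: 'w measure) F
      (Q :: 'u::{real_inner, banach, second_countable_topology} \<Rightarrow>\<^sub>L 'u) K e lam \<beta> W
      (D :: 'h::{real_inner, banach, second_countable_topology} set) A a S
      (T :: real) (\<Psi> :: real \<Rightarrow> 'w \<Rightarrow> 'u \<Rightarrow> 'h).
      cylindrical_wiener M F Q K e lam \<beta> W \<longrightarrow>
      volterra_resolvent D A a S \<longrightarrow>
      0 \<le> T \<longrightarrow>
      \<Psi> \<in> N2 M F Q T \<longrightarrow>
      (SUP t\<in>{0..T}. \<integral>\<^sup>+\<omega>. ennreal (norm (stoch_convolution M F Q W S \<Psi> t \<omega>)) \<partial>M)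
        \<le> ennreal (C * (SUP t\<in>{0..T}. norm (S t)) *
            (\<integral>\<omega>. sqrt (LINT t:{0..T}|lborel. (hs_norm Q (\<Psi> t \<omega>))\<^sup>2) \<partial>M)))"
proof (intro exI[of _ 6] conjI allI impI)
  fix M :: "'w measure" and F and Q :: "'u \<Rightarrow>\<^sub>L 'u" and K e lam \<beta> W and D :: "'h set" and A a S
    and T :: real and \<Psi> :: "real \<Rightarrow> 'w \<Rightarrow> 'u \<Rightarrow> 'h"
  assume cw: "cylindrical_wiener M F Q K e lam \<beta> W" and "volterra_resolvent D A a S"
    and T: "0 \<le> T" and \<Psi>: "\<Psi> \<in> N2 M F Q T"
  then have S: "continuous_on {0..} (\<lambda>t. blinfun_apply (S t) x)" for x
    by (simp add: volterra_resolvent_def)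
  interpret cylindrical_wiener M F Q K e lam \<beta> W by (rule cw)
  define m where "m = (SUP t\<in>{0..T}. norm (S t))"
  define I where "I = (\<integral>\<omega>. sqrt (LINT t:{0..T}|lborel. (hs_norm Q (\<Psi> t \<omega>))\<^sup>2) \<partial>M)"
  have bd: "norm (S \<tau>) \<le> m" if "\<tau> \<in> {0..T}" for \<tau>
    \<comment> \<open>A real supremum bounds its members only for a bounded set, which uniform
      boundedness provides.\<close>
    unfolding m_def using that strongly_continuous_bounded[OF S] by (rule cSUP_upper)
  have m: "0 \<le> m" using order_trans[OF norm_ge_zero bd[of 0]] T by simp
  show "(SUP t\<in>{0..T}. \<integral>\<^sup>+\<omega>. ennreal (norm (stoch_convolution M F Q W S \<Psi> t \<omega>)) \<partial>M) \<le> ennreal (6 * m * I)"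
  proof (rule SUP_least)
    fix t assume "t \<in> {0..T}"
    then have "(\<integral>\<^sup>+\<omega>. ennreal (norm (stoch_convolution M F Q W S \<Psi> t \<omega>)) \<partial>M) \<le>
        ennreal (6 * m) * (\<integral>\<^sup>+\<omega>. ennreal (sqrt (enn2real (energy_of T \<Psi> \<omega>))) \<partial>M)"
      by (intro stoch_convolution_bound S bd \<Psi>) auto
    also have "\<dots> = ennreal (6 * m) * ennreal I"
      unfolding I_def by (simp only: energy_expectation[OF T \<Psi>])
    also have "\<dots> = ennreal (6 * m * I)"
      using m by (simp only: ennreal_mult')
    finally show "(\<integral>\<^sup>+\<omega>. ennreal (norm (stoch_convolution M F Q W S \<Psi> t \<omega>)) \<partial>M) \<le> ennreal (6 * m * I)" .
  qed
qed simp

end
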